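(* Let $R$ be an F-finite domain and $\mathscr{D}$ a Cartier subalgebra of $R$. Then the F-signature function $\operatorname{Spec}(R)\to\mathbb{R}$, $P\mapsto s(P,\mathscr{D})$, is lower semi-continuous. Moreover, if $\mathscr{D}$ satisfies $$\left(I^{\mathscr{D}}_q(P)\right)^{[p]}\subseteq I^{\mathscr{D}}_{qp}(P)\quad\text{for all } P\in\operatorname{Spec}(R)\text{ and all } q=p^e,\ e\ge 0,$$ then the functions $P\mapsto s_q(P,\mathscr{D})$ converge uniformly on $\operatorname{Spec}(R)$ to the function $P\mapsto s(P,\mathscr{D})$ as $q\in\Gamma_{\mathscr{D}}$, $q\to\infty$.
   Context: All rings are commutative, Noetherian, with identity, of prime characteristic $p$, and F-finite (finite as modules over themselves via Frobenius $r\mapsto r^p$). $q=p^e$, $e\geq 0$; for $q=p^e$, $F^q_*R$ denotes $R$ viewed as an $R$-module via the $e$th iterate of Frobenius. $J^{[p]}$ is the ideal generated by $p$th powers of elements of $J$. Cartier algebras: let $\mathscr{C}_q=\operatorname{Hom}_R(F^q_*R,R)$ and $\mathscr{C}^R=\bigoplus_{q=p^e,e\ge0}\mathscr{C}_q$, with multiplication $\varphi\cdot\psi=\varphi\circ F^q_*\psi\in\mathscr{C}_{qq'}$ for $\varphi\in\mathscr{C}_q,\psi\in\mathscr{C}_{q'}$, where $F^q_*\psi(F^{qq'}_*r)=F^q_*\psi(F^{q'}_*r)$. A Cartier subalgebra of $R$ is a graded $\mathbb{F}_p$-subalgebra $\mathscr{D}=\bigoplus_q\mathscr{D}_q\subseteq\mathscr{C}^R$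 with $\mathscr{D}_1=\mathscr{C}_1=\operatorname{Hom}_R(R,R)\cong R$. For $P\in\operatorname{Spec}(R)$, $\mathscr{D}_P$ is the induced Cartier subalgebra of $R_P$ with $(\mathscr{D}_P)_q=(\mathscr{D}_q)_P\subseteq\operatorname{Hom}_{R_P}(F^q_*R_P,R_P)$. Splitting numbers: for a local ring $(S,\mathfrak m,k)$ with Cartier subalgebra $\mathscr{E}$, a summand $M_i$ in a direct sum decomposition $F^q_*S\cong\bigoplus M_i$ is an $\mathscr{E}$-summand if $M_i\cong S$ and the projection $F^q_*S\to M_i\cong S$ is an element of $\mathscr{E}_q$. The $q$th F-splitting number $a_q^{\mathscr{E}}$ of $(S,\mathscr{E})$ is the maximal number of $\mathscr{E}$-summands appearing in direct sum decompositions of $F^q_*S$. Let $\alpha(S)=\log_p[k^{1/p}:k]$ and $\Gamma_{\mathscr{E}}=\{q\mid a_q^{\mathscr{E}}\neq0\}$, a semigroup. The F-signature of the pair is $s(S,\mathscr{E})=\lim_{q\in\Gamma_{\mathscr{E}},\,q\to\infty}\frac{a_q^{\mathscr{E}}}{q^{\alpha(S)+\dim(S)}}$, which exists (Blickle-Schwede-Tucker); if $\Gamma_{\mathscr{E}}=\{1\}$, it is taken to be $0$. Global notation: $a_q(P,\mathscr{D})$ is the $q$th F-splitting number of $(R_P,\mathscr{D}_P)$, $\alpha(P)=\alpha(R_P)$, $s_q(P,\mathscr{D})=a_q(P,\mathscr{D})/q^{\alpha(P)+\operatorname{ht}(P)}$, $s(P,\mathscr{D})=s(R_P,\mathscr{D}_P)$,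 and $$I^{\mathscr{D}}_q(P)=\{r\in R_P\mid \varphi(F^q_*r)\in PR_P\text{ for all }\varphi\in(\mathscr{D}_P)_q\},$$ an ideal of $R_P$. For the domain $R$, $\Gamma_{\mathscr{D}}$ denotes $\Gamma_{\mathscr{D}_{(0)}}$, the semigroup of the pair obtained by localizing at the zero prime. A function $f:X\to\mathbb{R}$ on a topological space is lower semi-continuous if $\{x\mid f(x)>r\}$ is open for every $r\in\mathbb{R}$. *)

theory Defs
  imports "HOL-Analysis.Analysis" "HOL-Algebra.Algebra"
begin

section \<open>Spectrum, heights and localization\<close>

definition Spec :: "('a, 'm) ring_scheme \<Rightarrow> 'a set set" where
  "Spec R = {P. primeideal P R}"

definition zariski :: "('a, 'm) ring_scheme \<Rightarrow> 'a set topology" where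
  "zariski R = topology (\<lambda>U. \<exists>A \<subseteq> carrier R. U = {P \<in> Spec R. \<not> A \<subseteq> P})"

lemma openin_zariski:
  assumes "cring R"
  shows "openin (zariski R) U \<longleftrightarrow> (\<exists>A \<subseteq> carrier R. U = {P \<in> Spec R. \<not> A \<subseteq> P})"
proof -
  interpret cring R by fact
  define op where "op = (\<lambda>U. \<exists>A \<subseteq> carrier R. U = {P \<in> Spec R. \<not> A \<subseteq> P})"
  have inter: "op (U \<inter> V)" if U: "op U" and V: "op V" for U V
  proof -
    obtain A where A: "A \<subseteq> carrier R" "U = {P \<in> Spec R. \<not> A \<subseteq> P}"
      using U unfolding op_def by blast
    obtain B where B: "B \<subseteq> carrier R" "V = {P \<in> Spec R. \<not> B \<subseteq> P}"
      using V unfolding op_def by blast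
    define C where "C = (\<lambda>(a, b). a \<otimes>\<^bsub>R\<^esub> b) ` (A \<times> B)"
    have eq: "C \<subseteq> P \<longleftrightarrow> A \<subseteq> P \<or> B \<subseteq> P" if P: "P \<in> Spec R" for P
    proof
      assume CP: "C \<subseteq> P"
      show "A \<subseteq> P \<or> B \<subseteq> P"
      proof (rule ccontr)
        assume "\<not> (A \<subseteq> P \<or> B \<subseteq> P)"
        then obtain a b where ab: "a \<in> A" "a \<notin> P" "b \<in> B" "b \<notin> P" by blast
        then have "a \<otimes>\<^bsub>R\<^esub> b \<in> P" using CP unfolding C_def by force
        moreover have "a \<in> carrier R" "b \<in> carrier R" using ab A(1) B(1) by auto
        ultimately show False
          using primeideal.I_prime[of P R a b] P ab by (simp add: Spec_def)
      qed
    next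
      assume AB: "A \<subseteq> P \<or> B \<subseteq> P"
      have "ideal P R" using P by (simp add: Spec_def primeideal.axioms(1))
      show "C \<subseteq> P"
      proof
        fix c assume "c \<in> C"
        then obtain a b where ab: "a \<in> A" "b \<in> B" "c = a \<otimes>\<^bsub>R\<^esub> b"
          unfolding C_def by force
        then have car: "a \<in> carrier R" "b \<in> carrier R" using A(1) B(1) by auto
        from AB ab consider "a \<in> P" | "b \<in> P" by blast
        then show "c \<in> P"
        proof cases
          case 1
          then show ?thesis
            using ideal.I_r_closed[OF \<open>ideal P R\<close> 1 car(2)] ab(3) by simp
        next
          case 2
          then show ?thesis
            using ideal.I_l_closed[OF \<open>ideal P R\<close> 2 car(1)] ab(3) by simp
        qed
      qed
    qed
    have "U \<inter> V = {P \<in> Spec R. \<not> C \<subseteq> P}" unfolding A(2) B(2) using eq by auto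
    moreover have "C \<subseteq> carrier R" unfolding C_def using A(1) B(1) by auto
    ultimately show ?thesis unfolding op_def by (intro exI conjI)
  qed
  have union: "op (\<Union>K)" if K: "\<forall>U\<in>K. op U" for K
  proof -
    define A where "A = \<Union>{A. A \<subseteq> carrier R \<and> {P \<in> Spec R. \<not> A \<subseteq> P} \<in> K}"
    have "P \<in> \<Union>K \<longleftrightarrow> P \<in> Spec R \<and> \<not> A \<subseteq> P" for P
    proof
      assume "P \<in> \<Union>K"
      then obtain U where "U \<in> K" "P \<in> U" by blast
      moreover from K \<open>U \<in> K\<close> have "op U" by (rule bspec)
      then obtain B where "B \<subseteq> carrier R" "U = {P \<in> Spec R. \<not> B \<subseteq> P}"
        unfolding op_def by blast
      ultimately have "P \<in> Spec R" "\<not> B \<subseteq> P" "B \<subseteq> A" unfolding A_def by auto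
      then show "P \<in> Spec R \<and> \<not> A \<subseteq> P" by blast
    next
      assume "P \<in> Spec R \<and> \<not> A \<subseteq> P"
      then obtain B where "\<not> B \<subseteq> P" "{P \<in> Spec R. \<not> B \<subseteq> P} \<in> K" "P \<in> Spec R"
        unfolding A_def by auto
      then show "P \<in> \<Union>K" by blast
    qed
    then have "\<Union>K = {P \<in> Spec R. \<not> A \<subseteq> P}" by auto
    moreover have "A \<subseteq> carrier R" unfolding A_def by auto
    ultimately show ?thesis unfolding op_def by (intro exI conjI)
  qed
  have "istopology op" unfolding istopology_def using inter union by (intro conjI allI impI)
  then have "openin (topology op) = op" by (rule topology_inverse')
  then show ?thesis unfolding zariski_def op_def by simp
qed

lemma topspace_zariski:
  assumes "cring R"
  shows "topspace (zariski R) = Spec R"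
proof
  have "\<not> carrier R \<subseteq> P" if "P \<in> Spec R" for P
  proof
    assume "carrier R \<subseteq> P"
    moreover have P: "primeideal P R" using that by (simp add: Spec_def)
    then have "P \<subseteq> carrier R"
      by (intro additive_subgroup.a_subset ideal.axioms(1) primeideal.axioms(1))
    ultimately show False using primeideal.I_notcarr[OF P] by simp
  qed
  then have "openin (zariski R) (Spec R)"
    unfolding openin_zariski[OF assms] by (intro exI[of _ "carrier R"]) auto
  then show "Spec R \<subseteq> topspace (zariski R)" by (rule openin_subset)
  have "openin (zariski R) (topspace (zariski R))" by simp
  then show "topspace (zariski R) \<subseteq> Spec R"
    unfolding openin_zariski[OF assms] by auto
qed

definition lower_semicontinuous :: "'x topology \<Rightarrow> ('x \<Rightarrow> real) \<Rightarrow> bool" where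
  "lower_semicontinuous T f \<longleftrightarrow> (\<forall>r. openin T {x \<in> topspace T. f x > r})"

definition prime_chain :: "('a, 'm) ring_scheme \<Rightarrow> nat \<Rightarrow> (nat \<Rightarrow> 'a set) \<Rightarrow> bool" where
  "prime_chain R n Q \<longleftrightarrow> (\<forall>i\<le>n. Q i \<in> Spec R) \<and> (\<forall>i<n. Q i \<subset> Q (Suc i))"

definition krull_dim :: "('a, 'm) ring_scheme \<Rightarrow> enat" where
  "krull_dim R = Sup {enat n | n Q. prime_chain R n Q}"

definition ht :: "('a, 'm) ring_scheme \<Rightarrow> 'a set \<Rightarrow> enat" where
  "ht R P = Sup {enat n | n Q. prime_chain R n Q \<and> Q n = P}"

text \<open>The fraction \<open>a/s\<close> in \<open>R\<^sub>P\<close>, as an equivalence class of pairs.\<close>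

definition loc_frac :: "('a, 'm) ring_scheme \<Rightarrow> 'a set \<Rightarrow> 'a \<Rightarrow> 'a \<Rightarrow> ('a \<times> 'a) set" where
  "loc_frac R P a s = {(b, t). b \<in> carrier R \<and> t \<in> carrier R - P \<and>
     (\<exists>u \<in> carrier R - P. u \<otimes>\<^bsub>R\<^esub> (a \<otimes>\<^bsub>R\<^esub> t \<ominus>\<^bsub>R\<^esub> b \<otimes>\<^bsub>R\<^esub> s) = \<zero>\<^bsub>R\<^esub>)}"

text \<open>As for \<^const>\<open>rcoset_mult\<close>, the operations on classes are unions over all representatives;
  the sets in each union coincide.\<close>

definition localization :: "('a, 'm) ring_scheme \<Rightarrow> 'a set \<Rightarrow> ('a \<times> 'a) set ring" where
  "localization R P =
    \<lparr>carrier = {loc_frac R P a s | a s. a \<in> carrier R \<and> s \<in> carrier R - P},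
     monoid.mult = (\<lambda>A B. \<Union>(a, s)\<in>A. \<Union>(b, t)\<in>B. loc_frac R P (a \<otimes>\<^bsub>R\<^esub> b) (s \<otimes>\<^bsub>R\<^esub> t)),
     one = loc_frac R P \<one>\<^bsub>R\<^esub> \<one>\<^bsub>R\<^esub>,
     ring.zero = loc_frac R P \<zero>\<^bsub>R\<^esub> \<one>\<^bsub>R\<^esub>,
     add = (\<lambda>A B. \<Union>(a, s)\<in>A. \<Union>(b, t)\<in>B.
        loc_frac R P (a \<otimes>\<^bsub>R\<^esub> t \<oplus>\<^bsub>R\<^esub> b \<otimes>\<^bsub>R\<^esub> s) (s \<otimes>\<^bsub>R\<^esub> t))\<rparr>"

definition extended_prime :: "('a, 'm) ring_scheme \<Rightarrow> 'a set \<Rightarrow> ('a \<times> 'a) set set" where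
  "extended_prime R P = {loc_frac R P a s | a s. a \<in> P \<and> s \<in> carrier R - P}"


section \<open>Modules and Frobenius pushforwards\<close>

definition self_module :: "('a, 'm) ring_scheme \<Rightarrow> ('a, 'a) module" where
  "self_module R = \<lparr>carrier = carrier R, monoid.mult = monoid.mult R, one = monoid.one R,
     ring.zero = ring.zero R, add = ring.add R,
     smult = monoid.mult R\<rparr>"

text \<open>\<open>F\<^sup>q\<^sub>*R\<close>, for \<open>q\<close> a power of the characteristic.\<close>

definition frob_push :: "('a, 'm) ring_scheme \<Rightarrow> nat \<Rightarrow> ('a, 'a) module" where
  "frob_push R q = \<lparr>carrier = carrier R, monoid.mult = monoid.mult R, one = monoid.one R,
     ring.zero = ring.zero R, add = ring.add R,
     smult = (\<lambda>r x. (r [^]\<^bsub>R\<^esub> q) \<otimes>\<^bsub>R\<^esub> x)\<rparr>"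

definition module_generated_by :: "('a, 'm) ring_scheme \<Rightarrow> ('a, 'b) module \<Rightarrow> 'b set \<Rightarrow> bool" where
  "module_generated_by R M B \<longleftrightarrow> B \<subseteq> carrier M \<and>
     (\<forall>N. submodule N R M \<and> B \<subseteq> N \<longrightarrow> N = carrier M)"

definition F_finite :: "nat \<Rightarrow> ('a, 'm) ring_scheme \<Rightarrow> bool" where
  "F_finite p R \<longleftrightarrow> (\<exists>B. finite B \<and> module_generated_by R (frob_push R p) B)"

definition mod_hom ::
  "('a, 'm) ring_scheme \<Rightarrow> ('a, 'b) module \<Rightarrow> ('a, 'c) module \<Rightarrow> ('b \<Rightarrow> 'c) set" where
  "mod_hom R M N = {f \<in> carrier M \<rightarrow>\<^sub>E carrier N.
     (\<forall>x\<in>carrier M. \<forall>y\<in>carrier M. f (x \<oplus>\<^bsub>M\<^esub> y) = f x \<oplus>\<^bsub>N\<^esub> f y) \<and>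
     (\<forall>r\<in>carrier R. \<forall>x\<in>carrier M. f (r \<odot>\<^bsub>M\<^esub> x) = r \<odot>\<^bsub>N\<^esub> f x)}"

definition mod_iso ::
  "('a, 'm) ring_scheme \<Rightarrow> ('a, 'b) module \<Rightarrow> ('a, 'c) module \<Rightarrow> ('b \<Rightarrow> 'c) set" where
  "mod_iso R M N = {f \<in> mod_hom R M N. bij_betw f (carrier M) (carrier N)}"

text \<open>Internal direct sum decompositions. The modules decomposed below are finitely generated, so
  only finitely many summands are nonzero and finite families suffice.\<close>

definition direct_sum_decomp ::
  "('a, 'm) ring_scheme \<Rightarrow> ('a, 'b) module \<Rightarrow> nat \<Rightarrow> (nat \<Rightarrow> 'b set) \<Rightarrow> bool" where
  "direct_sum_decomp R M n N \<longleftrightarrow> (\<forall>i<n. submodule (N i) R M) \<and>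
     (\<forall>x\<in>carrier M. \<exists>!f. f \<in> (\<Pi>\<^sub>E i\<in>{..<n}. N i) \<and> x = finsum M f {..<n})"

definition summand_proj :: "('a, 'b) module \<Rightarrow> nat \<Rightarrow> (nat \<Rightarrow> 'b set) \<Rightarrow> nat \<Rightarrow> 'b \<Rightarrow> 'b" where
  "summand_proj M n N i x =
     (THE f. f \<in> (\<Pi>\<^sub>E i\<in>{..<n}. N i) \<and> x = finsum M f {..<n}) i"


section \<open>Cartier algebras\<close>

text \<open>A graded object indexed by the powers \<open>q\<close> of \<open>p\<close> is a function on \<^typ>\<open>nat\<close>
  of which only the values at elements of \<open>ppowers p\<close> matter.\<close>

definition ppowers :: "nat \<Rightarrow> nat set" where
  "ppowers p = range (\<lambda>e. p ^ e)"

definition cartier_hom :: "('a, 'm) ring_scheme \<Rightarrow> nat \<Rightarrow> ('a \<Rightarrow> 'a) set" where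
  "cartier_hom R q = mod_hom R (frob_push R q) (self_module R)"

text \<open>The scalar \<open>n mod p\<close> of the prime field acts as multiplication by the integer \<open>n\<close>.
  The product \<open>\<phi> \<cdot> \<psi>\<close> is \<^term>\<open>compose (carrier R) \<phi> \<psi>\<close> on underlying sets, and the
  unit of the algebra lies in \<open>D 1 = cartier_hom R 1\<close>.\<close>

definition cartier_subalgebra ::
  "nat \<Rightarrow> ('a, 'm) ring_scheme \<Rightarrow> (nat \<Rightarrow> ('a \<Rightarrow> 'a) set) \<Rightarrow> bool" where
  "cartier_subalgebra p R D \<longleftrightarrow>
     (\<forall>q\<in>ppowers p. D q \<subseteq> cartier_hom R q \<and>
        (\<lambda>x\<in>carrier R. \<zero>\<^bsub>R\<^esub>) \<in> D q \<and>
        (\<forall>\<phi>\<in>D q. \<forall>\<psi>\<in>D q. (\<lambda>x\<in>carrier R. \<phi> x \<oplus>\<^bsub>R\<^esub> \<psi> x) \<in> D q) \<and>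
        (\<forall>\<phi>\<in>D q. \<forall>n::nat. (\<lambda>x\<in>carrier R. [n] \<cdot>\<^bsub>R\<^esub> \<phi> x) \<in> D q)) \<and>
     (\<forall>q\<in>ppowers p. \<forall>q'\<in>ppowers p. \<forall>\<phi>\<in>D q. \<forall>\<psi>\<in>D q'.
        compose (carrier R) \<phi> \<psi> \<in> D (q * q')) \<and>
     D 1 = cartier_hom R 1"

text \<open>The image of \<open>(D\<^sub>q)\<^sub>P\<close> in \<open>Hom(F\<^sup>q\<^sub>*R\<^sub>P, R\<^sub>P)\<close>: \<open>\<phi>/s\<close> is the unique
  \<open>R\<^sub>P\<close>-linear map sending \<open>x/1\<close> to \<open>\<phi>(x)/s\<close>.\<close>

definition cartier_localization ::
  "('a, 'm) ring_scheme \<Rightarrow> 'a set \<Rightarrow> (nat \<Rightarrow> ('a \<Rightarrow> 'a) set) \<Rightarrow>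
     nat \<Rightarrow> (('a \<times> 'a) set \<Rightarrow> ('a \<times> 'a) set) set" where
  "cartier_localization R P D q =
     {\<psi> \<in> cartier_hom (localization R P) q. \<exists>\<phi>\<in>D q. \<exists>s\<in>carrier R - P.
        \<forall>x\<in>carrier R. \<psi> (loc_frac R P x \<one>\<^bsub>R\<^esub>) = loc_frac R P (\<phi> x) s}"


section \<open>F-splitting numbers and F-signature of a local pair\<close>

definition is_E_summand ::
  "('a, 'm) ring_scheme \<Rightarrow> (nat \<Rightarrow> ('a \<Rightarrow> 'a) set) \<Rightarrow> nat \<Rightarrow> nat \<Rightarrow> (nat \<Rightarrow> 'a set) \<Rightarrow> nat \<Rightarrow> bool" where
  "is_E_summand S E q n M i \<longleftrightarrow>
     (\<exists>\<theta> \<in> mod_iso S ((frob_push S q)\<lparr>carrier := M i\<rparr>) (self_module S).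
        (\<lambda>x\<in>carrier S. \<theta> (summand_proj (frob_push S q) n M i x)) \<in> E q)"

definition splitting_number ::
  "('a, 'm) ring_scheme \<Rightarrow> (nat \<Rightarrow> ('a \<Rightarrow> 'a) set) \<Rightarrow> nat \<Rightarrow> nat" where
  "splitting_number S E q =
     Max {card {i. i < n \<and> is_E_summand S E q n M i} | n M. direct_sum_decomp S (frob_push S q) n M}"

definition residue_field :: "('a, 'm) ring_scheme \<Rightarrow> 'a set ring" where
  "residue_field S = S Quot (THE m. maximalideal m S)"

text \<open>Frobenius identifies the extension \<open>k \<subseteq> k\<^sup>1\<^sup>/\<^sup>p\<close> with \<open>k\<^sup>p \<subseteq> k\<close>.\<close>

definition alpha :: "nat \<Rightarrow> ('a, 'm) ring_scheme \<Rightarrow> real" where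
  "alpha p S = (let k = residue_field S in
     log (real p) (real (ring.dim k ((\<lambda>x. x [^]\<^bsub>k\<^esub> p) ` carrier k) (carrier k))))"

definition splitting_semigroup :: "nat \<Rightarrow> ('a, 'm) ring_scheme \<Rightarrow> (nat \<Rightarrow> ('a \<Rightarrow> 'a) set) \<Rightarrow> nat set" where
  "splitting_semigroup p S E = {q \<in> ppowers p. splitting_number S E q \<noteq> 0}"

definition F_signature ::
  "nat \<Rightarrow> ('a, 'm) ring_scheme \<Rightarrow> (nat \<Rightarrow> ('a \<Rightarrow> 'a) set) \<Rightarrow> real" where
  "F_signature p S E =
     (if splitting_semigroup p S E = {1} then 0
      else Lim (inf at_top (principal (splitting_semigroup p S E)))
             (\<lambda>q. real (splitting_number S E q) /
                  real q powr (alpha p S + real (the_enat (krull_dim S)))))"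


section \<open>Functions on the spectrum\<close>

definition a_at :: "('a, 'm) ring_scheme \<Rightarrow> (nat \<Rightarrow> ('a \<Rightarrow> 'a) set) \<Rightarrow> nat \<Rightarrow> 'a set \<Rightarrow> nat" where
  "a_at R D q P = splitting_number (localization R P) (cartier_localization R P D) q"

definition s_q_at ::
  "nat \<Rightarrow> ('a, 'm) ring_scheme \<Rightarrow> (nat \<Rightarrow> ('a \<Rightarrow> 'a) set) \<Rightarrow> nat \<Rightarrow> 'a set \<Rightarrow> real" where
  "s_q_at p R D q P =
     real (a_at R D q P) / real q powr (alpha p (localization R P) + real (the_enat (ht R P)))"

definition s_at ::
  "nat \<Rightarrow> ('a, 'm) ring_scheme \<Rightarrow> (nat \<Rightarrow> ('a \<Rightarrow> 'a) set) \<Rightarrow> 'a set \<Rightarrow> real" where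
  "s_at p R D P = F_signature p (localization R P) (cartier_localization R P D)"

definition splitting_ideal ::
  "('a, 'm) ring_scheme \<Rightarrow> (nat \<Rightarrow> ('a \<Rightarrow> 'a) set) \<Rightarrow> nat \<Rightarrow> 'a set \<Rightarrow> ('a \<times> 'a) set set" where
  "splitting_ideal R D q P =
     {r \<in> carrier (localization R P). \<forall>\<phi>\<in>cartier_localization R P D q. \<phi> r \<in> extended_prime R P}"

definition frobenius_power :: "nat \<Rightarrow> ('a, 'm) ring_scheme \<Rightarrow> 'a set \<Rightarrow> 'a set" where
  "frobenius_power p S J = Idl\<^bsub>S\<^esub> ((\<lambda>x. x [^]\<^bsub>S\<^esub> p) ` J)"

definition splitting_semigroup_domain ::
  "nat \<Rightarrow> ('a, 'm) ring_scheme \<Rightarrow> (nat \<Rightarrow> ('a \<Rightarrow> 'a) set) \<Rightarrow> nat set" where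
  "splitting_semigroup_domain p R D =
     splitting_semigroup p (localization R {\<zero>\<^bsub>R\<^esub>}) (cartier_localization R {\<zero>\<^bsub>R\<^esub>} D)"

end

theory Submission
  imports Defs
begin

text \<open>
  Everything is done inside \<open>R\<close>, with lengths of localized modules over \<open>R\<^sub>P\<close>. The splitting number of \<open>q\<close> at \<open>P\<close>
  is the length of \<open>F\<^sup>q\<^sub>*R/I\<^sub>q(P)\<close> at \<open>P\<close>, and it is at least \<open>n\<close> iff there are \<open>\<phi>\<^sub>i \<in> \<D>\<^sub>q\<close> and
  \<open>x\<^sub>i \<in> R\<close> with \<open>\<phi>\<^sub>i(x\<^sub>k) = \<delta>\<^sub>i\<^sub>k s\<close>, \<open>s \<notin> P\<close>, \<open>i, k \<le> n\<close>; this is an open condition on \<open>P\<close>.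

  By Kunz, \<open>\<alpha>(P) + ht P\<close> is constant: for primes \<open>Q \<subset> P\<close> with nothing in between, two computations of a length over
  the one-dimensional domain \<open>(R/Q)\<^sub>P\<close> give \<open>[\<kappa>(Q) : \<kappa>(Q)\<^sup>p] = p [\<kappa>(P) : \<kappa>(P)\<^sup>p]\<close>. Write \<open>r = [K : K\<^sup>p]\<close> for
  the fraction field \<open>K\<close>. Noetherian induction then bounds the number of generators of \<open>F\<^sup>q\<^sub>*(R/c)\<close> over \<open>R\<close>, for
  \<open>q = p\<^sup>e\<close> and \<open>c \<noteq> 0\<close>, by \<open>C (r/p)\<^sup>e\<close>, which makes all error terms uniform in \<open>P\<close>.

  A nonzero element of \<open>\<D>\<^sub>q\<^sub>'\<close> splits a free submodule of full rank off \<open>F\<^sup>q\<^sup>'\<^sub>*R\<close> up to torsion. Since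
  \<open>\<D>\<^sub>q \<D>\<^sub>q\<^sub>' \<subseteq> \<D>\<^sub>q\<^sub>q\<^sub>'\<close>, this gives \<open>s\<^sub>q \<le> s\<^sub>q\<^sub>q\<^sub>' + C/q\<close> on \<open>Spec R\<close>, so the limit along \<open>\<Gamma>\<^sub>\<D>\<close> exists
  everywhere and \<open>s \<ge> s\<^sub>q - C/q\<close>, whence lower semicontinuity. The condition on Frobenius powers gives
  \<open>s\<^sub>q\<^sub>p \<le> s\<^sub>q + C/q\<close> by the same argument with a free submodule of \<open>F\<^sub>*R\<close>, so that \<open>\<bar>s - s\<^sub>q\<bar> \<le> C/q\<close>.
\<close>


text \<open>A submodule of F^q_*R is a subset of R closed under sums and under multiplication by
  q-th powers, so the modules for all q live in one set. For fixed u, the map that sends y to y^q' u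
  is semilinear from one exponent to a larger one, and comparisons of lengths between different q go
  through such maps.

  Uniformity in P has a simple source: generators are counted over R, once, and their number bounds
  the length at every P of each quotient on which the q-th powers of elements of P act as zero. The
  normalizing factor of s_q is r^e at every prime, so an error C (r/p)^e turns into C/q.

  In the inequality between s_q and s_qq' the constant depends on q' at first. Every exponent of the
  semigroup is one of finitely many plus a multiple of a fixed positive one, and along these
  multiples the errors form a geometric series; this removes the dependence. The limit is then the
  supremum of s_q - C/q, since two exponents of the semigroup differ by a third once they are far
  apart.\<close>

no_notation Sum_Type.Plus (infixr "<+>" 65)

section \<open>Frobenius powers\<close>

lemma (in cring) add_power_binomial:
  assumes a: "a \<in> carrier R" and b: "b \<in> carrier R"
  shows "(a \<oplus> b) [^] (n::nat) = (\<Oplus>k\<in>{..n}. [(n choose k)] \<cdot> (a [^] k \<otimes> b [^] (n - k)))"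
proof (induction n)
  case 0
  then show ?case using a b by simp
next
  case (Suc n)
  let ?f = "\<lambda>n k. [(n choose k)] \<cdot> (a [^] k \<otimes> b [^] (n - k))"
  have f: "?f m k \<in> carrier R" for m k using a b by simp
  have la: "?f n k \<otimes> a = [(n choose k)] \<cdot> (a [^] Suc k \<otimes> b [^] (n - k))" for k
    using a b by (simp add: add_pow_ldistr add_pow_rdistr m_ac)
  have lb: "?f n k \<otimes> b = [(n choose k)] \<cdot> (a [^] k \<otimes> b [^] (Suc n - k))" if "k \<le> n" for k
    using a b that by (simp add: add_pow_ldistr add_pow_rdistr m_ac Suc_diff_le)
  have "(a \<oplus> b) [^] Suc n = (\<Oplus>k\<in>{..n}. ?f n k) \<otimes> (a \<oplus> b)"
    using Suc a b by simp
  also have "\<dots> = (\<Oplus>k\<in>{..n}. ?f n k \<otimes> a) \<oplus> (\<Oplus>k\<in>{..n}. ?f n k \<otimes> b)"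
    using a b f by (simp add: r_distr finsum_ldistr)
  also have "(\<Oplus>k\<in>{..n}. ?f n k \<otimes> b)
      = (\<Oplus>k\<in>{..n}. [(n choose k)] \<cdot> (a [^] k \<otimes> b [^] (Suc n - k)))"
    using a b lb by (intro finsum_cong') auto
  also have "\<dots> = (\<Oplus>k\<in>{..Suc n}. [(n choose k)] \<cdot> (a [^] k \<otimes> b [^] (Suc n - k)))"
    using a b by (simp add: finsum_Suc binomial_eq_0)
  also have "\<dots> = (\<Oplus>k\<in>{..n}. [(n choose Suc k)] \<cdot> (a [^] Suc k \<otimes> b [^] (n - k)))
      \<oplus> ([(1::nat)] \<cdot> (a [^] (0::nat) \<otimes> b [^] Suc n))"
    using a b by (subst finsum_Suc2) auto
  also have "(\<Oplus>k\<in>{..n}. ?f n k \<otimes> a)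
      = (\<Oplus>k\<in>{..n}. [(n choose k)] \<cdot> (a [^] Suc k \<otimes> b [^] (n - k)))"
    using la by simp
  also have "\<dots> \<oplus> ((\<Oplus>k\<in>{..n}. [(n choose Suc k)] \<cdot> (a [^] Suc k \<otimes> b [^] (n - k)))
      \<oplus> ([(1::nat)] \<cdot> (a [^] (0::nat) \<otimes> b [^] Suc n)))
    = (\<Oplus>k\<in>{..n}. [(n choose k)] \<cdot> (a [^] Suc k \<otimes> b [^] (n - k))
        \<oplus> [(n choose Suc k)] \<cdot> (a [^] Suc k \<otimes> b [^] (n - k)))
      \<oplus> ([(1::nat)] \<cdot> (a [^] (0::nat) \<otimes> b [^] Suc n))"
    using a b by (subst finsum_addf) (auto simp: a_assoc)
  also have "\<dots> = (\<Oplus>k\<in>{..n}. ?f (Suc n) (Suc k)) \<oplus> ?f (Suc n) 0"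
    using a b by (simp add: add.nat_pow_mult)
  also have "\<dots> = (\<Oplus>k\<in>{..Suc n}. ?f (Suc n) k)"
    using f by (subst finsum_Suc2) auto
  finally show ?case .
qed

lemma (in cring) one_notin_prime: "primeideal P R \<Longrightarrow> \<one> \<in> carrier R - P"
  using ideal.one_imp_carrier primeideal.I_notcarr primeideal.axioms(1) by (metis DiffI one_closed)

lemma (in cring) mult_notin_prime:
  "primeideal P R \<Longrightarrow> s \<in> carrier R - P \<Longrightarrow> t \<in> carrier R - P \<Longrightarrow> s \<otimes> t \<in> carrier R - P"
  using primeideal.I_prime[of P R s t] by blast

text \<open>Lengths enter as suprema of chain lengths, so two of them are compared through the
  natural numbers below them; infinite lengths then need no separate treatment.\<close>

lemma enat_le_by_nats:
  fixes x y :: enat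
  assumes "\<And>n. enat n \<le> x \<Longrightarrow> enat n \<le> y"
  shows "x \<le> y"
proof (cases x)
  case (enat n)
  then show ?thesis using assms[of n] by simp
next
  case infinity
  then have *: "enat n \<le> y" for n using assms by simp
  have "y \<noteq> enat n" for n using *[of "Suc n"] by auto
  then show ?thesis by (cases y) auto
qed

lemma enat_add_le_by_nats:
  fixes x y z :: enat
  assumes "\<And>m n. enat m \<le> x \<Longrightarrow> enat n \<le> y \<Longrightarrow> enat (m + n) \<le> z"
  shows "x + y \<le> z"
proof (rule enat_le_by_nats)
  fix k assume k: "enat k \<le> x + y"
  have "\<exists>m n. enat m \<le> x \<and> enat n \<le> y \<and> k \<le> m + n"
  proof (cases x)
    case infinity
    then show ?thesis by (intro exI[of _ k] exI[of _ 0]) (auto simp: zero_enat_def[symmetric])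
  next
    case (enat a)
    show ?thesis
    proof (cases y)
      case infinity
      then show ?thesis by (intro exI[of _ 0] exI[of _ k]) (auto simp: zero_enat_def[symmetric])
    next
      case y: (enat b)
      then show ?thesis using enat k by (intro exI[of _ a] exI[of _ b]) auto
    qed
  qed
  then obtain m n where "enat m \<le> x" "enat n \<le> y" "k \<le> m + n" by blast
  then show "enat k \<le> z" using assms[of m n] order_trans[of "enat k" "enat (m + n)" z] by simp
qed

text \<open>Only a commutative ring is required, because the locale is also interpreted at the
  localizations and at their residue fields.\<close>

locale char_p_ring = cring R for R (structure) +
  fixes p :: nat
  assumes prime_p: "Factorial_Ring.prime p" and char_p: "[p] \<cdot> \<one> = \<zero>"
begin

lemma char_dvd_zero:
  assumes "p dvd m" "x \<in> carrier R"
  shows "[m] \<cdot> x = \<zero>"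
proof -
  have "[p] \<cdot> x = ([p] \<cdot> \<one>) \<otimes> x"
    using assms by (simp add: add_pow_ldistr)
  then have "[p] \<cdot> x = \<zero>" using char_p assms by simp
  moreover obtain j where "m = p * j" using assms by auto
  ultimately show ?thesis
    using assms(2) by (metis add.nat_pow_one add.nat_pow_pow)
qed

lemma frobenius_add:
  assumes a: "a \<in> carrier R" and b: "b \<in> carrier R"
  shows "(a \<oplus> b) [^] p = a [^] p \<oplus> b [^] p"
proof -
  obtain m where m: "p = Suc m" "0 < m"
    using prime_gt_1_nat[OF prime_p] by (metis Suc_lessE One_nat_def)
  let ?f = "\<lambda>k. [(p choose k)] \<cdot> (a [^] k \<otimes> b [^] (p - k))"
  have f: "?f k \<in> carrier R" for k using a b by simp
  have z: "?f k = \<zero>" if "0 < k" "k < p" for k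
    using dvd_choose_prime[of k p] prime_p that a b by (intro char_dvd_zero) auto
  have "(\<Oplus>k\<in>{..p}. ?f k) = ?f p \<oplus> (\<Oplus>k\<in>{..m}. ?f k)"
    unfolding m using f m by (subst finsum_Suc) auto
  also have "(\<Oplus>k\<in>{..m}. ?f k) = (\<Oplus>k\<in>{..m}. if k = 0 then ?f 0 else \<zero>)"
    using z m(1) f a b by (intro finsum_cong') (auto split: if_splits)
  also have "\<dots> = ?f 0"
    using f a b by (intro add.finprod_singleton_swap) auto
  also have "?f p \<oplus> ?f 0 = a [^] p \<oplus> b [^] p"
    using a b by simp
  finally show ?thesis using add_power_binomial[OF a b, of p] by simp
qed

definition frob :: "nat \<Rightarrow> 'a \<Rightarrow> 'a" where
  "frob e x = x [^] (p ^ e)"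

lemma frob_closed [simp, intro]: "x \<in> carrier R \<Longrightarrow> frob e x \<in> carrier R"
  by (simp add: frob_def)

lemma frob_0 [simp]: "x \<in> carrier R \<Longrightarrow> frob 0 x = x"
  by (simp add: frob_def)

lemma frob_frob: "x \<in> carrier R \<Longrightarrow> frob d (frob e x) = frob (e + d) x"
  by (simp add: frob_def nat_pow_pow power_add)

lemma frob_mult: "x \<in> carrier R \<Longrightarrow> y \<in> carrier R \<Longrightarrow> frob e (x \<otimes> y) = frob e x \<otimes> frob e y"
  by (simp add: frob_def nat_pow_distrib)

lemma frob_one [simp]: "frob e \<one> = \<one>"
  by (simp add: frob_def)

lemma frob_zero [simp]: "frob e \<zero> = \<zero>"
  using prime_gt_0_nat[OF prime_p] by (simp add: frob_def nat_pow_zero)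

lemma frob_Suc: "x \<in> carrier R \<Longrightarrow> frob (Suc e) x = frob e x [^] p"
  by (simp add: frob_def nat_pow_pow mult.commute)

lemma frob_add: "x \<in> carrier R \<Longrightarrow> y \<in> carrier R \<Longrightarrow> frob e (x \<oplus> y) = frob e x \<oplus> frob e y"
  by (induction e) (auto simp: frob_Suc frobenius_add)

lemma frob_minus:
  assumes "x \<in> carrier R" shows "frob e (\<ominus> x) = \<ominus> frob e x"
proof -
  have "frob e (\<ominus> x) \<oplus> frob e x = \<zero>"
    using frob_add[of "\<ominus> x" x e] assms by (simp add: l_neg)
  then show ?thesis using assms by (simp add: minus_equality)
qed

text \<open>As \<open>p ^ e\<close> is positive, x divides its own power. This is what trades an
  arbitrary denominator for one that is a \<open>p ^ e\<close>-th power and hence acts as a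
  scalar.\<close>

lemma frob_factor:
  assumes "x \<in> carrier R"
  obtains y where "y \<in> carrier R" "frob e x = x \<otimes> y"
proof
  obtain m where "p ^ e = Suc m"
    using prime_gt_0_nat[OF prime_p] by (metis gr0_implies_Suc zero_less_power)
  then show "frob e x = x \<otimes> x [^] (p ^ e - 1)"
    using assms by (simp add: frob_def m_comm)
qed (use assms in auto)

lemma frob_in_ideal:
  assumes "ideal I R" "x \<in> I" shows "frob e x \<in> I"
  using assms frob_factor ideal.I_r_closed ideal.Icarr by metis

lemma frob_notin_prime:
  assumes P: "primeideal P R" and x: "x \<in> carrier R - P"
  shows "frob e x \<in> carrier R - P"
proof -
  have "x [^] n \<in> carrier R - P" for n :: nat
    using one_notin_prime[OF P] mult_notin_prime[OF P _ x] by (induction n) auto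
  then show ?thesis by (simp add: frob_def)
qed


section \<open>Lengths of localized modules\<close>

text \<open>Submodules of \<open>F\<^sup>q\<^sub>*R\<close> for \<open>q = p\<^sup>e\<close>. Those with \<open>sat P e N \<subseteq> N\<close> correspond to the
  \<open>R\<^sub>P\<close>-submodules of \<open>F\<^sup>q\<^sub>*R\<^sub>P\<close>, which allows to work at \<open>P\<close> without leaving \<open>R\<close>.\<close>

definition subm :: "nat \<Rightarrow> 'a set \<Rightarrow> bool" where
  "subm e N \<longleftrightarrow> N \<subseteq> carrier R \<and> \<zero> \<in> N \<and> (\<forall>x\<in>N. \<forall>y\<in>N. x \<oplus> y \<in> N) \<and>
     (\<forall>r\<in>carrier R. \<forall>x\<in>N. frob e r \<otimes> x \<in> N)"

definition sat :: "'a set \<Rightarrow> nat \<Rightarrow> 'a set \<Rightarrow> 'a set" where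
  "sat P e N = {x \<in> carrier R. \<exists>s\<in>carrier R - P. frob e s \<otimes> x \<in> N}"

definition sat_subm :: "'a set \<Rightarrow> nat \<Rightarrow> 'a set \<Rightarrow> bool" where
  "sat_subm P e N \<longleftrightarrow> subm e N \<and> sat P e N \<subseteq> N"

lemma submI:
  assumes "N \<subseteq> carrier R" "\<zero> \<in> N" "\<And>x y. x \<in> N \<Longrightarrow> y \<in> N \<Longrightarrow> x \<oplus> y \<in> N"
    "\<And>r x. r \<in> carrier R \<Longrightarrow> x \<in> N \<Longrightarrow> frob e r \<otimes> x \<in> N"
  shows "subm e N"
  using assms by (auto simp: subm_def)

lemma subm_carr: "subm e N \<Longrightarrow> x \<in> N \<Longrightarrow> x \<in> carrier R"
  and subm_zero: "subm e N \<Longrightarrow> \<zero> \<in> N"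
  and subm_add: "subm e N \<Longrightarrow> x \<in> N \<Longrightarrow> y \<in> N \<Longrightarrow> x \<oplus> y \<in> N"
  and subm_smult: "subm e N \<Longrightarrow> r \<in> carrier R \<Longrightarrow> x \<in> N \<Longrightarrow> frob e r \<otimes> x \<in> N"
  by (auto simp: subm_def)

lemma subm_neg:
  assumes "subm e N" "x \<in> N" shows "\<ominus> x \<in> N"
proof -
  have "frob e (\<ominus> \<one>) \<otimes> x = \<ominus> x"
    using subm_carr[OF assms] by (simp add: frob_minus l_minus)
  then show ?thesis using subm_smult[OF assms(1) _ assms(2), of "\<ominus> \<one>"] by simp
qed

lemma subm_diff: "subm e N \<Longrightarrow> x \<in> N \<Longrightarrow> y \<in> N \<Longrightarrow> x \<ominus> y \<in> N"
  by (simp add: minus_eq subm_add subm_neg)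

lemma subm_carrier [simp, intro]: "subm e (carrier R)"
  by (rule submI) auto

lemma subm_ideal:
  assumes "ideal I R" shows "subm e I"
proof (rule submI)
  interpret ideal I R by fact
  show "I \<subseteq> carrier R" "\<zero> \<in> I" using a_subset by auto
  show "x \<oplus> y \<in> I" if "x \<in> I" "y \<in> I" for x y using that by simp
  show "frob e r \<otimes> x \<in> I" if "r \<in> carrier R" "x \<in> I" for r x using that by (simp add: I_l_closed)
qed

lemma ideal_of_subm:
  assumes "subm e N" "\<And>r x. r \<in> carrier R \<Longrightarrow> x \<in> N \<Longrightarrow> r \<otimes> x \<in> N"
  shows "ideal N R"
proof (rule idealI)
  show "ring R" by (rule ring_axioms)
  show "subgroup N (add_monoid R)"
    using subm_neg[OF assms(1)] subm_carr[OF assms(1)] subm_zero[OF assms(1)] subm_add[OF assms(1)]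
    by (intro subgroup.intro) (auto simp: a_inv_def)
  show "x \<otimes> a \<in> N" "a \<otimes> x \<in> N" if "a \<in> N" "x \<in> carrier R" for a x
    using assms(2)[OF that(2,1)] that subm_carr[OF assms(1)] m_comm by auto
qed

lemma subm_Int: "subm e N \<Longrightarrow> subm e L \<Longrightarrow> subm e (N \<inter> L)"
  by (auto simp: subm_def)

lemma subm_sum:
  assumes N: "subm e N" and L: "subm e L"
  shows "subm e (N <+> L)"
proof (rule submI)
  note c = subm_carr[OF N] subm_carr[OF L]
  show "N <+> L \<subseteq> carrier R" using c by (auto simp: set_add_def')
  have "\<zero> = \<zero> \<oplus> \<zero>" by simp
  then show "\<zero> \<in> N <+> L" using subm_zero[OF N] subm_zero[OF L] unfolding set_add_def' by blast
  show "x \<oplus> y \<in> N <+> L" if x: "x \<in> N <+> L" and y: "y \<in> N <+> L" for x y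
  proof -
    obtain a b where 1: "a \<in> N" "b \<in> L" "x = a \<oplus> b" using x by (auto simp: set_add_def')
    obtain a' b' where 2: "a' \<in> N" "b' \<in> L" "y = a' \<oplus> b'" using y by (auto simp: set_add_def')
    have "x \<oplus> y = (a \<oplus> a') \<oplus> (b \<oplus> b')" using 1 2 c by (simp add: a_ac)
    then show ?thesis
      using subm_add[OF N 1(1) 2(1)] subm_add[OF L 1(2) 2(2)] unfolding set_add_def' by blast
  qed
  show "frob e r \<otimes> x \<in> N <+> L" if r: "r \<in> carrier R" and x: "x \<in> N <+> L" for r x
  proof -
    obtain a b where 1: "a \<in> N" "b \<in> L" "x = a \<oplus> b" using x by (auto simp: set_add_def')
    have "frob e r \<otimes> x = frob e r \<otimes> a \<oplus> frob e r \<otimes> b" using 1 c r by (simp add: r_distr)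
    then show ?thesis
      using subm_smult[OF N r 1(1)] subm_smult[OF L r 1(2)] unfolding set_add_def' by blast
  qed
qed

lemma sum_upper:
  assumes N: "subm e N" and L: "subm e L"
  shows "N \<subseteq> N <+> L" "L \<subseteq> N <+> L"
proof -
  have "x = x \<oplus> \<zero>" if "x \<in> N" for x using subm_carr[OF N that] by simp
  then show "N \<subseteq> N <+> L" using subm_zero[OF L] unfolding set_add_def' by blast
  have "x = \<zero> \<oplus> x" if "x \<in> L" for x using subm_carr[OF L that] by simp
  then show "L \<subseteq> N <+> L" using subm_zero[OF N] unfolding set_add_def' by blast
qed

lemma sum_least: "subm e M \<Longrightarrow> N \<subseteq> M \<Longrightarrow> L \<subseteq> M \<Longrightarrow> N <+> L \<subseteq> M"
  by (auto simp: set_add_def' intro: subm_add)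

lemma satI: "x \<in> carrier R \<Longrightarrow> s \<in> carrier R - P \<Longrightarrow> frob e s \<otimes> x \<in> N \<Longrightarrow> x \<in> sat P e N"
  by (auto simp: sat_def)

lemma sat_upper: "primeideal P R \<Longrightarrow> subm e N \<Longrightarrow> N \<subseteq> sat P e N"
  using one_notin_prime by (force simp: sat_def subm_carr)

lemma sat_mono: "N \<subseteq> M \<Longrightarrow> sat P e N \<subseteq> sat P e M"
  by (auto simp: sat_def)

lemma sat_subm_sat:
  assumes P: "primeideal P R" and N: "subm e N"
  shows "sat_subm P e (sat P e N)"
  unfolding sat_subm_def
proof
  show "subm e (sat P e N)"
  proof (rule submI)
    show "sat P e N \<subseteq> carrier R" by (auto simp: sat_def)
    show "\<zero> \<in> sat P e N" using sat_upper[OF P N] subm_zero[OF N] by auto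
    show "x \<oplus> y \<in> sat P e N" if x: "x \<in> sat P e N" and y: "y \<in> sat P e N" for x y
    proof -
      obtain s where s: "s \<in> carrier R - P" "frob e s \<otimes> x \<in> N" "x \<in> carrier R"
        using x by (auto simp: sat_def)
      obtain t where t: "t \<in> carrier R - P" "frob e t \<otimes> y \<in> N" "y \<in> carrier R"
        using y by (auto simp: sat_def)
      have "frob e (s \<otimes> t) \<otimes> (x \<oplus> y) = frob e t \<otimes> (frob e s \<otimes> x) \<oplus> frob e s \<otimes> (frob e t \<otimes> y)"
        using s t by (simp add: frob_mult r_distr l_distr m_ac)
      also have "\<dots> \<in> N" using s t N by (auto intro: subm_add subm_smult)
      finally show ?thesis using s t mult_notin_prime[OF P s(1) t(1)] by (intro satI) auto
    qed
    show "frob e r \<otimes> x \<in> sat P e N" if r: "r \<in> carrier R" and x: "x \<in> sat P e N" for r x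
    proof -
      obtain s where s: "s \<in> carrier R - P" "frob e s \<otimes> x \<in> N" "x \<in> carrier R"
        using x by (auto simp: sat_def)
      have "frob e s \<otimes> (frob e r \<otimes> x) = frob e r \<otimes> (frob e s \<otimes> x)"
        using s r by (simp add: m_ac)
      also have "\<dots> \<in> N" using s r N by (auto intro: subm_smult)
      finally show ?thesis using s r by (intro satI) auto
    qed
  qed
  show "sat P e (sat P e N) \<subseteq> sat P e N"
  proof
    fix x assume "x \<in> sat P e (sat P e N)"
    then obtain s t where s: "x \<in> carrier R" "s \<in> carrier R - P" "t \<in> carrier R - P"
      "frob e t \<otimes> (frob e s \<otimes> x) \<in> N" by (auto simp: sat_def)
    then have "frob e (t \<otimes> s) \<otimes> x \<in> N" by (simp add: frob_mult m_assoc)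
    then show "x \<in> sat P e N" using s mult_notin_prime[OF P, of t s] by (intro satI) auto
  qed
qed

lemma sat_least: "N \<subseteq> M \<Longrightarrow> sat_subm P e M \<Longrightarrow> sat P e N \<subseteq> M"
  using sat_mono unfolding sat_subm_def by blast

lemma sat_subm_subm: "sat_subm P e N \<Longrightarrow> subm e N"
  by (simp add: sat_subm_def)

lemma sat_eq: "primeideal P R \<Longrightarrow> sat_subm P e N \<Longrightarrow> sat P e N = N"
  using sat_upper[of P e N] by (auto simp: sat_subm_def)

lemma sat_subm_cancel:
  "sat_subm P e N \<Longrightarrow> x \<in> carrier R \<Longrightarrow> s \<in> carrier R - P \<Longrightarrow> frob e s \<otimes> x \<in> N \<Longrightarrow> x \<in> N"
  by (auto simp: sat_subm_def sat_def)

lemma sat_subm_carrier [simp]: "sat_subm P e (carrier R)"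
  by (auto simp: sat_subm_def sat_def)

lemma sat_subm_Int: "sat_subm P e N \<Longrightarrow> sat_subm P e L \<Longrightarrow> sat_subm P e (N \<inter> L)"
  by (auto simp: sat_subm_def subm_Int sat_def)

text \<open>There are n strict steps above N through saturated submodules, and a last inclusion into
  M that may be an equality. Since neither N nor M has to be saturated, both ends can be moved
  freely, as in \<open>has_chain_mono\<close>.\<close>

fun has_chain :: "'a set \<Rightarrow> nat \<Rightarrow> nat \<Rightarrow> 'a set \<Rightarrow> 'a set \<Rightarrow> bool" where
  "has_chain P e 0 N M \<longleftrightarrow> N \<subseteq> M"
| "has_chain P e (Suc n) N M \<longleftrightarrow> (\<exists>L. sat_subm P e L \<and> N \<subset> L \<and> L \<subseteq> M \<and> has_chain P e n L M)"

lemma has_chain_mono: "has_chain P e n N M \<Longrightarrow> N' \<subseteq> N \<Longrightarrow> M \<subseteq> M' \<Longrightarrow> has_chain P e n N' M'"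
proof (induction n arbitrary: N N')
  case (Suc n)
  then obtain L where L: "sat_subm P e L" "N \<subset> L" "L \<subseteq> M" "has_chain P e n L M" by auto
  then have "has_chain P e n L M'" using Suc by blast
  then show ?case using L Suc by (auto intro!: exI[of _ L])
qed auto

lemma has_chain_subset: "has_chain P e n N M \<Longrightarrow> N \<subseteq> M"
  by (cases n) auto

lemma has_chain_Suc: "has_chain P e (Suc n) N M \<Longrightarrow> has_chain P e n N M"
  using has_chain_mono by auto

lemma has_chain_le: "m \<le> n \<Longrightarrow> has_chain P e n N M \<Longrightarrow> has_chain P e m N M"
  by (induction rule: inc_induct) (blast dest: has_chain_Suc)+

lemma has_chain_concat:
  "has_chain P e m N L \<Longrightarrow> sat_subm P e L \<Longrightarrow> has_chain P e n L M \<Longrightarrow> has_chain P e (m + n) N M"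
proof (induction m arbitrary: N)
  case 0
  then show ?case using has_chain_mono by auto
next
  case (Suc m)
  then obtain K where K: "sat_subm P e K" "N \<subset> K" "K \<subseteq> L" "has_chain P e m K L" by auto
  then have "has_chain P e (m + n) K M" using Suc by blast
  moreover have "L \<subseteq> M" using Suc.prems(3) by (rule has_chain_subset)
  ultimately show ?case using K by (auto intro!: exI[of _ K])
qed

text \<open>The modular law after localization: up to a denominator, an element of N' is an element
  of N plus one of L, and the latter lies in both N' and L, hence in N.\<close>

lemma saturated_modular:
  assumes P: "primeideal P R" and L: "sat_subm P e L" and N: "sat_subm P e N"
    and N': "sat_subm P e N'" and "N \<subseteq> N'" and eq: "N \<inter> L = N' \<inter> L"
    and eq': "sat P e (N <+> L) = sat P e (N' <+> L)"
  shows "N' \<subseteq> N"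
proof
  fix x assume x: "x \<in> N'"
  note sub = sat_subm_subm[OF N'] sat_subm_subm[OF N] sat_subm_subm[OF L]
  have xc: "x \<in> carrier R" using x sub subm_carr by blast
  have "x \<in> N' <+> L" using x sum_upper(1)[OF sub(1,3)] by auto
  then have "x \<in> sat P e (N <+> L)"
    unfolding eq' using sat_upper[OF P subm_sum[OF sub(1,3)]] by auto
  then obtain s where s: "s \<in> carrier R - P" "frob e s \<otimes> x \<in> N <+> L" by (auto simp: sat_def)
  then obtain a b where ab: "a \<in> N" "b \<in> L" "frob e s \<otimes> x = a \<oplus> b" by (auto simp: set_add_def')
  have c: "a \<in> carrier R" "b \<in> carrier R" using ab sub subm_carr by blast+
  have "frob e s \<otimes> x \<ominus> a \<in> N'"
    using ab s x \<open>N \<subseteq> N'\<close> sub by (intro subm_diff subm_smult) auto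
  moreover have "frob e s \<otimes> x \<ominus> a = b" unfolding ab(3) using c by algebra
  ultimately have "b \<in> N" using ab eq by auto
  then have "frob e s \<otimes> x \<in> N" unfolding ab(3) using ab sub by (intro subm_add) auto
  then show "x \<in> N" using sat_subm_cancel[OF N xc s(1)] by simp
qed

text \<open>Each step of a chain is strict in its trace on L or in its saturated sum with L, by
  \<open>saturated_modular\<close>; so the two induced chains together have at least n
  steps.\<close>

lemma has_chain_split:
  assumes P: "primeideal P R" and L: "sat_subm P e L" and M: "sat_subm P e M" and LM: "L \<subseteq> M"
  shows "has_chain P e n N M \<Longrightarrow> sat_subm P e N \<Longrightarrow>
    \<exists>a b. n \<le> a + b \<and> has_chain P e a (N \<inter> L) L \<and> has_chain P e b (sat P e (N <+> L)) M"
proof (induction n arbitrary: N)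
  case 0
  then have "sat P e (N <+> L) \<subseteq> M"
    using LM M by (intro sat_least sum_least) (auto simp: sat_subm_def)
  then show ?case by (intro exI[of _ 0]) auto
next
  case (Suc n)
  then obtain K where K: "sat_subm P e K" "N \<subset> K" "K \<subseteq> M" "has_chain P e n K M" by auto
  obtain a b where ab: "n \<le> a + b" "has_chain P e a (K \<inter> L) L" "has_chain P e b (sat P e (K <+> L)) M"
    using Suc.IH[OF K(4,1)] by auto
  note sub = sat_subm_subm[OF K(1)] sat_subm_subm[OF Suc.prems(2)] sat_subm_subm[OF L]
  have le: "sat P e (N <+> L) \<subseteq> sat P e (K <+> L)"
    using K(2) by (intro sat_mono) (auto simp: set_add_def')
  show ?case
  proof (cases "N \<inter> L = K \<inter> L")
    case False
    then have "has_chain P e (Suc a) (N \<inter> L) L"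
      using ab(2) K(2) sat_subm_Int[OF K(1) L] by (auto intro!: exI[of _ "K \<inter> L"])
    moreover have "has_chain P e b (sat P e (N <+> L)) M" using has_chain_mono[OF ab(3) le] by simp
    ultimately show ?thesis using ab(1) by (intro exI[of _ "Suc a"] exI[of _ b]) auto
  next
    case True
    then have "sat P e (N <+> L) \<noteq> sat P e (K <+> L)"
      using saturated_modular[OF P L Suc.prems(2) K(1)] K(2) by auto
    then have "has_chain P e (Suc b) (sat P e (N <+> L)) M"
      using le ab(3) sat_subm_sat[OF P subm_sum[OF sub(1,3)]] has_chain_subset[OF ab(3)]
      by (auto intro!: exI[of _ "sat P e (K <+> L)"])
    then show ?thesis using ab(1,2) True by (intro exI[of _ a] exI[of _ "Suc b"]) auto
  qed
qed

text \<open>The length of M/N localized at P, as a module over the local ring at P. Both ends are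
  saturated first, so N and M may be arbitrary submodules; the value is an \<open>enat\<close>
  because finiteness is proved only later.\<close>

definition len :: "'a set \<Rightarrow> nat \<Rightarrow> 'a set \<Rightarrow> 'a set \<Rightarrow> enat" where
  "len P e N M = Sup {enat n | n. has_chain P e n (sat P e N) (sat P e M)}"

text \<open>Chains can be cut short by \<open>has_chain_le\<close>, so every natural number below
  the supremum is itself the length of a chain, even when the supremum is infinite.\<close>

lemma le_len_iff:
  assumes "N \<subseteq> M"
  shows "enat n \<le> len P e N M \<longleftrightarrow> has_chain P e n (sat P e N) (sat P e M)"
proof
  show "enat n \<le> len P e N M" if "has_chain P e n (sat P e N) (sat P e M)"
    unfolding len_def using that by (intro Sup_upper) auto
  assume le: "enat n \<le> len P e N M"
  show "has_chain P e n (sat P e N) (sat P e M)"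
  proof (cases n)
    case 0
    then show ?thesis using sat_mono[OF assms] by simp
  next
    case (Suc m)
    show ?thesis
    proof (rule ccontr)
      assume *: "\<not> ?thesis"
      have "len P e N M \<le> enat m"
        unfolding len_def
      proof (rule Sup_least, clarify)
        fix k assume "has_chain P e k (sat P e N) (sat P e M)"
        then have "\<not> n \<le> k" using * has_chain_le by blast
        then show "enat k \<le> enat m" using Suc by simp
      qed
      then show False using le Suc by (metis Suc_n_not_le_n enat_ord_simps(1) order_trans)
    qed
  qed
qed

text \<open>One inequality splits a chain along L by \<open>has_chain_split\<close>, the other joins
  two chains at the saturation of L.\<close>

lemma len_add:
  assumes P: "primeideal P R" and N: "subm e N" and L: "subm e L" and M: "subm e M"
    and NL: "N \<subseteq> L" and LM: "L \<subseteq> M"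
  shows "len P e N M = len P e N L + len P e L M"
proof (rule antisym)
  have NM: "N \<subseteq> M" using NL LM by auto
  note sN = sat_subm_sat[OF P N] and sL = sat_subm_sat[OF P L] and sM = sat_subm_sat[OF P M]
  show "len P e N M \<le> len P e N L + len P e L M"
  proof (rule enat_le_by_nats)
    fix n assume "enat n \<le> len P e N M"
    then have "has_chain P e n (sat P e N) (sat P e M)" using le_len_iff[OF NM] by simp
    from has_chain_split[OF P sL sM sat_mono[OF LM] this sN]
    obtain a b where ab: "n \<le> a + b" "has_chain P e a (sat P e N \<inter> sat P e L) (sat P e L)"
      "has_chain P e b (sat P e (sat P e N <+> sat P e L)) (sat P e M)" by auto
    have "sat P e N \<inter> sat P e L = sat P e N" using sat_mono[OF NL, of P e] by auto
    then have a: "enat a \<le> len P e N L" using ab(2) le_len_iff[OF NL] by simp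
    have "sat P e N <+> sat P e L = sat P e L"
      using sat_mono[OF NL, of P e] sum_upper(2)[OF sat_subm_subm[OF sN] sat_subm_subm[OF sL]]
        sum_least[OF sat_subm_subm[OF sL]] by blast
    then have "sat P e (sat P e N <+> sat P e L) = sat P e L"
      using sat_eq[OF P sL] by simp
    then have b: "enat b \<le> len P e L M" using ab(3) le_len_iff[OF LM] by simp
    have "enat n \<le> enat a + enat b" using ab(1) by simp
    also have "\<dots> \<le> len P e N L + len P e L M" using a b by (rule add_mono)
    finally show "enat n \<le> len P e N L + len P e L M" .
  qed
  show "len P e N L + len P e L M \<le> len P e N M"
    using has_chain_concat[OF _ sL] le_len_iff[OF NM] le_len_iff[OF NL] le_len_iff[OF LM]
    by (intro enat_add_le_by_nats) auto
qed

lemma len_cong_sat: "sat P e N = sat P e N' \<Longrightarrow> sat P e M = sat P e M' \<Longrightarrow> len P e N M = len P e N' M'"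
  by (simp add: len_def)

lemma len_mono:
  assumes "N' \<subseteq> N" "N \<subseteq> M" "M \<subseteq> M'"
  shows "len P e N M \<le> len P e N' M'"
proof (rule enat_le_by_nats)
  fix n assume "enat n \<le> len P e N M"
  then have "has_chain P e n (sat P e N) (sat P e M)" using le_len_iff[OF assms(2)] by simp
  then have "has_chain P e n (sat P e N') (sat P e M')"
    using has_chain_mono[OF _ sat_mono[OF assms(1)] sat_mono[OF assms(3)]] by simp
  then show "enat n \<le> len P e N' M'" using le_len_iff[of N' M'] assms by simp
qed

lemma len_self:
  "len P e N N = 0"
proof -
  have "\<not> has_chain P e (Suc 0) (sat P e N) (sat P e N)" by auto
  then have "\<not> 1 \<le> len P e N N"
    using le_len_iff[of N N 1 P e] by (simp add: one_enat_def del: has_chain.simps)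
  then show ?thesis by (metis ileI1 not_gr_zero one_eSuc one_enat_def linorder_not_le)
qed

text \<open>The isomorphism \<open>(N + T R)/N \<cong> R/T\<^sup>-\<^sup>1N\<close>.\<close>

lemma len_iso:
  assumes P: "primeideal P R" and N: "subm e' N"
    and T: "\<And>y. y \<in> carrier R \<Longrightarrow> T y \<in> carrier R"
    and T_add: "\<And>x y. x \<in> carrier R \<Longrightarrow> y \<in> carrier R \<Longrightarrow> T (x \<oplus> y) = T x \<oplus> T y"
    and T_smult: "\<And>r y. r \<in> carrier R \<Longrightarrow> y \<in> carrier R \<Longrightarrow> T (frob e r \<otimes> y) = frob e' r \<otimes> T y"
  shows "subm e' (N <+> T ` carrier R)" "subm e {y \<in> carrier R. T y \<in> N}"
    "len P e' N (N <+> T ` carrier R) = len P e {y \<in> carrier R. T y \<in> N} (carrier R)"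
proof -
  have T0: "T \<zero> = \<zero>"
    using T_add[of \<zero> \<zero>] T[of \<zero>] by simp
  have T_neg: "T (x \<ominus> y) = T x \<ominus> T y" if "x \<in> carrier R" "y \<in> carrier R" for x y
  proof -
    have "T (\<ominus> y) \<oplus> T y = \<zero>" using T_add[of "\<ominus> y" y] that T0 by (simp add: l_neg)
    then have "T (\<ominus> y) = \<ominus> T y" using that T by (simp add: minus_equality)
    then show ?thesis using that T_add[of x "\<ominus> y"] by (simp add: minus_eq)
  qed
  have im: "subm e' (T ` Y)" if "subm e Y" for Y :: "'a set"
  proof (rule submI)
    note c = subm_carr[OF that]
    show "T ` Y \<subseteq> carrier R" using T c by auto
    show "\<zero> \<in> T ` Y" using T0 subm_zero[OF that] by (metis imageI)
    show "x \<oplus> y \<in> T ` Y" if "x \<in> T ` Y" "y \<in> T ` Y" for x y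
    proof -
      obtain a b where "a \<in> Y" "b \<in> Y" "x = T a" "y = T b" using \<open>x \<in> T ` Y\<close> \<open>y \<in> T ` Y\<close> by auto
      then show ?thesis using T_add[of a b] c subm_add[OF \<open>subm e Y\<close>, of a b] by force
    qed
    show "frob e' r \<otimes> x \<in> T ` Y" if "r \<in> carrier R" "x \<in> T ` Y" for r x
    proof -
      obtain a where "a \<in> Y" "x = T a" using \<open>x \<in> T ` Y\<close> by auto
      then show ?thesis using T_smult[of r a] c subm_smult[OF \<open>subm e Y\<close>, of r a] that(1) by force
    qed
  qed
  have pre: "subm e {y \<in> carrier R. T y \<in> U}" if "subm e' U" for U :: "'a set"
    using that T0 T_add T_smult by (intro submI) (auto intro: subm_zero subm_add subm_smult)
  let ?N = "{y \<in> carrier R. T y \<in> N}" and ?M = "N <+> T ` carrier R"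
  show sM: "subm e' ?M" using subm_sum[OF N im] by simp
  show sN: "subm e ?N" using pre N by simp
  have NM: "N \<subseteq> ?M" using sum_upper(1)[OF N im] by simp
  have TM: "T ` carrier R \<subseteq> ?M" using sum_upper(2)[OF N im] by simp
  have pres: "sat_subm P e {y \<in> carrier R. T y \<in> U}" if "sat_subm P e' U" for U :: "'a set"
    unfolding sat_subm_def
  proof (intro conjI subsetI)
    show "subm e {y \<in> carrier R. T y \<in> U}" using pre[OF sat_subm_subm[OF that]] .
    fix y assume "y \<in> sat P e {y \<in> carrier R. T y \<in> U}"
    then obtain s where "y \<in> carrier R" "s \<in> carrier R - P" "T (frob e s \<otimes> y) \<in> U"
      by (auto simp: sat_def)
    then show "y \<in> {y \<in> carrier R. T y \<in> U}"
      using sat_subm_cancel[OF that T, of y s] T_smult by auto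
  qed
  have dec: "\<exists>s\<in>carrier R - P. \<exists>y\<in>carrier R. \<exists>n\<in>N. frob e' s \<otimes> z = n \<oplus> T y"
    if "z \<in> sat P e' ?M" for z
    using that by (auto simp: sat_def set_add_def' image_iff)
  \<comment> \<open>Preimages under T keep a chain strict: up to a denominator, an element of Y
    outside U is an element of N plus some \<open>T y\<close>, and N is contained in U, so y
    separates the two preimages.\<close>
  have le: "has_chain P e n {y \<in> carrier R. T y \<in> U} (carrier R)"
    if "has_chain P e' n U (sat P e' ?M)" "sat_subm P e' U" "N \<subseteq> U" for n and U :: "'a set"
    using that
  proof (induction n arbitrary: U)
    case 0
    then show ?case by auto
  next
    case (Suc n)
    then obtain Y where Y: "sat_subm P e' Y" "U \<subset> Y" "Y \<subseteq> sat P e' ?M" "has_chain P e' n Y (sat P e' ?M)"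
      by auto
    then have 1: "has_chain P e n {y \<in> carrier R. T y \<in> Y} (carrier R)" using Suc by blast
    obtain z where z: "z \<in> Y" "z \<notin> U" using Y by blast
    have zc: "z \<in> carrier R" using z(1) Y(1) by (meson sat_subm_subm subm_carr)
    obtain s y n' where s: "s \<in> carrier R - P" "y \<in> carrier R" "n' \<in> N" "frob e' s \<otimes> z = n' \<oplus> T y"
      using dec z Y by blast
    have n'c: "n' \<in> carrier R" using s N subm_carr by blast
    have "T y = frob e' s \<otimes> z \<ominus> n'" unfolding s(4) using n'c T[OF s(2)] by algebra
    also have "\<dots> \<in> Y" using s z(1) Y(2) Suc.prems(3)
      by (intro subm_diff[OF sat_subm_subm[OF Y(1)]] subm_smult[OF sat_subm_subm[OF Y(1)]]) auto
    finally have "T y \<in> Y" .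
    moreover have "T y \<notin> U"
    proof
      assume "T y \<in> U"
      then have "frob e' s \<otimes> z \<in> U" unfolding s(4)
        using s(3) Suc.prems(3) by (intro subm_add[OF sat_subm_subm[OF Suc.prems(2)]]) auto
      then show False using sat_subm_cancel[OF Suc.prems(2) zc s(1)] z by simp
    qed
    ultimately have "{y \<in> carrier R. T y \<in> U} \<subset> {y \<in> carrier R. T y \<in> Y}"
      using s(2) Y(2) by auto
    then show ?case using 1 pres[OF Y(1)] by auto
  qed
  have ge: "has_chain P e' n (sat P e' (N <+> T ` Y)) (sat P e' ?M)"
    if "has_chain P e n Y (carrier R)" "sat_subm P e Y" "?N \<subseteq> Y" for n and Y :: "'a set"
    using that
  proof (induction n arbitrary: Y)
    case 0
    then show ?case by (auto intro!: sat_mono simp: set_add_def')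
  next
    case (Suc n)
    then obtain Z where Z: "sat_subm P e Z" "Y \<subset> Z" "Z \<subseteq> carrier R" "has_chain P e n Z (carrier R)"
      by auto
    have 1: "has_chain P e' n (sat P e' (N <+> T ` Z)) (sat P e' ?M)" using Suc Z by blast
    \<comment> \<open>Conversely, images keep a chain strict: if a multiple of \<open>T y\<close>
      lies in N plus the image of U, then the corresponding multiple of y differs from an element of
      U by one that T sends into N, and such elements lie in U.\<close>
    have key: "T y \<in> sat P e' (N <+> T ` U) \<Longrightarrow> y \<in> U"
      if U: "sat_subm P e U" "?N \<subseteq> U" and y: "y \<in> carrier R" for U :: "'a set" and y
    proof -
      assume "T y \<in> sat P e' (N <+> T ` U)"
      then obtain s n' y' where s: "s \<in> carrier R - P" "n' \<in> N" "y' \<in> U"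
        "frob e' s \<otimes> T y = n' \<oplus> T y'" by (auto simp: sat_def set_add_def' image_iff)
      have c: "n' \<in> carrier R" "y' \<in> carrier R" using s N U subm_carr sat_subm_subm by blast+
      have "T (frob e s \<otimes> y \<ominus> y') = n' \<oplus> T y' \<ominus> T y'"
        using s c y by (simp add: T_neg T_smult)
      also have "\<dots> = n'" using c T[OF c(2)] by algebra
      finally have "frob e s \<otimes> y \<ominus> y' \<in> U" using s c y U(2) by auto
      then have "(frob e s \<otimes> y \<ominus> y') \<oplus> y' \<in> U" using s(3) by (intro subm_add[OF sat_subm_subm[OF U(1)]]) auto
      moreover have "(frob e s \<otimes> y \<ominus> y') \<oplus> y' = frob e s \<otimes> y"
      proof -
        have "frob e s \<otimes> y \<in> carrier R" using s y by auto
        then show ?thesis using c(2) by algebra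
      qed
      ultimately show "y \<in> U" using sat_subm_cancel[OF U(1) y s(1)] by simp
    qed
    obtain z where z: "z \<in> Z" "z \<notin> Y" using Z by blast
    have "T z \<in> N <+> T ` Z" using z sum_upper(2)[OF N im[OF sat_subm_subm[OF Z(1)]]] by blast
    then have "T z \<in> sat P e' (N <+> T ` Z)"
      using sat_upper[OF P subm_sum[OF N im[OF sat_subm_subm[OF Z(1)]]]] by blast
    moreover have "T z \<notin> sat P e' (N <+> T ` Y)"
      using key[OF Suc.prems(2,3)] z Z by blast
    moreover have "sat P e' (N <+> T ` Y) \<subseteq> sat P e' (N <+> T ` Z)"
      using Z(2) by (intro sat_mono) (auto simp: set_add_def')
    ultimately have "sat P e' (N <+> T ` Y) \<subset> sat P e' (N <+> T ` Z)" by blast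
    then show ?case
      using 1 sat_subm_sat[OF P subm_sum[OF N im[OF sat_subm_subm[OF Z(1)]]]] has_chain_subset[OF 1] by auto
  qed
  have satR: "sat P e (carrier R) = carrier R" using sat_eq[OF P sat_subm_carrier] .
  show "len P e' N ?M = len P e ?N (carrier R)"
  proof (rule antisym; rule enat_le_by_nats)
    fix n
    {
      assume "enat n \<le> len P e' N ?M"
      then have "has_chain P e' n (sat P e' N) (sat P e' ?M)" using le_len_iff[OF NM] by simp
      then have "has_chain P e n {y \<in> carrier R. T y \<in> sat P e' N} (carrier R)"
        using le sat_subm_sat[OF P N] sat_upper[OF P N] by blast
      moreover have "sat P e ?N \<subseteq> {y \<in> carrier R. T y \<in> sat P e' N}"
        using sat_upper[OF P N] by (intro sat_least pres sat_subm_sat[OF P N]) auto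
      ultimately have "has_chain P e n (sat P e ?N) (sat P e (carrier R))"
        unfolding satR using has_chain_mono[OF _ _ order_refl] by simp
      then show "enat n \<le> len P e ?N (carrier R)" using le_len_iff[of ?N "carrier R" n P e] by auto
    }
    assume "enat n \<le> len P e ?N (carrier R)"
    then have "has_chain P e n (sat P e ?N) (carrier R)" using le_len_iff[of ?N "carrier R" n P e] satR by auto
    then have "has_chain P e' n (sat P e' (N <+> T ` sat P e ?N)) (sat P e' ?M)"
      using ge sat_subm_sat[OF P sN] sat_upper[OF P sN] by blast
    moreover have "sat P e' N \<subseteq> sat P e' (N <+> T ` sat P e ?N)"
      using sum_upper(1)[OF N im[OF sat_subm_subm[OF sat_subm_sat[OF P sN]]]] by (rule sat_mono)
    ultimately have "has_chain P e' n (sat P e' N) (sat P e' ?M)" using has_chain_mono[OF _ _ order_refl] by simp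
    then show "enat n \<le> len P e' N ?M" using le_len_iff[OF NM] by simp
  qed
qed


section \<open>Adjoining one element, and colon ideals\<close>

definition adjoin :: "nat \<Rightarrow> 'a set \<Rightarrow> 'a \<Rightarrow> 'a set" where
  "adjoin k N u = N <+> (\<lambda>y. frob k y \<otimes> u) ` carrier R"

definition colon :: "nat \<Rightarrow> 'a set \<Rightarrow> 'a \<Rightarrow> 'a set" where
  "colon k N u = {y \<in> carrier R. frob k y \<otimes> u \<in> N}"

text \<open>This is \<open>len_iso\<close> for the map y to y^(p^k) u, which is semilinear from
  exponent e to e + k. The case k = 0 covers the sum of an ideal with a principal ideal and the
  ideal quotient; the case e = 0 covers a cyclic submodule and its annihilator modulo N.\<close>

lemma adjoin:
  assumes N: "subm (e + k) N" and u: "u \<in> carrier R"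
  shows subm_adjoin: "subm (e + k) (adjoin k N u)"
    and subm_colon: "subm e (colon k N u)"
    and len_adjoin: "primeideal P R \<Longrightarrow>
      len P (e + k) N (adjoin k N u) = len P e (colon k N u) (carrier R)"
proof -
  have T: "frob k (frob e r \<otimes> y) \<otimes> u = frob (e + k) r \<otimes> (frob k y \<otimes> u)"
    if "r \<in> carrier R" "y \<in> carrier R" for r y
    using that u by (simp add: frob_mult frob_frob m_ac)
  have add: "frob k (x \<oplus> y) \<otimes> u = frob k x \<otimes> u \<oplus> frob k y \<otimes> u"
    if "x \<in> carrier R" "y \<in> carrier R" for x y
    using that u by (simp add: frob_add l_distr)
  have im: "subm (e + k) ((\<lambda>y. frob k y \<otimes> u) ` carrier R)"
  proof (rule submI)
    show "\<zero> \<in> (\<lambda>y. frob k y \<otimes> u) ` carrier R" using u by (intro image_eqI[of _ _ \<zero>]) auto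
    show "x \<oplus> y \<in> (\<lambda>y. frob k y \<otimes> u) ` carrier R"
      if "x \<in> (\<lambda>y. frob k y \<otimes> u) ` carrier R" "y \<in> (\<lambda>y. frob k y \<otimes> u) ` carrier R" for x y
      using that add[symmetric] by auto
    show "frob (e + k) r \<otimes> x \<in> (\<lambda>y. frob k y \<otimes> u) ` carrier R"
      if "r \<in> carrier R" "x \<in> (\<lambda>y. frob k y \<otimes> u) ` carrier R" for r x
      using that T[symmetric] by auto
  qed (use u in auto)
  show "subm (e + k) (adjoin k N u)" unfolding adjoin_def using subm_sum[OF N im] .
  show "subm e (colon k N u)"
  proof (rule submI)
    show "\<zero> \<in> colon k N u" using u subm_zero[OF N] by (simp add: colon_def)
    show "x \<oplus> y \<in> colon k N u" if "x \<in> colon k N u" "y \<in> colon k N u" for x y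
      using that add subm_add[OF N] by (auto simp: colon_def)
    show "frob e r \<otimes> x \<in> colon k N u" if "r \<in> carrier R" "x \<in> colon k N u" for r x
      using that T subm_smult[OF N] by (auto simp: colon_def)
  qed (auto simp: colon_def)
  show "len P (e + k) N (adjoin k N u) = len P e (colon k N u) (carrier R)" if "primeideal P R"
    unfolding adjoin_def colon_def
    using that N u T add by (intro len_iso(3)) auto
qed

lemma adjoin_upper:
  assumes "subm e N" "u \<in> carrier R"
  shows "N \<subseteq> adjoin k N u" "y \<in> carrier R \<Longrightarrow> frob k y \<otimes> u \<in> adjoin k N u" "u \<in> adjoin k N u"
proof -
  have "x = x \<oplus> frob k \<zero> \<otimes> u" if "x \<in> N" for x
    using that assms subm_carr[OF assms(1)] by simp
  then show "N \<subseteq> adjoin k N u" unfolding adjoin_def set_add_def' by blast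
  show *: "frob k y \<otimes> u \<in> adjoin k N u" if "y \<in> carrier R" for y
  proof -
    have "frob k y \<otimes> u = \<zero> \<oplus> frob k y \<otimes> u" using that assms by simp
    then show ?thesis unfolding adjoin_def set_add_def' using that subm_zero[OF assms(1)] by blast
  qed
  show "u \<in> adjoin k N u" using *[of \<one>] assms by simp
qed

lemma adjoinE:
  assumes "x \<in> adjoin k N u"
  obtains n y where "n \<in> N" "y \<in> carrier R" "x = n \<oplus> frob k y \<otimes> u"
  using assms by (auto simp: adjoin_def set_add_def')

lemma adjoin_least:
  assumes "subm (e + k) M" "N \<subseteq> M" "\<And>y. y \<in> carrier R \<Longrightarrow> frob k y \<otimes> u \<in> M"
  shows "adjoin k N u \<subseteq> M"
  using assms unfolding adjoin_def by (intro sum_least) auto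

lemma ideal_adjoin:
  assumes I: "ideal I R" and u: "u \<in> carrier R"
  shows "ideal (adjoin 0 I u) R"
proof (rule ideal_of_subm[of 0])
  have s: "subm 0 (adjoin 0 I u)" using subm_adjoin[of 0 0 I u] subm_ideal[OF I] u by simp
  then show "subm 0 (adjoin 0 I u)" .
  show "r \<otimes> x \<in> adjoin 0 I u" if "r \<in> carrier R" "x \<in> adjoin 0 I u" for r x
    using subm_smult[OF s that] that(1) by simp
qed

lemma ideal_colon:
  assumes I: "ideal I R" and u: "u \<in> carrier R"
  shows "ideal (colon 0 I u) R"
proof (rule ideal_of_subm[of 0])
  have s: "subm 0 (colon 0 I u)" using subm_colon[of 0 0 I u] subm_ideal[OF I] u by simp
  then show "subm 0 (colon 0 I u)" .
  show "r \<otimes> x \<in> colon 0 I u" if "r \<in> carrier R" "x \<in> colon 0 I u" for r x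
    using subm_smult[OF s that] that(1) by simp
qed

section \<open>Prime ideals as saturated submodules\<close>

lemma prime_ideal: "primeideal P R \<Longrightarrow> ideal P R"
  by (rule primeideal.axioms(1))

lemma prime_subset: "primeideal P R \<Longrightarrow> P \<subseteq> carrier R"
  using subm_ideal[OF prime_ideal] subm_carr by blast

lemma prime_frobenius_closed:
  "primeideal P R \<Longrightarrow> r \<in> P \<Longrightarrow> x \<in> carrier R \<Longrightarrow> frob e r \<otimes> x \<in> P"
  using prime_ideal frob_in_ideal ideal.I_r_closed by metis

lemma sat_subm_prime:
  assumes P: "primeideal P R" shows "sat_subm P e P"
  unfolding sat_subm_def
proof (intro conjI subsetI)
  show "subm e P" using subm_ideal[OF prime_ideal[OF P]] .
  fix x assume "x \<in> sat P e P"
  then obtain s where s: "x \<in> carrier R" "s \<in> carrier R - P" "frob e s \<otimes> x \<in> P" by (auto simp: sat_def)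
  then show "x \<in> P" using primeideal.I_prime[OF P _ s(1,3)] frob_notin_prime[OF P s(2)] by blast
qed

lemma len_prime_0:
  assumes P: "primeideal P R"
  shows "len P 0 P (carrier R) = 1"
proof (rule antisym)
  have PR: "P \<subseteq> carrier R" using prime_subset[OF P] .
  have s: "sat P 0 P = P" "sat P 0 (carrier R) = carrier R"
    using sat_eq[OF P] sat_subm_prime[OF P] sat_subm_carrier by auto
  have "P \<noteq> carrier R" using one_notin_prime[OF P] by auto
  then have "has_chain P 0 1 P (carrier R)" using PR by (auto intro!: exI[of _ "carrier R"])
  then show "1 \<le> len P 0 P (carrier R)" using le_len_iff[OF PR, of 1 P 0] s by (simp add: one_enat_def)
  \<comment> \<open>A saturated submodule strictly above P contains an element outside P, and
    dividing by it gives 1.\<close>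
  have top: "L = carrier R" if L: "sat_subm P 0 L" "P \<subset> L" "L \<subseteq> carrier R" for L
  proof -
    obtain x where x: "x \<in> L" "x \<in> carrier R - P" using L by blast
    then have "\<one> \<in> L" using sat_subm_cancel[OF L(1), of \<one> x] by simp
    then have "r \<in> L" if "r \<in> carrier R" for r
      using subm_smult[OF sat_subm_subm[OF L(1)] that, of \<one>] that by simp
    then show ?thesis using L by auto
  qed
  have "\<not> has_chain P 0 2 P (carrier R)" by (auto simp: numeral_2_eq_2 dest!: top)
  then have "\<not> enat 2 \<le> len P 0 P (carrier R)" using le_len_iff[OF PR, of 2 P 0] s by simp
  then show "len P 0 P (carrier R) \<le> 1"
    by (cases "len P 0 P (carrier R)") (auto simp: one_enat_def)
qed

lemma len_prime_pos:
  assumes P: "primeideal P R"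
  shows "1 \<le> len P e P (carrier R)"
proof -
  have PR: "P \<subseteq> carrier R" using prime_subset[OF P] .
  have s: "sat P e P = P" "sat P e (carrier R) = carrier R"
    using sat_eq[OF P] sat_subm_prime[OF P] sat_subm_carrier by auto
  have "P \<noteq> carrier R" using one_notin_prime[OF P] by auto
  then have "has_chain P e 1 P (carrier R)" using PR by (auto intro!: exI[of _ "carrier R"])
  then show ?thesis using le_len_iff[OF PR, of 1 P e] s by (simp add: one_enat_def)
qed

text \<open>Generation of R over its p^e-th powers, relative to N. The formulation by submodules
  avoids linear combinations and passes directly to colons and sums.\<close>

definition generates :: "nat \<Rightarrow> 'a set \<Rightarrow> 'a set \<Rightarrow> bool" where
  "generates e N G \<longleftrightarrow> (\<forall>M. subm e M \<and> N \<subseteq> M \<and> G \<subseteq> M \<longrightarrow> M = carrier R)"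

lemma generatesD: "generates e N G \<Longrightarrow> subm e M \<Longrightarrow> N \<subseteq> M \<Longrightarrow> G \<subseteq> M \<Longrightarrow> M = carrier R"
  by (auto simp: generates_def)

lemma generates_mono: "generates e N G \<Longrightarrow> N \<subseteq> N' \<Longrightarrow> G \<subseteq> G' \<Longrightarrow> generates e N' G'"
  unfolding generates_def by blast

text \<open>When the generators are adjoined one by one, each step is cyclic and killed by P, so it
  contributes at most the length 1 of the residue field. The cardinality of G does not depend on
  P.\<close>

lemma len_le_generators:
  assumes P: "primeideal P R" and G: "finite G" "G \<subseteq> carrier R"
  shows "subm e N \<Longrightarrow> (\<And>r x. r \<in> P \<Longrightarrow> x \<in> carrier R \<Longrightarrow> frob e r \<otimes> x \<in> N) \<Longrightarrow>
    generates e N G \<Longrightarrow> len P e N (carrier R) \<le> card G"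
  using G
proof (induction G arbitrary: N)
  case empty
  then have "N = carrier R" using generatesD[of e N "{}" N] by simp
  then show ?case by (simp add: len_self)
next
  case (insert g G)
  have N: "subm (0 + e) N" using insert by simp
  let ?M = "adjoin e N g"
  have g: "g \<in> carrier R" using insert by simp
  have M: "subm e ?M" using subm_adjoin[OF N g] by simp
  note up = adjoin_upper[OF insert.prems(1) g, where k = e]
  have "P \<subseteq> colon e N g" using insert.prems(2) g prime_subset[OF P] by (auto simp: colon_def)
  then have "len P 0 (colon e N g) (carrier R) \<le> len P 0 P (carrier R)"
    by (intro len_mono) (auto simp: colon_def)
  then have 1: "len P e N ?M \<le> 1" using len_adjoin[OF N g P] len_prime_0[OF P] by simp
  have "generates e ?M G" unfolding generates_def
  proof (intro allI impI)
    fix M' assume "subm e M' \<and> adjoin e N g \<subseteq> M' \<and> G \<subseteq> M'"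
    then show "M' = carrier R"
      using up generatesD[OF insert.prems(3), of M'] by auto
  qed
  then have 2: "len P e ?M (carrier R) \<le> card G"
    using insert M up by (intro insert.IH) auto
  have "len P e N (carrier R) = len P e N ?M + len P e ?M (carrier R)"
    using up M subm_carr[OF M] insert.prems by (intro len_add[OF P]) auto
  also have "\<dots> \<le> 1 + enat (card G)" using 1 2 by (rule add_mono)
  finally show ?case using insert by (simp add: one_enat_def)
qed


section \<open>Linear combinations over Frobenius powers\<close>

primrec lcomb :: "nat \<Rightarrow> (nat \<Rightarrow> 'a) \<Rightarrow> (nat \<Rightarrow> 'a) \<Rightarrow> nat \<Rightarrow> 'a" where
  "lcomb k u y 0 = \<zero>"
| "lcomb k u y (Suc n) = lcomb k u y n \<oplus> frob k (y n) \<otimes> u n"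

text \<open>Each coordinate has its own set of coefficients, so that \<open>len_direct_sum\<close>
  can enlarge them one at a time; B is the part already divided out.\<close>

definition comb_span :: "nat \<Rightarrow> (nat \<Rightarrow> 'a) \<Rightarrow> nat \<Rightarrow> (nat \<Rightarrow> 'a set) \<Rightarrow> 'a set \<Rightarrow> 'a set" where
  "comb_span k u n A B = {b \<oplus> lcomb k u y n | b y. b \<in> B \<and> (\<forall>i<n. y i \<in> A i)}"

lemma lcomb_closed [simp, intro]:
  "(\<And>i. i < n \<Longrightarrow> u i \<in> carrier R) \<Longrightarrow> (\<And>i. i < n \<Longrightarrow> y i \<in> carrier R) \<Longrightarrow> lcomb k u y n \<in> carrier R"
  by (induction n) auto

lemma lcomb_cong:
  "(\<And>i. i < n \<Longrightarrow> y i = z i) \<Longrightarrow> (\<And>i. i < n \<Longrightarrow> u i = v i) \<Longrightarrow> lcomb k u y n = lcomb k v z n"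
  by (induction n) auto

lemma lcomb_add:
  assumes "\<And>i. i < n \<Longrightarrow> u i \<in> carrier R" "\<And>i. i < n \<Longrightarrow> y i \<in> carrier R" "\<And>i. i < n \<Longrightarrow> z i \<in> carrier R"
  shows "lcomb k u (\<lambda>i. y i \<oplus> z i) n = lcomb k u y n \<oplus> lcomb k u z n"
  using assms by (induction n) (auto simp: frob_add l_distr a_ac)

lemma lcomb_minus:
  assumes "\<And>i. i < n \<Longrightarrow> u i \<in> carrier R" "\<And>i. i < n \<Longrightarrow> y i \<in> carrier R"
  shows "lcomb k u (\<lambda>i. \<ominus> y i) n = \<ominus> lcomb k u y n"
  using assms by (induction n) (auto simp: frob_minus l_minus minus_add)

lemma lcomb_smult:
  assumes "\<And>i. i < n \<Longrightarrow> u i \<in> carrier R" "\<And>i. i < n \<Longrightarrow> y i \<in> carrier R" "r \<in> carrier R"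
  shows "lcomb k u (\<lambda>i. r \<otimes> y i) n = frob k r \<otimes> lcomb k u y n"
  using assms by (induction n) (auto simp: frob_mult r_distr m_assoc)

lemma lcomb_zero:
  assumes "\<And>i. i < n \<Longrightarrow> u i \<in> carrier R" "\<And>i. i < n \<Longrightarrow> y i = \<zero>"
  shows "lcomb k u y n = \<zero>"
  using assms by (induction n) auto

lemma lcomb_single:
  assumes "j < n" "\<And>i. i < n \<Longrightarrow> u i \<in> carrier R" "z \<in> carrier R"
  shows "lcomb k u (\<lambda>i. if i = j then z else \<zero>) n = frob k z \<otimes> u j"
  using assms
proof (induction n)
  case (Suc n)
  show ?case
  proof (cases "j = n")
    case True
    then have "lcomb k u (\<lambda>i. if i = j then z else \<zero>) n = \<zero>"
      using Suc by (intro lcomb_zero) auto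
    then show ?thesis using True Suc by simp
  next
    case False
    then show ?thesis using Suc by simp
  qed
qed simp

lemma lcomb_in:
  assumes "subm e B" "\<And>i. i < n \<Longrightarrow> frob k (y i) \<otimes> u i \<in> B"
  shows "lcomb k u y n \<in> B"
  using assms(2) by (induction n) (auto intro: subm_zero[OF assms(1)] subm_add[OF assms(1)])

lemma comb_spanI: "b \<in> B \<Longrightarrow> (\<And>i. i < n \<Longrightarrow> y i \<in> A i) \<Longrightarrow> b \<oplus> lcomb k u y n \<in> comb_span k u n A B"
  by (auto simp: comb_span_def)

lemma comb_spanE:
  assumes "x \<in> comb_span k u n A B"
  obtains b y where "b \<in> B" "\<And>i. i < n \<Longrightarrow> y i \<in> A i" "x = b \<oplus> lcomb k u y n"
  using assms by (auto simp: comb_span_def)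

lemma comb_span_mono:
  "(\<And>i. i < n \<Longrightarrow> A i \<subseteq> A' i) \<Longrightarrow> B \<subseteq> B' \<Longrightarrow> comb_span k u n A B \<subseteq> comb_span k u n A' B'"
  unfolding comb_span_def by blast

lemma subm_comb_span:
  assumes u: "\<And>i. i < n \<Longrightarrow> u i \<in> carrier R" and A: "\<And>i. i < n \<Longrightarrow> subm e (A i)"
    and B: "subm (e + k) B"
  shows "subm (e + k) (comb_span k u n A B)"
proof (rule submI)
  note c = subm_carr[OF A] subm_carr[OF B]
  show "comb_span k u n A B \<subseteq> carrier R"
    using u c by (auto elim!: comb_spanE)
  have "\<zero> \<oplus> lcomb k u (\<lambda>_. \<zero>) n \<in> comb_span k u n A B"
    using A B subm_zero by (intro comb_spanI) blast+
  then show "\<zero> \<in> comb_span k u n A B" using u by (simp add: lcomb_zero)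
  show "x \<oplus> x' \<in> comb_span k u n A B"
    if x: "x \<in> comb_span k u n A B" and x': "x' \<in> comb_span k u n A B" for x x'
  proof -
    obtain b y where 1: "b \<in> B" "\<And>i. i < n \<Longrightarrow> y i \<in> A i" "x = b \<oplus> lcomb k u y n"
      using x by (elim comb_spanE) blast
    obtain b' y' where 2: "b' \<in> B" "\<And>i. i < n \<Longrightarrow> y' i \<in> A i" "x' = b' \<oplus> lcomb k u y' n"
      using x' by (elim comb_spanE) blast
    have "lcomb k u y n \<in> carrier R" "lcomb k u y' n \<in> carrier R"
      using 1 2 u c by auto
    then have "x \<oplus> x' = (b \<oplus> b') \<oplus> (lcomb k u y n \<oplus> lcomb k u y' n)"
      unfolding 1(3) 2(3) using 1 2 c by (simp add: a_ac)
    also have "lcomb k u y n \<oplus> lcomb k u y' n = lcomb k u (\<lambda>i. y i \<oplus> y' i) n"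
      using 1 2 u c by (intro lcomb_add[symmetric]) auto
    also have "(b \<oplus> b') \<oplus> \<dots> \<in> comb_span k u n A B"
      using 1 2 subm_add[OF A] subm_add[OF B] by (intro comb_spanI) auto
    finally show ?thesis .
  qed
  show "frob (e + k) r \<otimes> x \<in> comb_span k u n A B"
    if r: "r \<in> carrier R" and x: "x \<in> comb_span k u n A B" for r x
  proof -
    obtain b y where 1: "b \<in> B" "\<And>i. i < n \<Longrightarrow> y i \<in> A i" "x = b \<oplus> lcomb k u y n"
      using x by (elim comb_spanE) blast
    have l: "lcomb k u y n \<in> carrier R" using 1 u c by auto
    have "frob (e + k) r \<otimes> x = frob (e + k) r \<otimes> b \<oplus> frob (e + k) r \<otimes> lcomb k u y n"
      unfolding 1(3) using l 1 c r by (simp add: r_distr)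
    also have "frob (e + k) r \<otimes> lcomb k u y n = lcomb k u (\<lambda>i. frob e r \<otimes> y i) n"
      using 1 u c r by (subst lcomb_smult) (auto simp: frob_frob)
    also have "frob (e + k) r \<otimes> b \<oplus> \<dots> \<in> comb_span k u n A B"
      using 1 r subm_smult[OF A] subm_smult[OF B] by (intro comb_spanI) auto
    finally show ?thesis .
  qed
qed

lemma comb_span_upper:
  assumes u: "\<And>i. i < n \<Longrightarrow> u i \<in> carrier R" and A: "\<And>i. i < n \<Longrightarrow> \<zero> \<in> A i"
    and B: "subm e B"
  shows "B \<subseteq> comb_span k u n A B"
    and "j < n \<Longrightarrow> z \<in> A j \<Longrightarrow> z \<in> carrier R \<Longrightarrow> frob k z \<otimes> u j \<in> comb_span k u n A B"
proof -
  show "B \<subseteq> comb_span k u n A B"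
  proof
    fix b assume b: "b \<in> B"
    have "b \<oplus> lcomb k u (\<lambda>_. \<zero>) n \<in> comb_span k u n A B" using A b by (intro comb_spanI)
    then show "b \<in> comb_span k u n A B" using u subm_carr[OF B b] by (simp add: lcomb_zero)
  qed
  assume z: "j < n" "z \<in> A j" "z \<in> carrier R"
  have "\<zero> \<oplus> lcomb k u (\<lambda>i. if i = j then z else \<zero>) n \<in> comb_span k u n A B"
    using A z subm_zero[OF B] by (intro comb_spanI) auto
  then show "frob k z \<otimes> u j \<in> comb_span k u n A B" using z u by (simp add: lcomb_single)
qed

lemma comb_span_least:
  assumes "subm e M" "B \<subseteq> M" "\<And>i z. i < n \<Longrightarrow> z \<in> A i \<Longrightarrow> frob k z \<otimes> u i \<in> M"
  shows "comb_span k u n A B \<subseteq> M"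
proof
  fix x assume "x \<in> comb_span k u n A B"
  then obtain b y where 1: "b \<in> B" "\<And>i. i < n \<Longrightarrow> y i \<in> A i" "x = b \<oplus> lcomb k u y n"
    by (elim comb_spanE) blast
  show "x \<in> M" unfolding 1(3) using 1 assms by (intro subm_add[OF assms(1)] lcomb_in[OF assms(1)]) auto
qed

text \<open>The kernel of the semilinear map from R^n to R/B given by u lies in J^n. For J = P and a
  B that contains all multiples of p^k-th powers of elements of P, this is linear independence over
  the residue field at P, acting through p^k-th powers. A general J provides direct sums of copies
  of R/J.\<close>

definition independent_mod :: "nat \<Rightarrow> 'a set \<Rightarrow> 'a set \<Rightarrow> (nat \<Rightarrow> 'a) \<Rightarrow> nat \<Rightarrow> bool" where
  "independent_mod k B J u n \<longleftrightarrow> (\<forall>i<n. u i \<in> carrier R) \<and>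
     (\<forall>y. (\<forall>i<n. y i \<in> carrier R) \<longrightarrow> lcomb k u y n \<in> B \<longrightarrow> (\<forall>i<n. y i \<in> J))"

lemma independent_modD:
  "independent_mod k B J u n \<Longrightarrow> i < n \<Longrightarrow> u i \<in> carrier R"
  "independent_mod k B J u n \<Longrightarrow> (\<And>i. i < n \<Longrightarrow> y i \<in> carrier R) \<Longrightarrow> lcomb k u y n \<in> B \<Longrightarrow> i < n \<Longrightarrow> y i \<in> J"
  by (auto simp: independent_mod_def)

text \<open>\<open>B + \<Sum> R\<^sup>q u\<^sub>i\<close> modulo \<open>B + \<Sum> J\<^sup>q u\<^sub>i\<close> is isomorphic to \<open>(R/J)\<^sup>n\<close>; the proof replaces \<open>J\<close> by \<open>R\<close> in one
  coordinate at a time.\<close>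

lemma len_direct_sum:
  assumes P: "primeideal P R" and ind: "independent_mod k B J u n"
    and J: "subm e J" and B: "subm (e + k) B"
  shows "len P (e + k) (comb_span k u n (\<lambda>_. J) B) (comb_span k u n (\<lambda>_. carrier R) B)
    = of_nat n * len P e J (carrier R)"
proof -
  note u = independent_modD(1)[OF ind]
  define A where "A = (\<lambda>(j::nat) (i::nat). if i < j then carrier R else J)"
  define N where "N = (\<lambda>j::nat. comb_span k u n (A j) B)"
  have A: "subm e (A j i)" for j i using J by (simp add: A_def)
  have N: "subm (e + k) (N j)" for j unfolding N_def using u A B by (intro subm_comb_span) auto
  have mono: "N i \<subseteq> N j" if "i \<le> j" for i j
    unfolding N_def using that subm_carr[OF J] by (intro comb_span_mono) (auto simp: A_def)
  have N0: "N 0 = comb_span k u n (\<lambda>_. J) B" by (simp add: N_def A_def)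
  have Nn: "N n = comb_span k u n (\<lambda>_. carrier R) B"
    by (auto simp: N_def A_def comb_span_def)
  have step: "len P (e + k) (N j) (N (Suc j)) = len P e J (carrier R)" if j: "j < n" for j
  proof -
    have uj: "u j \<in> carrier R" using u j by simp
    have zA: "\<zero> \<in> A i l" for i l using subm_zero[OF A] .
    have "colon k (N j) (u j) = J"
    proof
      show "J \<subseteq> colon k (N j) (u j)"
        using comb_span_upper(2)[of n u "A j" "e + k" B j _ k] u zA B j subm_carr[OF J]
        by (auto simp: colon_def N_def A_def)
      show "colon k (N j) (u j) \<subseteq> J"
      proof
        fix z assume "z \<in> colon k (N j) (u j)"
        then have z: "z \<in> carrier R" "frob k z \<otimes> u j \<in> N j" by (auto simp: colon_def)
        then obtain b y where 1: "b \<in> B" "\<And>i. i < n \<Longrightarrow> y i \<in> A j i"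
          "frob k z \<otimes> u j = b \<oplus> lcomb k u y n"
          unfolding N_def by (elim comb_spanE) blast
        have y: "y i \<in> carrier R" if "i < n" for i using 1(2)[OF that] subm_carr[OF A] by blast
        let ?z = "\<lambda>i. if i = j then z else \<zero>"
        have bc: "b \<in> carrier R" using 1 subm_carr[OF B] by simp
        have lc: "lcomb k u y n \<in> carrier R" using u y by simp
        have "lcomb k u (\<lambda>i. ?z i \<oplus> \<ominus> y i) n = lcomb k u ?z n \<oplus> \<ominus> lcomb k u y n"
          using u y z by (subst lcomb_add) (auto simp: lcomb_minus)
        also have "\<dots> = b \<oplus> lcomb k u y n \<oplus> \<ominus> lcomb k u y n"
          using lcomb_single[OF j] u z 1(3) by simp
        also have "\<dots> = b" using bc lc by (simp add: a_assoc r_neg)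
        finally have "lcomb k u (\<lambda>i. ?z i \<oplus> \<ominus> y i) n \<in> B" using 1 by simp
        then have "z \<oplus> \<ominus> y j \<in> J"
          using independent_modD(2)[OF ind, of "\<lambda>i. ?z i \<oplus> \<ominus> y i" j] y z j by auto
        moreover have "y j \<in> J" using 1(2)[OF j] by (simp add: A_def)
        ultimately have "(z \<oplus> \<ominus> y j) \<oplus> y j \<in> J" using subm_add[OF J] by blast
        then show "z \<in> J" using z y[OF j] by (simp add: a_assoc l_neg)
      qed
    qed
    moreover have "adjoin k (N j) (u j) = N (Suc j)"
    proof
      show "adjoin k (N j) (u j) \<subseteq> N (Suc j)"
      proof (rule adjoin_least[OF N])
        show "N j \<subseteq> N (Suc j)" by (rule mono) simp
        show "frob k y \<otimes> u j \<in> N (Suc j)" if "y \<in> carrier R" for y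
          using comb_span_upper(2)[of n u "A (Suc j)" "e + k" B j _ k] u zA B j that
          by (auto simp: N_def A_def)
      qed
      show "N (Suc j) \<subseteq> adjoin k (N j) (u j)"
      proof
        fix x assume "x \<in> N (Suc j)"
        then obtain b y where 1: "b \<in> B" "\<And>i. i < n \<Longrightarrow> y i \<in> A (Suc j) i" "x = b \<oplus> lcomb k u y n"
          unfolding N_def by (elim comb_spanE) blast
        have y: "y i \<in> carrier R" if "i < n" for i using 1(2)[OF that] subm_carr[OF A] by blast
        let ?y = "y(j := \<zero>)" and ?z = "\<lambda>i. if i = j then y j else \<zero>"
        have bc: "b \<in> carrier R" using 1 subm_carr[OF B] by simp
        have lc: "lcomb k u ?y n \<in> carrier R" using u y by simp
        have "lcomb k u y n = lcomb k u (\<lambda>i. ?y i \<oplus> ?z i) n"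
          using y by (intro lcomb_cong) auto
        also have "\<dots> = lcomb k u ?y n \<oplus> frob k (y j) \<otimes> u j"
          using u y j lcomb_single[OF j] by (subst lcomb_add) auto
        finally have "x = (b \<oplus> lcomb k u ?y n) \<oplus> frob k (y j) \<otimes> u j"
          unfolding 1(3) using bc lc y[OF j] uj by (simp add: a_assoc)
        moreover have "b \<oplus> lcomb k u ?y n \<in> N j"
          unfolding N_def
        proof (intro comb_spanI 1(1))
          fix i assume i: "i < n"
          show "?y i \<in> A j i" using 1(2)[OF i] subm_zero[OF J] i by (auto simp: A_def less_Suc_eq split: if_splits)
        qed
        ultimately show "x \<in> adjoin k (N j) (u j)"
          using y[OF j] unfolding adjoin_def set_add_def' by blast
      qed
    qed
    ultimately show ?thesis using len_adjoin[OF N uj P, of j] by simp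
  qed
  have "len P (e + k) (N 0) (N j) = of_nat j * len P e J (carrier R)" if "j \<le> n" for j
    using that
  proof (induction j)
    case 0
    then show ?case by (simp add: len_self)
  next
    case (Suc j)
    have "len P (e + k) (N 0) (N (Suc j)) = len P (e + k) (N 0) (N j) + len P (e + k) (N j) (N (Suc j))"
      using mono by (intro len_add[OF P] N) auto
    then show ?case using Suc step by (simp add: algebra_simps distrib_right)
  qed
  from this[of n] show ?thesis using N0 Nn by simp
qed

text \<open>In \<open>len_direct_sum\<close> with J = P the smaller span is B itself, because
  multiples of p^e-th powers of elements of P lie in B, and R/P has length 1 at P.\<close>

lemma len_independent:
  assumes P: "primeideal P R" and ind: "independent_mod e B P u n" and B: "subm e B"
    and PB: "\<And>r x. r \<in> P \<Longrightarrow> x \<in> carrier R \<Longrightarrow> frob e r \<otimes> x \<in> B"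
  shows "len P e B (comb_span e u n (\<lambda>_. carrier R) B) = of_nat n"
    and "of_nat n \<le> len P e B (carrier R)"
proof -
  note u = independent_modD(1)[OF ind]
  have "comb_span e u n (\<lambda>_. P) B = B"
  proof
    show "comb_span e u n (\<lambda>_. P) B \<subseteq> B" using PB u by (intro comb_span_least[OF B]) auto
    have "\<zero> \<in> P" using subm_zero[OF subm_ideal[OF prime_ideal[OF P]]] .
    then show "B \<subseteq> comb_span e u n (\<lambda>_. P) B" using B u by (intro comb_span_upper)
  qed
  then show 1: "len P e B (comb_span e u n (\<lambda>_. carrier R) B) = of_nat n"
    using len_direct_sum[OF P ind, of 0] B len_prime_0[OF P] subm_ideal[OF prime_ideal[OF P], of 0]
    by simp
  have "subm e (comb_span e u n (\<lambda>_. carrier R) B)"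
    using subm_comb_span[of n u 0 "\<lambda>_. carrier R" e B] u B by auto
  then have "comb_span e u n (\<lambda>_. carrier R) B \<subseteq> carrier R" using subm_carr by blast
  then show "of_nat n \<le> len P e B (carrier R)"
    unfolding 1[symmetric] using u B by (intro len_mono comb_span_upper) auto
qed

text \<open>In a new relation the coefficient of x must lie in P, for otherwise it could be inverted
  and would put x into the saturated span. The term of x is then in B, and a relation of the old
  family remains.\<close>

lemma independent_extend:
  assumes P: "primeideal P R" and ind: "independent_mod e B P u n" and B: "subm e B"
    and PB: "\<And>r x. r \<in> P \<Longrightarrow> x \<in> carrier R \<Longrightarrow> frob e r \<otimes> x \<in> B"
    and x: "x \<in> carrier R" "x \<notin> sat P e (comb_span e u n (\<lambda>_. carrier R) B)"
  shows "independent_mod e B P (u(n := x)) (Suc n)"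
  unfolding independent_mod_def
proof (intro conjI allI impI)
  note u = independent_modD(1)[OF ind]
  show "(u(n := x)) i \<in> carrier R" if "i < Suc n" for i
    using u that x by (auto simp: less_Suc_eq)
  fix y i assume y: "\<forall>i<Suc n. y i \<in> carrier R" and mem: "lcomb e (u(n := x)) y (Suc n) \<in> B" and i: "i < Suc n"
  have eq: "lcomb e (u(n := x)) y n = lcomb e u y n" by (intro lcomb_cong) auto
  have lc: "lcomb e u y n \<in> carrier R" using u y by simp
  have mem': "lcomb e u y n \<oplus> frob e (y n) \<otimes> x \<in> B" using mem eq by simp
  have "y n \<in> P"
  proof (rule ccontr)
    assume nP: "y n \<notin> P"
    have "(lcomb e u y n \<oplus> frob e (y n) \<otimes> x) \<oplus> lcomb e u (\<lambda>i. \<ominus> y i) n \<in> comb_span e u n (\<lambda>_. carrier R) B"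
      using mem' y by (intro comb_spanI) auto
    moreover have "(lcomb e u y n \<oplus> frob e (y n) \<otimes> x) \<oplus> lcomb e u (\<lambda>i. \<ominus> y i) n = frob e (y n) \<otimes> x"
    proof -
      have "frob e (y n) \<otimes> x \<in> carrier R" using y x by simp
      moreover have "lcomb e u (\<lambda>i. \<ominus> y i) n = \<ominus> lcomb e u y n" using u y by (intro lcomb_minus) auto
      moreover have "(l \<oplus> f) \<oplus> \<ominus> l = f" if "l \<in> carrier R" "f \<in> carrier R" for l f
        using that by algebra
      ultimately show ?thesis using lc by simp
    qed
    ultimately show False using satI[of x "y n" P e] x nP y by simp
  qed
  then have "frob e (y n) \<otimes> x \<in> B" using PB x by simp
  then have "(lcomb e u y n \<oplus> frob e (y n) \<otimes> x) \<ominus> frob e (y n) \<otimes> x \<in> B"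
    using mem' by (intro subm_diff[OF B])
  moreover have "(lcomb e u y n \<oplus> frob e (y n) \<otimes> x) \<ominus> frob e (y n) \<otimes> x = lcomb e u y n"
    using lc y x by (simp add: minus_eq a_assoc r_neg)
  ultimately have "j < n \<Longrightarrow> y j \<in> P" for j using independent_modD(2)[OF ind, of y j] y by auto
  then show "y i \<in> P" using \<open>y n \<in> P\<close> i by (auto simp: less_Suc_eq)
qed

text \<open>Independent families have at most n members, so one of maximal size exists. It spans
  after localization, since otherwise it could be extended, and additivity of lengths shows that its
  size is n.\<close>

lemma basis_exists:
  assumes P: "primeideal P R" and B: "subm e B"
    and PB: "\<And>r x. r \<in> P \<Longrightarrow> x \<in> carrier R \<Longrightarrow> frob e r \<otimes> x \<in> B"
    and len: "len P e B (carrier R) = enat n"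
  obtains u where "independent_mod e B P u n"
    "sat P e (comb_span e u n (\<lambda>_. carrier R) B) = carrier R"
proof -
  define S where "S = {m. \<exists>u. independent_mod e B P u m}"
  have le: "m \<le> n" if m: "m \<in> S" for m
  proof -
    obtain u where "independent_mod e B P u m" using m by (auto simp: S_def)
    from len_independent(2)[OF P this B PB] show ?thesis using len by (simp add: of_nat_eq_enat)
  qed
  have "0 \<in> S" by (auto simp: S_def independent_mod_def)
  then have "Max S \<in> S" using le by (intro Max_in finite_subset[of S "{..n}"]) auto
  then obtain u where u: "independent_mod e B P u (Max S)" by (auto simp: S_def)
  note uc = independent_modD(1)[OF u]
  let ?L = "comb_span e u (Max S) (\<lambda>_. carrier R) B"
  have L: "subm e ?L" using subm_comb_span[of _ u 0 "\<lambda>_. carrier R" e B] uc B by auto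
  have all: "sat P e ?L = carrier R"
  proof (rule ccontr)
    assume "sat P e ?L \<noteq> carrier R"
    then obtain x where x: "x \<in> carrier R" "x \<notin> sat P e ?L" by (auto simp: sat_def)
    have "Suc (Max S) \<in> S"
      using independent_extend[OF P u B PB x] by (auto simp: S_def)
    then have "Suc (Max S) \<le> Max S" using le by (intro Max_ge finite_subset[of S "{..n}"]) auto
    then show False by simp
  qed
  have "len P e ?L (carrier R) = len P e (carrier R) (carrier R)"
    using all sat_eq[OF P sat_subm_carrier] by (intro len_cong_sat) auto
  then have "len P e ?L (carrier R) = 0" by (simp add: len_self)
  moreover have "len P e B (carrier R) = len P e B ?L + len P e ?L (carrier R)"
    using B L subm_carr[OF L] uc by (intro len_add[OF P] comb_span_upper) auto
  ultimately have "n = Max S"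
    using len len_independent(1)[OF P u B PB] by (simp add: of_nat_eq_enat)
  then show ?thesis using that u all by blast
qed

text \<open>A common denominator for the finitely many generators serves for all of R, because the
  elements that it multiplies into L form a submodule.\<close>

lemma uniform_denominator:
  assumes Q: "primeideal Q R" and G: "finite G" "G \<subseteq> carrier R" "generates e {\<zero>} G"
    and L: "subm e L" and all: "sat Q e L = carrier R"
  shows "\<exists>c\<in>carrier R - Q. \<forall>x\<in>carrier R. frob e c \<otimes> x \<in> L"
proof -
  have "\<exists>c\<in>carrier R - Q. \<forall>g\<in>G. frob e c \<otimes> g \<in> L"
    using G(1,2)
  proof (induction G)
    case empty
    then show ?case using one_notin_prime[OF Q] by auto
  next
    case (insert g G)
    then obtain c where c: "c \<in> carrier R - Q" "\<And>g. g \<in> G \<Longrightarrow> frob e c \<otimes> g \<in> L" by auto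
    have "g \<in> sat Q e L" using all insert by simp
    then obtain s where s: "s \<in> carrier R - Q" "frob e s \<otimes> g \<in> L" by (auto simp: sat_def)
    have "frob e (s \<otimes> c) \<otimes> h = frob e s \<otimes> (frob e c \<otimes> h)" "frob e (s \<otimes> c) \<otimes> h = frob e c \<otimes> (frob e s \<otimes> h)"
      if "h \<in> carrier R" for h using s c that by (simp_all add: frob_mult m_ac)
    then have "frob e (s \<otimes> c) \<otimes> g \<in> L" "h \<in> G \<Longrightarrow> frob e (s \<otimes> c) \<otimes> h \<in> L" for h
      using s c(1) insert.prems subm_smult[OF L _ s(2), of c] subm_smult[OF L _ c(2), of s h]
      by (simp_all add: subset_eq)
    then have "\<forall>h\<in>insert g G. frob e (s \<otimes> c) \<otimes> h \<in> L" by blast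
    then show ?case using mult_notin_prime[OF Q s(1) c(1)] by blast
  qed
  then obtain c where c: "c \<in> carrier R - Q" "\<forall>g\<in>G. frob e c \<otimes> g \<in> L" by blast
  let ?M = "{x \<in> carrier R. frob e c \<otimes> x \<in> L}"
  have "subm e ?M"
  proof (rule submI)
    show "\<zero> \<in> ?M" using c subm_zero[OF L] by simp
    show "x \<oplus> y \<in> ?M" if "x \<in> ?M" "y \<in> ?M" for x y
      using that c subm_add[OF L] by (simp add: r_distr)
    show "frob e r \<otimes> x \<in> ?M" if "r \<in> carrier R" "x \<in> ?M" for r x
      using that c subm_smult[OF L, of r "frob e c \<otimes> x"] by (simp add: m_lcomm)
  qed auto
  then have "?M = carrier R"
    using G c subm_zero[OF \<open>subm e ?M\<close>] by (intro generatesD[OF G(3)]) auto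
  then show ?thesis using c by blast
qed

end


section \<open>Noetherian induction on ideals\<close>

text \<open>Passing to strictly larger ideals is well-founded, as the union of an ascending chain of
  ideals is a member of the chain.\<close>

lemma (in noetherian_domain) ideal_induct [consumes 1, case_names less]:
  assumes "ideal I R"
    and step: "\<And>I. ideal I R \<Longrightarrow> (\<And>J. ideal J R \<Longrightarrow> I \<subset> J \<Longrightarrow> Q J) \<Longrightarrow> Q I"
  shows "Q I"
proof -
  let ?r = "{(J, I). ideal I R \<and> ideal J R \<and> I \<subset> J}"
  have "wf ?r"
    unfolding wf_iff_no_infinite_down_chain
  proof
    assume "\<exists>f. \<forall>i. (f (Suc i), f i) \<in> ?r"
    then obtain f where "\<forall>i. (f (Suc i), f i) \<in> ?r" by blast
    then have f: "ideal (f i) R" "f i \<subset> f (Suc i)" for i by auto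
    have mono: "f i \<subseteq> f j" if "i \<le> j" for i j
      using that f(2) by (induction rule: dec_induct) auto
    have "subset.chain {I. ideal I R} (range f)"
      unfolding subset_chain_def
    proof (intro conjI ballI)
      fix I J assume "I \<in> range f" "J \<in> range f"
      then obtain i j where "I = f i" "J = f j" by auto
      then show "I \<subseteq> J \<or> J \<subseteq> I" using mono[of i j] mono[of j i] by (cases i j rule: le_cases) auto
    qed (use f(1) in auto)
    then have "\<Union>(range f) \<in> range f" by (intro ideal_chain_is_trivial) auto
    then obtain n where "\<Union>(range f) = f n" by auto
    then have "f (Suc n) \<subseteq> f n" by blast
    then show False using f(2)[of n] by blast
  qed
  then show ?thesis using assms(1)
  proof (induction I rule: wf_induct_rule)
    case (less I)
    then show ?case using step[of I] by auto
  qed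
qed

lemma (in noetherian_domain) maximal_ideal_in_family:
  assumes "I \<in> F" "\<And>J. J \<in> F \<Longrightarrow> ideal J R"
  obtains J where "J \<in> F" "I \<subseteq> J" "\<And>K. K \<in> F \<Longrightarrow> \<not> J \<subset> K"
proof -
  have "\<exists>J\<in>F. I \<subseteq> J \<and> (\<forall>K\<in>F. \<not> J \<subset> K)"
    using assms(2)[OF assms(1)] assms(1)
  proof (induction rule: ideal_induct)
    case (less I)
    show ?case
    proof (cases "\<exists>K\<in>F. I \<subset> K")
      case True
      then obtain K where K: "K \<in> F" "I \<subset> K" by blast
      from less(2)[OF assms(2)[OF K(1)] K(2) K(1)]
      obtain J where "J \<in> F" "K \<subseteq> J" "\<forall>L\<in>F. \<not> J \<subset> L" by auto
      then show ?thesis using K(2) by (intro bexI[of _ J]) auto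
    next
      case False
      then show ?thesis using less(3) by (intro bexI[of _ I]) auto
    qed
  qed
  then obtain J where J: "J \<in> F" "I \<subseteq> J" "\<forall>K\<in>F. \<not> J \<subset> K" by (elim bexE conjE)
  show ?thesis by (rule that[OF J(1,2)]) (use J(3) in simp)
qed

locale ffinite_domain = noetherian_domain R + char_p_ring R p for R (structure) and p +
  assumes ffinite: "F_finite p R"
begin

text \<open>In place of a prime filtration: every ideal is reached from \<open>R\<close> and the primes through the sequences
  \<open>0 \<rightarrow> R/(J : a) \<rightarrow> R/J \<rightarrow> R/(J + aR) \<rightarrow> 0\<close>.\<close>

lemma ideal_devissage [consumes 1, case_names carrier prime_ideal extension]:
  assumes J: "ideal J R"
    and carr: "Q (carrier R)"
    and prim: "\<And>H. primeideal H R \<Longrightarrow> (\<And>I. ideal I R \<Longrightarrow> H \<subset> I \<Longrightarrow> Q I) \<Longrightarrow> Q H"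
    and ext: "\<And>J a. ideal J R \<Longrightarrow> a \<in> carrier R \<Longrightarrow> J \<subset> adjoin 0 J a \<Longrightarrow> J \<subset> colon 0 J a \<Longrightarrow>
      Q (adjoin 0 J a) \<Longrightarrow> Q (colon 0 J a) \<Longrightarrow> Q J"
  shows "Q J"
  using J
proof (induction rule: ideal_induct)
  case (less J)
  show ?case
  proof (cases "J = carrier R")
    case True
    then show ?thesis using carr by simp
  next
    case False
    show ?thesis
    proof (cases "\<forall>a\<in>carrier R. \<forall>b\<in>carrier R. a \<otimes> b \<in> J \<longrightarrow> a \<in> J \<or> b \<in> J")
      case True
      have "primeideal J R"
        using less(1) False True is_cring by (intro primeidealI) auto
      then show ?thesis using prim less by blast
    next
      case no: False
      \<comment> \<open>If J is neither R nor prime, such a pair makes both J + aR and J : a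
        strictly larger than J: the first contains a, the second b.\<close>
      then obtain a b where ab: "a \<in> carrier R" "b \<in> carrier R" "a \<otimes> b \<in> J" "a \<notin> J" "b \<notin> J" by blast
      have s: "subm 0 J" using less(1) by (rule subm_ideal)
      have 1: "J \<subset> adjoin 0 J a"
        using adjoin_upper[OF s ab(1), where k = 0] ab by blast
      have "J \<subseteq> colon 0 J a"
        using ideal.I_r_closed[OF less(1)] ab(1) subm_carr[OF s] by (auto simp: colon_def)
      moreover have "b \<in> colon 0 J a" using ab by (simp add: colon_def m_comm)
      ultimately have 2: "J \<subset> colon 0 J a" using ab by blast
      show ?thesis
        using ext[OF less(1) ab(1) 1 2] less(2)[OF _ 1] less(2)[OF _ 2]
          ideal_adjoin[OF less(1) ab(1)] ideal_colon[OF less(1) ab(1)] by blast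
    qed
  qed
qed

lemma len_extension:
  assumes P: "primeideal P R" and J: "ideal J R" and a: "a \<in> carrier R"
  shows "len P e J (carrier R) = len P e (colon 0 J a) (carrier R) + len P e (adjoin 0 J a) (carrier R)"
proof -
  have s: "subm e J" using J by (rule subm_ideal)
  have t: "subm e (adjoin 0 J a)" using ideal_adjoin[OF J a] by (rule subm_ideal)
  have "len P e J (carrier R) = len P e J (adjoin 0 J a) + len P e (adjoin 0 J a) (carrier R)"
    using s t adjoin_upper(1)[OF s a] subm_carr[OF t] by (intro len_add[OF P]) auto
  moreover have "len P e J (adjoin 0 J a) = len P e (colon 0 J a) (carrier R)"
    using len_adjoin[of e 0 J a P] s a P by simp
  ultimately show ?thesis by simp
qed

lemma len_not_below:
  assumes P: "primeideal P R" and J: "ideal J R" and "\<not> J \<subseteq> P"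
  shows "len P e J (carrier R) = 0"
proof -
  have s: "subm e J" using J by (rule subm_ideal)
  obtain t where t: "t \<in> J" "t \<notin> P" using assms by blast
  then have "t \<in> carrier R - P" using subm_carr[OF s] by simp
  moreover have "frob e t \<otimes> x \<in> J" if "x \<in> carrier R" for x
    using ideal.I_r_closed[OF J frob_in_ideal[OF J t(1)] that] .
  ultimately have "sat P e J = carrier R" by (auto simp: sat_def)
  then have "len P e J (carrier R) = len P e (carrier R) (carrier R)"
    using sat_eq[OF P sat_subm_carrier] by (intro len_cong_sat) auto
  then show ?thesis by (simp add: len_self)
qed

text \<open>m counts how often R/P occurs when R/J is filtered and localized at P; the other prime
  quotients vanish there. The filtration is by ideals, so the same m serves every exponent, which is
  what allows lengths at exponents 0 and 1 to be compared.\<close>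

lemma finite_len:
  assumes P: "primeideal P R" and J: "ideal J R"
    and top: "\<And>H. primeideal H R \<Longrightarrow> J \<subseteq> H \<Longrightarrow> H \<subseteq> P \<Longrightarrow> H = P"
  shows "\<exists>m. \<forall>e. len P e J (carrier R) = of_nat m * len P e P (carrier R)"
  using J top
proof (induction rule: ideal_devissage)
  case carrier
  then show ?case by (intro exI[of _ 0]) (simp add: len_self)
next
  case (prime_ideal H)
  show ?case
  proof (cases "H \<subseteq> P")
    case True
    then have "H = P" using prime_ideal by blast
    then show ?thesis by (intro exI[of _ 1]) simp
  next
    case False
    then show ?thesis
      by (intro exI[of _ 0]) (simp add: len_not_below[OF P primeideal.axioms(1)[OF \<open>primeideal H R\<close>]])
  qed
next
  case (extension J a)
  have "H = P" if "primeideal H R" "adjoin 0 J a \<subseteq> H \<or> colon 0 J a \<subseteq> H" "H \<subseteq> P" for H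
    using extension(7)[OF that(1) _ that(3)] extension(3,4) that(2) by blast
  then obtain m n where m: "\<And>e. len P e (adjoin 0 J a) (carrier R) = of_nat m * len P e P (carrier R)"
    and n: "\<And>e. len P e (colon 0 J a) (carrier R) = of_nat n * len P e P (carrier R)"
    using extension(5,6) by blast
  show ?case
    by (intro exI[of _ "n + m"] allI)
       (simp add: len_extension[OF P \<open>ideal J R\<close> \<open>a \<in> carrier R\<close>] m n distrib_right)
qed


section \<open>Residue degrees of Frobenius\<close>

lemma frobenius_generators:
  obtains G where "finite G" "G \<subseteq> carrier R" "generates 1 {\<zero>} G"
proof -
  obtain B where B: "finite B" "module_generated_by R (frob_push R p) B"
    using ffinite by (auto simp: F_finite_def)
  have "generates 1 {\<zero>} B"
    unfolding generates_def
  proof (intro allI impI)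
    fix M assume M: "subm 1 M \<and> {\<zero>} \<subseteq> M \<and> B \<subseteq> M"
    then have s: "subm 1 M" by simp
    have "submodule M R (frob_push R p)"
    proof (intro submodule.intro submodule_axioms.intro subgroup.intro)
      show "x \<otimes>\<^bsub>add_monoid (frob_push R p)\<^esub> y \<in> M" if "x \<in> M" "y \<in> M" for x y
        using subm_add[OF s that] by (simp add: frob_push_def)
      show "inv\<^bsub>add_monoid (frob_push R p)\<^esub> x \<in> M" if "x \<in> M" for x
        using subm_neg[OF s that] by (simp add: frob_push_def a_inv_def m_inv_def)
      show "a \<odot>\<^bsub>frob_push R p\<^esub> x \<in> M" if "a \<in> carrier R" "x \<in> M" for a x
        using subm_smult[OF s that] by (simp add: frob_push_def frob_def)
    qed (use subm_carr[OF s] subm_zero[OF s] in \<open>auto simp: frob_push_def\<close>)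
    then show "M = carrier R" using B M unfolding module_generated_by_def by (auto simp: frob_push_def)
  qed
  moreover have "B \<subseteq> carrier R" using B by (auto simp: module_generated_by_def frob_push_def)
  ultimately show ?thesis using that B by blast
qed

text \<open>The degree \<open>[\<kappa>(P) : \<kappa>(P)\<^sup>p]\<close>.\<close>

definition fdeg :: "'a set \<Rightarrow> nat" where
  "fdeg P = the_enat (len P 1 P (carrier R))"

text \<open>The generators of F_*R over R bound all residue degrees at once. Besides finiteness,
  this supplies the measure that makes the descent in \<open>fdeg_chain\<close> end.\<close>

lemma fdeg_bounded: "\<exists>N. \<forall>P. primeideal P R \<longrightarrow> len P 1 P (carrier R) \<le> enat N"
proof -
  obtain G where G: "finite G" "G \<subseteq> carrier R" "generates 1 {\<zero>} G" by (rule frobenius_generators)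
  have "len P 1 P (carrier R) \<le> card G" if P: "primeideal P R" for P
    using len_le_generators[OF P G(1,2) subm_ideal[OF prime_ideal[OF P]]]
      prime_frobenius_closed[OF P] generates_mono[OF G(3)] subm_zero[OF subm_ideal[OF prime_ideal[OF P]]]
    by simp
  then show ?thesis by blast
qed

lemma len_eq_fdeg:
  assumes "primeideal P R" shows "len P 1 P (carrier R) = of_nat (fdeg P)"
proof -
  obtain N where "len P 1 P (carrier R) \<le> enat N" using fdeg_bounded assms by blast
  then show ?thesis by (cases "len P 1 P (carrier R)") (auto simp: fdeg_def of_nat_eq_enat)
qed

lemma fdeg_pos: "primeideal P R \<Longrightarrow> 0 < fdeg P"
  using len_prime_pos[of P 1] len_eq_fdeg[of P] by (cases "fdeg P") auto

text \<open>Lifts to R of a basis of the residue field at Q over its p-th powers, together with one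
  denominator c for all of R.\<close>

lemma fdeg_basis:
  assumes Q: "primeideal Q R"
  obtains u c where "independent_mod 1 Q Q u (fdeg Q)" "c \<in> carrier R - Q"
    "\<And>x. x \<in> carrier R \<Longrightarrow> frob 1 c \<otimes> x \<in> comb_span 1 u (fdeg Q) (\<lambda>_. carrier R) Q"
proof -
  have s: "subm e Q" for e using subm_ideal[OF prime_ideal[OF Q]] .
  have len: "len Q 1 Q (carrier R) = enat (fdeg Q)" using len_eq_fdeg[OF Q] by (simp add: of_nat_eq_enat)
  obtain u where u: "independent_mod 1 Q Q u (fdeg Q)"
    "sat Q 1 (comb_span 1 u (fdeg Q) (\<lambda>_. carrier R) Q) = carrier R"
    by (rule basis_exists[OF Q s prime_frobenius_closed[OF Q] len])
  obtain G where G: "finite G" "G \<subseteq> carrier R" "generates 1 {\<zero>} G" by (rule frobenius_generators)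
  have "subm 1 (comb_span 1 u (fdeg Q) (\<lambda>_. carrier R) Q)"
    using subm_comb_span[of "fdeg Q" u 0 "\<lambda>_. carrier R" 1 Q] s independent_modD(1)[OF u(1)] by simp
  from uniform_denominator[OF Q G this u(2)]
  obtain c where c: "c \<in> carrier R - Q"
    "\<forall>x\<in>carrier R. frob 1 c \<otimes> x \<in> comb_span 1 u (fdeg Q) (\<lambda>_. carrier R) Q" by blast
  show ?thesis by (rule that[OF u(1) c(1)]) (use c(2) in blast)
qed

text \<open>Kunz's formula in dimension one. With \<open>L = Q + \<Sum> R\<^sup>p u\<^sub>i\<close> of finite colength at \<open>P\<close> and \<open>x \<in> P - Q\<close>,
  compare the two ways to compute the length of \<open>F\<^sub>*R\<close> over \<open>Q + x\<^sup>p L\<close>.\<close>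

lemma fdeg_adjacent:
  assumes Q: "primeideal Q R" and P: "primeideal P R" and QP: "Q \<subset> P"
    and adj: "\<And>H. primeideal H R \<Longrightarrow> Q \<subset> H \<Longrightarrow> H \<subseteq> P \<Longrightarrow> H = P"
  shows "fdeg Q = p * fdeg P"
proof -
  define r where "r = fdeg Q"
  have sQ: "subm e Q" for e using subm_ideal[OF prime_ideal[OF Q]] .
  have Qc: "q \<in> carrier R" if "q \<in> Q" for q using subm_carr[OF sQ that] .
  have Qr: "q \<otimes> y \<in> Q" if "q \<in> Q" "y \<in> carrier R" for q y
    using ideal.I_r_closed[OF prime_ideal[OF Q] that] .
  have Qcancel: "y \<in> Q" if "y \<otimes> z \<in> Q" "y \<in> carrier R" "z \<in> carrier R - Q" for y z
    using primeideal.I_prime[OF Q, of y z] that by auto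
  obtain u c where u: "independent_mod 1 Q Q u r" and c: "c \<in> carrier R - Q"
    "\<And>x. x \<in> carrier R \<Longrightarrow> frob 1 c \<otimes> x \<in> comb_span 1 u r (\<lambda>_. carrier R) Q"
    unfolding r_def by (rule fdeg_basis[OF Q]) blast
  note uc = independent_modD(1)[OF u]
  define L where "L = comb_span 1 u r (\<lambda>_. carrier R) Q"
  have sL: "subm 1 L"
    unfolding L_def using subm_comb_span[of r u 0 "\<lambda>_. carrier R" 1 Q] sQ uc by simp
  have QL: "Q \<subseteq> L" unfolding L_def using comb_span_upper(1)[of r u "\<lambda>_. carrier R" 1 Q] sQ uc by simp
  obtain x where x: "x \<in> P" "x \<notin> Q" using QP by blast
  have xc: "x \<in> carrier R" using x prime_subset[OF P] by blast
  have xpow: "x [^] (i::nat) \<in> carrier R - Q" for i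
    using x xc one_notin_prime[OF Q] mult_notin_prime[OF Q, of _ x] by (induction i) auto
  have frob1: "frob 1 x = x [^] p" by (simp add: frob_def)

  \<comment> \<open>No prime lies strictly between Q and P, so Q + yR has finite colength at P as
    soon as y is not in Q.\<close>
  have fin: "\<exists>m. \<forall>e. len P e (adjoin 0 Q y) (carrier R) = of_nat m * len P e P (carrier R)"
    if y: "y \<in> carrier R - Q" for y
  proof (rule finite_len[OF P])
    show "ideal (adjoin 0 Q y) R" using ideal_adjoin[OF prime_ideal[OF Q]] y by simp
    show "H = P" if "primeideal H R" "adjoin 0 Q y \<subseteq> H" "H \<subseteq> P" for H
      using adj[OF that(1) _ that(3)] that(2) adjoin_upper[OF sQ, where k = 0] y by blast
  qed

  define J where "J = adjoin 0 Q x"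
  have iJ: "ideal J R" unfolding J_def using ideal_adjoin[OF prime_ideal[OF Q] xc] .
  have sJ: "subm e J" for e using iJ by (rule subm_ideal)
  have QJ: "Q \<subseteq> J" unfolding J_def using adjoin_upper[OF sQ xc] by blast
  obtain m where m: "\<And>e. len P e J (carrier R) = of_nat m * len P e P (carrier R)"
    using fin[of x] x xc by (auto simp: J_def)
  have m0: "len P 0 J (carrier R) = of_nat m" using m[of 0] len_prime_0[OF P] by simp
  have "J \<subseteq> P" unfolding J_def
    using QP x ideal.I_l_closed[OF prime_ideal[OF P]]
    by (intro adjoin_least[of 0 0]) (auto intro: subm_ideal[OF prime_ideal[OF P]])
  then have "len P 0 P (carrier R) \<le> of_nat m"
    unfolding m0[symmetric] using prime_subset[OF P] by (intro len_mono) auto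
  then have mpos: "0 < m" using len_prime_0[OF P] by (cases m) auto

  \<comment> \<open>The filtration by Q + x^i R: each factor is a copy of R/J, as x is a
    nonzerodivisor modulo Q. At exponent 1 and for i = p its colength is p m
    \<open>fdeg P\<close>.\<close>
  define K where "K = (\<lambda>i::nat. adjoin 0 Q (x [^] i))"
  have K: "ideal (K i) R" for i unfolding K_def using ideal_adjoin[OF prime_ideal[OF Q]] xpow by simp
  have sK: "subm e (K i)" for e i using K by (rule subm_ideal)
  have QK: "Q \<subseteq> K i" for i unfolding K_def using adjoin_upper(1)[OF sQ] xpow by blast
  have inK: "y \<otimes> x [^] i \<in> K i" if "y \<in> carrier R" for y i
    unfolding K_def using adjoin_upper(2)[OF sQ _ that, of "x [^] i" 0] xpow[of i] that by simp
  have K_least: "K i \<subseteq> N" if "subm 1 N" "Q \<subseteq> N" "\<And>y. y \<in> carrier R \<Longrightarrow> y \<otimes> x [^] i \<in> N" for i N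
    unfolding K_def using that by (intro adjoin_least[of 1 0]) auto
  have KE: "\<exists>q\<in>Q. \<exists>z\<in>carrier R. y = q \<oplus> z \<otimes> x [^] i" if "y \<in> K i" for y i
    using that unfolding K_def by (elim adjoinE) auto
  have Kstep: "adjoin 0 (K (Suc i)) (x [^] i) = K i" for i
  proof
    have xi: "x [^] i \<in> carrier R" using xc by simp
    show "adjoin 0 (K (Suc i)) (x [^] i) \<subseteq> K i"
    proof (rule adjoin_least[of 1 0])
      show "K (Suc i) \<subseteq> K i"
      proof (rule K_least)
        show "y \<otimes> x [^] Suc i \<in> K i" if "y \<in> carrier R" for y
          using inK[of "y \<otimes> x" i] that xc by (simp add: m_ac)
      qed (use sK QK in auto)
    qed (use sK inK in auto)
    show "K i \<subseteq> adjoin 0 (K (Suc i)) (x [^] i)"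
    proof (rule K_least)
      show "subm 1 (adjoin 0 (K (Suc i)) (x [^] i))" using subm_adjoin[of 1 0 "K (Suc i)"] sK xi by simp
      show "Q \<subseteq> adjoin 0 (K (Suc i)) (x [^] i)" using QK adjoin_upper(1)[OF sK xi] by blast
      show "y \<otimes> x [^] i \<in> adjoin 0 (K (Suc i)) (x [^] i)" if "y \<in> carrier R" for y
        using adjoin_upper(2)[OF sK xi, of y 0] that by simp
    qed
  qed
  have Kcolon: "colon 0 (K (Suc i)) (x [^] i) = J" for i
  proof
    have xi: "x [^] i \<in> carrier R" using xc by simp
    show "colon 0 (K (Suc i)) (x [^] i) \<subseteq> J"
    proof
      fix y assume "y \<in> colon 0 (K (Suc i)) (x [^] i)"
      then have y: "y \<in> carrier R" "y \<otimes> x [^] i \<in> K (Suc i)" by (auto simp: colon_def)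
      then obtain q z where qz: "q \<in> Q" "z \<in> carrier R" "y \<otimes> x [^] i = q \<oplus> z \<otimes> x [^] Suc i"
        using KE by blast
      have "(y \<ominus> z \<otimes> x) \<otimes> x [^] i = y \<otimes> x [^] i \<ominus> z \<otimes> x [^] Suc i"
        using y qz xc xi by (simp, algebra)
      also have "\<dots> = q"
      proof -
        have "q \<oplus> t \<ominus> t = q" if "t \<in> carrier R" for t using that Qc[OF qz(1)] by algebra
        then show ?thesis unfolding qz(3) using qz(2) xc by simp
      qed
      finally have "y \<ominus> z \<otimes> x \<in> Q"
        using Qcancel[of "y \<ominus> z \<otimes> x" "x [^] i"] qz y xc xpow by simp
      moreover have "y = (y \<ominus> z \<otimes> x) \<oplus> z \<otimes> x" using y qz xc by algebra
      ultimately show "y \<in> J" unfolding J_def adjoin_def set_add_def' using qz(2) by auto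
    qed
    show "J \<subseteq> colon 0 (K (Suc i)) (x [^] i)" unfolding J_def
    proof (rule adjoin_least[of 0 0])
      show "subm (0 + 0) (colon 0 (K (Suc i)) (x [^] i))" using subm_colon[of 0 0 "K (Suc i)"] sK xi by simp
      show "Q \<subseteq> colon 0 (K (Suc i)) (x [^] i)" using Qr[OF _ xi] QK[of "Suc i"] Qc by (auto simp: colon_def)
      show "frob 0 y \<otimes> x \<in> colon 0 (K (Suc i)) (x [^] i)" if "y \<in> carrier R" for y
        using inK[OF that, of "Suc i"] that xc by (simp add: colon_def m_ac)
    qed
  qed
  have K0: "K 0 = carrier R"
    using inK[of _ 0] subm_carr[OF sK] by auto
  have lenK: "len P 1 (K i) (carrier R) = of_nat i * (of_nat m * of_nat (fdeg P))" for i
  proof (induction i)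
    case 0
    then show ?case by (simp add: K0 len_self)
  next
    case (Suc i)
    have "len P 1 (K (Suc i)) (carrier R) = len P 1 J (carrier R) + len P 1 (K i) (carrier R)"
      using len_extension[OF P K, of "x [^] i" 1 "Suc i"] Kstep Kcolon xc by simp
    then show ?case using Suc m[of 1] len_eq_fdeg[OF P] by (simp add: distrib_right)
  qed

  \<comment> \<open>Modulo Q, the p-th powers of elements of J = Q + xR are x^p times p-th powers,
    so \<open>L'\<close> is also Q + x^p L. The description as a span gives the length r m for L/L';
    the other one identifies R/L with (K p)/L'.\<close>
  define L' where "L' = comb_span 1 u r (\<lambda>_. J) Q"
  have sL': "subm 1 L'"
    unfolding L'_def using subm_comb_span[of r u 0 "\<lambda>_. J" 1 Q] sQ sJ uc by simp
  have zJ: "\<zero> \<in> J" using subm_zero[OF sJ] .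
  have QL': "Q \<subseteq> L'" unfolding L'_def using comb_span_upper(1)[of r u "\<lambda>_. J" 1 Q] sQ uc zJ by simp
  have L'L: "L' \<subseteq> L" unfolding L'_def L_def using subm_carr[OF sJ] by (intro comb_span_mono) auto
  have "independent_mod 1 Q J u r" using u QJ unfolding independent_mod_def by blast
  then have len1: "len P 1 L' L = of_nat r * of_nat m"
    using len_direct_sum[OF P, of 1 Q J u r 0] sJ sQ m0 unfolding L'_def L_def by simp
  have xp: "x [^] p \<in> carrier R" using xc by simp
  have Jfr: "\<exists>q\<in>Q. \<exists>y\<in>carrier R. frob 1 z \<otimes> u i = q \<oplus> (frob 1 y \<otimes> u i) \<otimes> x [^] p"
    if i: "i < r" and z: "z \<in> J" for i z
  proof -
    obtain q y where z: "q \<in> Q" "y \<in> carrier R" "z = q \<oplus> y \<otimes> x"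
      using z unfolding J_def by (elim adjoinE) auto
    have "frob 1 z \<otimes> u i = frob 1 q \<otimes> u i \<oplus> (frob 1 y \<otimes> u i) \<otimes> x [^] p"
      unfolding z(3) using z(2) Qc[OF z(1)] xc uc[OF i] frob1
      by (simp add: frob_add frob_mult l_distr) (simp add: m_ac)
    then show ?thesis using z uc[OF i] prime_frobenius_closed[OF Q] by blast
  qed
  have "adjoin 0 L' (x [^] p) = K p"
  proof
    show "adjoin 0 L' (x [^] p) \<subseteq> K p"
    proof (rule adjoin_least[of 1 0])
      show "L' \<subseteq> K p" unfolding L'_def
      proof (rule comb_span_least)
        fix i z assume i: "i < r" and "z \<in> J"
        then obtain q y where q: "q \<in> Q" "y \<in> carrier R"
          and eq: "frob 1 z \<otimes> u i = q \<oplus> (frob 1 y \<otimes> u i) \<otimes> x [^] p" using Jfr by blast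
        show "frob 1 z \<otimes> u i \<in> K p"
          unfolding eq using q uc[OF i] QK by (intro subm_add[OF sK] inK) auto
      qed (use sK QK in auto)
    qed (use sK inK in auto)
    show "K p \<subseteq> adjoin 0 L' (x [^] p)"
    proof (rule K_least)
      show "subm 1 (adjoin 0 L' (x [^] p))" using subm_adjoin[of 1 0 L'] sL' xp by simp
      show "Q \<subseteq> adjoin 0 L' (x [^] p)" using QL' adjoin_upper(1)[OF sL' xp] by blast
      show "y \<otimes> x [^] p \<in> adjoin 0 L' (x [^] p)" if "y \<in> carrier R" for y
        using adjoin_upper(2)[OF sL' xp, of y 0] that by simp
    qed
  qed
  moreover have "colon 0 L' (x [^] p) = L"
  proof
    show "L \<subseteq> colon 0 L' (x [^] p)" unfolding L_def
    proof (rule comb_span_least)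
      show s: "subm 1 (colon 0 L' (x [^] p))" using subm_colon[of 1 0 L'] sL' xp by simp
      show "Q \<subseteq> colon 0 L' (x [^] p)" using Qr[OF _ xp] QL' Qc by (auto simp: colon_def)
      fix i z assume i: "i < r" and z: "z \<in> carrier R"
      have "z \<otimes> x \<in> J" unfolding J_def using adjoin_upper(2)[OF sQ xc z, where k = 0] z by simp
      then have "frob 1 (z \<otimes> x) \<otimes> u i \<in> L'"
        unfolding L'_def using comb_span_upper(2)[of r u "\<lambda>_. J" 1 Q i "z \<otimes> x" 1] uc i zJ sQ z xc by simp
      then show "frob 1 z \<otimes> u i \<in> colon 0 L' (x [^] p)"
        using z xc uc[OF i] frob1 by (simp add: colon_def frob_mult m_ac)
    qed
    show "colon 0 L' (x [^] p) \<subseteq> L"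
    proof
      fix y assume "y \<in> colon 0 L' (x [^] p)"
      then have y: "y \<in> carrier R" "y \<otimes> x [^] p \<in> L'" by (auto simp: colon_def)
      have "\<exists>l\<in>L. \<exists>q\<in>Q. w = q \<oplus> l \<otimes> x [^] p" if "w \<in> L'" for w
      proof -
        let ?M = "Q <+> (\<lambda>l. l \<otimes> x [^] p) ` L"
        have T: "subm 1 ((\<lambda>l. l \<otimes> x [^] p) ` L)"
        proof (rule submI)
          show "(\<lambda>l. l \<otimes> x [^] p) ` L \<subseteq> carrier R" using subm_carr[OF sL] xp by auto
          show "\<zero> \<in> (\<lambda>l. l \<otimes> x [^] p) ` L" using subm_zero[OF sL] xp by (intro image_eqI[of _ _ \<zero>]) auto
          show "a \<oplus> b \<in> (\<lambda>l. l \<otimes> x [^] p) ` L"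
            if ab: "a \<in> (\<lambda>l. l \<otimes> x [^] p) ` L" "b \<in> (\<lambda>l. l \<otimes> x [^] p) ` L" for a b
          proof -
            obtain a' b' where "a' \<in> L" "b' \<in> L" "a = a' \<otimes> x [^] p" "b = b' \<otimes> x [^] p" using ab by auto
            then show ?thesis using xp subm_carr[OF sL] subm_add[OF sL]
              by (intro image_eqI[of _ _ "a' \<oplus> b'"]) (auto simp: l_distr)
          qed
          show "frob 1 s \<otimes> a \<in> (\<lambda>l. l \<otimes> x [^] p) ` L"
            if s: "s \<in> carrier R" and a: "a \<in> (\<lambda>l. l \<otimes> x [^] p) ` L" for s a
          proof -
            obtain a' where "a' \<in> L" "a = a' \<otimes> x [^] p" using a by auto
            then show ?thesis using xp subm_carr[OF sL] subm_smult[OF sL s] s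
              by (intro image_eqI[of _ _ "frob 1 s \<otimes> a'"]) (auto simp: m_assoc)
          qed
        qed
        have sM: "subm 1 ?M" using subm_sum[OF sQ T] .
        have "L' \<subseteq> ?M" unfolding L'_def
        proof (rule comb_span_least[OF sM])
          show "Q \<subseteq> ?M" using sum_upper(1)[OF sQ T] .
          fix i z assume i: "i < r" and "z \<in> J"
          then obtain q y where q: "q \<in> Q" "y \<in> carrier R"
            and eq: "frob 1 z \<otimes> u i = q \<oplus> (frob 1 y \<otimes> u i) \<otimes> x [^] p" using Jfr by blast
          have "frob 1 y \<otimes> u i \<in> L"
            unfolding L_def using comb_span_upper(2)[of r u "\<lambda>_. carrier R" 1 Q i y 1] uc i sQ q by simp
          then show "frob 1 z \<otimes> u i \<in> ?M" unfolding eq set_add_def' using q by auto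
        qed
        then have "w \<in> ?M" using that by blast
        then show ?thesis unfolding set_add_def' by auto
      qed
      then obtain l q where lq: "l \<in> L" "q \<in> Q" "y \<otimes> x [^] p = q \<oplus> l \<otimes> x [^] p" using y by blast
      have lc: "l \<in> carrier R" "q \<in> carrier R" using lq subm_carr[OF sL] Qc by auto
      have "(y \<ominus> l) \<otimes> x [^] p = y \<otimes> x [^] p \<ominus> l \<otimes> x [^] p"
        using y lc xp by algebra
      also have "\<dots> = q" unfolding lq(3) using lc xp by algebra
      finally have "y \<ominus> l \<in> Q" using Qcancel[of "y \<ominus> l" "x [^] p"] lq y lc xpow by simp
      then have "(y \<ominus> l) \<oplus> l \<in> L" using QL lq by (intro subm_add[OF sL]) auto
      moreover have "(y \<ominus> l) \<oplus> l = y" using y lc by algebra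
      ultimately show "y \<in> L" by simp
    qed
  qed
  ultimately have "len P 1 L' (carrier R) = len P 1 L (carrier R) + len P 1 (K p) (carrier R)"
  proof -
    assume 1: "adjoin 0 L' (x [^] p) = K p" and 2: "colon 0 L' (x [^] p) = L"
    have "len P 1 L' (K p) = len P 1 L (carrier R)"
      using len_adjoin[of 1 0 L' "x [^] p" P] sL' xp P 1 2 by simp
    moreover have "L' \<subseteq> K p" using adjoin_upper(1)[OF sL' xp, of 0] 1 by simp
    ultimately show ?thesis
      using len_add[OF P sL' sK[of 1 p] subm_carrier[of 1]] subm_carr[OF sK] by auto
  qed
  moreover have "len P 1 L' (carrier R) = len P 1 L' L + len P 1 L (carrier R)"
    using L'L subm_carr[OF sL] by (intro len_add[OF P] sL' sL) auto
  \<comment> \<open>The colength of L can be cancelled only if it is finite. As L contains Q + c^p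
    R, this follows from \<open>fin\<close>.\<close>
  moreover have "len P 1 L (carrier R) < \<infinity>"
  proof -
    let ?c = "frob 1 c"
    have c': "?c \<in> carrier R - Q" using frob_notin_prime[OF Q c(1)] .
    have "adjoin 0 Q ?c \<subseteq> L"
    proof (rule adjoin_least[of 1 0])
      show "frob 0 y \<otimes> frob 1 c \<in> L" if "y \<in> carrier R" for y
        using c(2)[OF that] c(1) that by (simp add: L_def m_comm)
    qed (use sL QL in auto)
    then have "len P 1 L (carrier R) \<le> len P 1 (adjoin 0 Q ?c) (carrier R)"
      using subm_carr[OF sL] by (intro len_mono) auto
    also obtain k where "len P 1 (adjoin 0 Q ?c) (carrier R) = of_nat k * len P 1 P (carrier R)"
      using fin[OF c'] by blast
    then have "len P 1 (adjoin 0 Q ?c) (carrier R) = of_nat (k * fdeg P)" using len_eq_fdeg[OF P] by simp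
    also have "\<dots> < \<infinity>" by (simp add: of_nat_eq_enat)
    finally show ?thesis .
  qed
  ultimately have "len P 1 (K p) (carrier R) = len P 1 L' L"
    by (cases "len P 1 L (carrier R)") (auto simp: add.commute)
  then have "(of_nat (p * (m * fdeg P)) :: enat) = of_nat (r * m)"
    unfolding lenK len1 by (simp only: of_nat_mult)
  then have "p * (m * fdeg P) = r * m" unfolding of_nat_eq_enat by simp
  then show ?thesis using mpos by (simp add: r_def)
qed


text \<open>Choose a prime maximal among those that contain Q and lie strictly below P. By
  \<open>fdeg_adjacent\<close> its degree is p times that of P, and degrees are bounded, so the
  descent reaches Q. Finiteness of heights is thus a result of this argument and not an
  input.\<close>

lemma fdeg_chain:
  assumes Q: "primeideal Q R" and P: "primeideal P R" and QP: "Q \<subseteq> P"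
  shows "\<exists>n h. prime_chain R n h \<and> h 0 = Q \<and> h n = P \<and> fdeg Q = p ^ n * fdeg P"
proof -
  obtain N where N: "\<And>P. primeideal P R \<Longrightarrow> fdeg P \<le> N"
    using fdeg_bounded len_eq_fdeg by (auto simp: of_nat_eq_enat)
  show ?thesis using P QP
  proof (induction "N - fdeg P" arbitrary: P rule: less_induct)
    case less
    show ?case
    proof (cases "Q = P")
      case True
      then show ?thesis using Q
        by (intro exI[of _ 0] exI[of _ "\<lambda>_. Q"]) (auto simp: prime_chain_def Spec_def)
    next
      case False
      let ?F = "{H. primeideal H R \<and> Q \<subseteq> H \<and> H \<subset> P}"
      have "Q \<in> ?F" using Q less False by auto
      then obtain H where H: "H \<in> ?F" "\<And>K. K \<in> ?F \<Longrightarrow> \<not> H \<subset> K"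
        by (rule maximal_ideal_in_family) (auto intro: prime_ideal)
      have eq: "fdeg H = p * fdeg P"
      proof (rule fdeg_adjacent)
        show "K = P" if "primeideal K R" "H \<subset> K" "K \<subseteq> P" for K
          using H(2)[of K] that H(1) by blast
      qed (use H less in auto)
      have "fdeg P < fdeg H" using eq fdeg_pos[OF less(2)] prime_gt_1_nat[OF prime_p] by simp
      moreover have "fdeg H \<le> N" using N H by simp
      ultimately have "N - fdeg H < N - fdeg P" by simp
      then obtain n h where h: "prime_chain R n h" "h 0 = Q" "h n = H" "fdeg Q = p ^ n * fdeg H"
        using less(1)[of H] H(1) by blast
      have "prime_chain R (Suc n) (h(Suc n := P))"
        using h(1,3) H(1) less(2) by (auto simp: prime_chain_def Spec_def less_Suc_eq le_Suc_eq)
      then show ?thesis using h eq by (intro exI[of _ "Suc n"] exI[of _ "h(Suc n := P)"]) auto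
    qed
  qed
qed

lemma fdeg_strict:
  assumes Q: "primeideal Q R" and P: "primeideal P R" and QP: "Q \<subset> P"
  shows "p * fdeg P \<le> fdeg Q"
proof -
  obtain n h where h: "prime_chain R n h" "h 0 = Q" "h n = P" "fdeg Q = p ^ n * fdeg P"
    using fdeg_chain[OF Q P] QP by blast
  have "n \<noteq> 0" using h QP by (intro notI) auto
  then have "p \<le> p ^ n" using prime_gt_1_nat[OF prime_p] by (intro self_le_power) auto
  then show ?thesis using h(4) by simp
qed

lemma fdeg_prime_chain:
  assumes "prime_chain R n h"
  shows "p ^ n * fdeg (h n) \<le> fdeg (h 0)"
  using assms
proof (induction n)
  case (Suc n)
  have c: "prime_chain R n h" using Suc.prems by (auto simp: prime_chain_def)
  have "p * fdeg (h (Suc n)) \<le> fdeg (h n)"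
    using Suc.prems by (intro fdeg_strict) (auto simp: prime_chain_def Spec_def)
  then have "p ^ n * (p * fdeg (h (Suc n))) \<le> p ^ n * fdeg (h n)" by (rule mult_le_mono2)
  also have "\<dots> \<le> fdeg (h 0)" using Suc.IH[OF c] .
  finally show ?case by (simp add: mult_ac)
qed simp

text \<open>Kunz: \<open>\<alpha>(P) + ht P\<close> does not depend on \<open>P\<close>.\<close>

lemma ht_fdeg:
  assumes P: "primeideal P R"
  obtains n where "ht R P = enat n" "fdeg {\<zero>} = p ^ n * fdeg P"
proof -
  have "{\<zero>} \<subseteq> P" using subm_zero[OF subm_ideal[OF prime_ideal[OF P], of 0]] by simp
  then obtain n h where h: "prime_chain R n h" "h 0 = {\<zero>}" "h n = P" "fdeg {\<zero>} = p ^ n * fdeg P"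
    using fdeg_chain[OF zeroprimeideal P] by blast
  \<comment> \<open>An arbitrary chain may skip primes and may start above zero, so along it the
    degree drops by a factor of at least p^m; comparison with the exact factor p^n along h gives the
    bound.\<close>
  have "m \<le> n" if g: "prime_chain R m g" "g m = P" for m g
  proof -
    have g0: "primeideal (g 0) R" using g by (auto simp: prime_chain_def Spec_def)
    have "fdeg (g 0) \<le> fdeg {\<zero>}"
    proof (cases "g 0 = {\<zero>}")
      case False
      then have "{\<zero>} \<subset> g 0" using subm_zero[OF subm_ideal[OF prime_ideal[OF g0], of 0]] by auto
      then have "p * fdeg (g 0) \<le> fdeg {\<zero>}" using fdeg_strict[OF zeroprimeideal g0] by simp
      moreover have "fdeg (g 0) \<le> p * fdeg (g 0)" using prime_gt_0_nat[OF prime_p] by simp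
      ultimately show ?thesis by linarith
    qed simp
    then have "p ^ m * fdeg P \<le> p ^ n * fdeg P"
      using fdeg_prime_chain[OF g(1), unfolded g(2)] h(4) by linarith
    then have "p ^ m \<le> p ^ n" using fdeg_pos[OF P] by simp
    then show ?thesis using prime_gt_1_nat[OF prime_p] power_le_imp_le_exp by blast
  qed
  then have "ht R P = enat n"
    unfolding ht_def
  proof (intro antisym Sup_least)
    show "enat n \<le> Sup {enat n | n Q. prime_chain R n Q \<and> Q n = P}"
      using h(1,3) by (intro Sup_upper) blast
    show "x \<le> enat n" if "x \<in> {enat n | n Q. prime_chain R n Q \<and> Q n = P}" for x
    proof -
      from that obtain m g where "x = enat m" "prime_chain R m g" "g m = P" by blast
      then show ?thesis using \<open>\<And>m g. prime_chain R m g \<Longrightarrow> g m = P \<Longrightarrow> m \<le> n\<close> by simp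
    qed
  qed
  then show ?thesis using that h(4) by blast
qed

end


section \<open>Uniform bounds on numbers of generators\<close>

context ffinite_domain
begin

text \<open>Multiplication by a carries generators modulo J : a to generators of (J + aR)/J;
  together with generators modulo J + aR they suffice.\<close>

lemma generators_extension:
  assumes J: "ideal J R" and a: "a \<in> carrier R"
    and 1: "generates e (adjoin 0 J a) G" and 2: "generates e (colon 0 J a) H"
    and H: "H \<subseteq> carrier R"
  shows "generates e J (G \<union> (\<lambda>h. h \<otimes> a) ` H)"
  unfolding generates_def
proof (intro allI impI)
  fix M assume M: "subm e M \<and> J \<subseteq> M \<and> G \<union> (\<lambda>h. h \<otimes> a) ` H \<subseteq> M"
  then have s: "subm e M" by simp
  have "subm e (colon 0 M a)" using subm_colon[of e 0 M a] s a by simp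
  moreover have "colon 0 J a \<subseteq> colon 0 M a" using M by (auto simp: colon_def)
  moreover have "H \<subseteq> colon 0 M a" using M H by (auto simp: colon_def subset_iff)
  ultimately have "colon 0 M a = carrier R" using generatesD[OF 2] by blast
  then have "y \<otimes> a \<in> M" if "y \<in> carrier R" for y using that by (force simp: colon_def set_eq_iff)
  then have "adjoin 0 J a \<subseteq> M" using s M by (intro adjoin_least[of e 0]) auto
  then show "M = carrier R" using generatesD[OF 1 s] M by blast
qed

text \<open>A recursion in the exponent: the p-th powers of generators at exponent e, multiplied by
  the \<open>u i\<close>, generate the span of the family u. Modulo this span R is killed by c, so
  generators modulo H + cR do the rest.\<close>

lemma generators_prime:
  assumes H: "primeideal H R" and u: "\<And>i. i < r \<Longrightarrow> u i \<in> carrier R" and c: "c \<in> carrier R"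
    and L: "\<And>x. x \<in> carrier R \<Longrightarrow> c \<otimes> x \<in> comb_span 1 u r (\<lambda>_. carrier R) H"
    and G: "generates e H G" "G \<subseteq> carrier R"
    and G': "generates (Suc e) (adjoin 0 H c) G'"
  shows "generates (Suc e) H (G' \<union> (\<lambda>(i, g). frob 1 g \<otimes> u i) ` ({..<r} \<times> G))"
  unfolding generates_def
proof (intro allI impI)
  fix M assume "subm (Suc e) M \<and> H \<subseteq> M \<and> G' \<union> (\<lambda>(i, g). frob 1 g \<otimes> u i) ` ({..<r} \<times> G) \<subseteq> M"
  then have s: "subm (Suc e) M" and M: "H \<subseteq> M" "G' \<subseteq> M"
    "\<And>i g. i < r \<Longrightarrow> g \<in> G \<Longrightarrow> frob 1 g \<otimes> u i \<in> M" by auto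
  have all: "frob 1 y \<otimes> u i \<in> M" if "i < r" "y \<in> carrier R" for i y
  proof -
    have "subm e (colon 1 M (u i))" using subm_colon[of e 1 M "u i"] s u that by simp
    moreover have "H \<subseteq> colon 1 M (u i)"
      using M(1) prime_frobenius_closed[OF H] u[OF that(1)] prime_subset[OF H] by (auto simp: colon_def)
    moreover have "G \<subseteq> colon 1 M (u i)" using M(3) that G by (auto simp: colon_def)
    ultimately have "colon 1 M (u i) = carrier R" using generatesD[OF G(1)] by blast
    then show ?thesis using that by (auto simp: colon_def)
  qed
  then have "comb_span 1 u r (\<lambda>_. carrier R) H \<subseteq> M"
    using M(1) s by (intro comb_span_least[of "Suc e"]) auto
  then have "y \<otimes> c \<in> M" if "y \<in> carrier R" for y using L[OF that] c that by (auto simp: m_comm)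
  then have "adjoin 0 H c \<subseteq> M" using s M by (intro adjoin_least[of "Suc e" 0]) auto
  then show "M = carrier R" using generatesD[OF G' s] M by blast
qed

text \<open>For a prime H of degree r, \<open>generators_prime\<close> gives the recursion g(e+1)
  \<le> r g(e) + C (r/p)^(e+1), because the primes strictly above H have degree at most r/p. The
  induction keeps B arbitrary since this case uses the hypothesis with r/p in place of B.\<close>

lemma generators_bound:
  assumes "ideal J R" and "\<And>H. primeideal H R \<Longrightarrow> J \<subseteq> H \<Longrightarrow> real (fdeg H) \<le> B"
  shows "\<exists>C. \<forall>e. \<exists>G. finite G \<and> G \<subseteq> carrier R \<and> generates e J G \<and> real (card G) \<le> C * B ^ e"
  using assms
proof (induction arbitrary: B rule: ideal_devissage)
  case carrier
  have "generates e (carrier R) {}" for e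
    unfolding generates_def using subm_carr by blast
  then show ?case by (intro exI[of _ 0] allI exI[of _ "{}"]) auto
next
  case (extension J a)
  have "real (fdeg H) \<le> B" if "primeideal H R" "adjoin 0 J a \<subseteq> H \<or> colon 0 J a \<subseteq> H" for H
    using extension(7)[OF that(1)] extension(3,4) that(2) by blast
  then obtain C C'
    where C: "\<forall>e. \<exists>G. finite G \<and> G \<subseteq> carrier R \<and> generates e (adjoin 0 J a) G \<and> real (card G) \<le> C * B ^ e"
    and C': "\<forall>e. \<exists>G. finite G \<and> G \<subseteq> carrier R \<and> generates e (colon 0 J a) G \<and> real (card G) \<le> C' * B ^ e"
    using extension(5)[of B] extension(6)[of B] by blast
  show ?case
  proof (intro exI[of _ "C + C'"] allI)
    fix e
    obtain G where G: "finite G" "G \<subseteq> carrier R" "generates e (adjoin 0 J a) G" "real (card G) \<le> C * B ^ e"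
      using C by blast
    obtain H where H: "finite H" "H \<subseteq> carrier R" "generates e (colon 0 J a) H" "real (card H) \<le> C' * B ^ e"
      using C' by blast
    let ?G = "G \<union> (\<lambda>h. h \<otimes> a) ` H"
    have "card ?G \<le> card G + card ((\<lambda>h. h \<otimes> a) ` H)" by (rule card_Un_le)
    also have "\<dots> \<le> card G + card H" using H by (intro add_left_mono card_image_le)
    finally have "real (card ?G) \<le> real (card G) + real (card H)" by simp
    also have "\<dots> \<le> (C + C') * B ^ e" using G(4) H(4) by (simp add: distrib_right)
    finally show "\<exists>G. finite G \<and> G \<subseteq> carrier R \<and> generates e J G \<and> real (card G) \<le> (C + C') * B ^ e"
      using generators_extension[OF extension(1,2) G(3) H(3,2)] G H extension(2)
      by (intro exI[of _ ?G]) auto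
  qed
next
  case (prime_ideal H)
  define r where "r = fdeg H"
  have r: "1 \<le> r" "real r \<le> B" using fdeg_pos[OF prime_ideal(1)] prime_ideal(3)[OF prime_ideal(1)] by (auto simp: r_def)
  have p: "2 \<le> p" using prime_ge_2_nat[OF prime_p] .
  obtain u c where u: "independent_mod 1 H H u r" and c: "c \<in> carrier R - H"
    "\<And>x. x \<in> carrier R \<Longrightarrow> frob 1 c \<otimes> x \<in> comb_span 1 u r (\<lambda>_. carrier R) H"
    unfolding r_def by (rule fdeg_basis[OF prime_ideal(1)]) blast
  note uc = independent_modD(1)[OF u]
  have c': "frob 1 c \<in> carrier R - H" using frob_notin_prime[OF prime_ideal(1) c(1)] .
  define J where "J = adjoin 0 H (frob 1 c)"
  have sH: "subm 0 H" using subm_ideal[OF primeideal.axioms(1)[OF prime_ideal(1)]] .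
  have HJ: "H \<subset> J" unfolding J_def using adjoin_upper[OF sH, of "frob 1 c", where k = 0] c' by blast
  have "ideal J R" unfolding J_def using ideal_adjoin[OF primeideal.axioms(1)[OF prime_ideal(1)]] c' by blast
  moreover have "real (fdeg K) \<le> real r / real p" if "primeideal K R" "J \<subseteq> K" for K
  proof -
    have "p * fdeg K \<le> r" unfolding r_def using HJ that by (intro fdeg_strict prime_ideal(1)) auto
    then have "real p * real (fdeg K) \<le> real r" by (metis of_nat_le_iff of_nat_mult)
    then show ?thesis using p by (simp add: field_simps)
  qed
  ultimately obtain C where C: "\<forall>e. \<exists>G. finite G \<and> G \<subseteq> carrier R \<and> generates e J G \<and> real (card G) \<le> C * (real r / real p) ^ e"
    using prime_ideal(2)[OF _ HJ, of "real r / real p"] by blast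
  have "0 \<le> C" using C[rule_format, of 0] by (auto intro: order_trans[OF of_nat_0_le_iff])
  \<comment> \<open>The factor 1 + C (1 - 1/p^e) absorbs the geometric series of errors: one step
    adds C/p^(e+1), and 1/p^e is at least 2/p^(e+1) because p is at least 2.\<close>
  have "\<exists>G. finite G \<and> G \<subseteq> carrier R \<and> generates e H G \<and> real (card G) \<le> (1 + C * (1 - 1 / real p ^ e)) * real r ^ e" for e
  proof (induction e)
    case 0
    have "generates 0 H {\<one>}" unfolding generates_def
    proof (intro allI impI)
      fix M assume M: "subm 0 M \<and> H \<subseteq> M \<and> {\<one>} \<subseteq> M"
      then have "y \<in> M" if "y \<in> carrier R" for y
        using subm_smult[of 0 M y \<one>] that by simp
      then show "M = carrier R" using M subm_carr by blast
    qed
    then show ?case by (intro exI[of _ "{\<one>}"]) auto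
  next
    case (Suc e)
    then obtain G where G: "finite G" "G \<subseteq> carrier R" "generates e H G"
      "real (card G) \<le> (1 + C * (1 - 1 / real p ^ e)) * real r ^ e" by blast
    obtain G' where G': "finite G'" "G' \<subseteq> carrier R" "generates (Suc e) J G'"
      "real (card G') \<le> C * (real r / real p) ^ Suc e" using C by blast
    let ?G = "G' \<union> (\<lambda>(i, g). frob 1 g \<otimes> u i) ` ({..<r} \<times> G)"
    have "card ?G \<le> card G' + card ((\<lambda>(i, g). frob 1 g \<otimes> u i) ` ({..<r} \<times> G))" by (rule card_Un_le)
    also have "\<dots> \<le> card G' + card ({..<r} \<times> G)" using G by (intro add_left_mono card_image_le) auto
    finally have "real (card ?G) \<le> real (card G') + real r * real (card G)"
      by (simp add: card_cartesian_product flip: of_nat_mult of_nat_add)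
    also have "\<dots> \<le> C * (real r / real p) ^ Suc e + real r * ((1 + C * (1 - 1 / real p ^ e)) * real r ^ e)"
      using G(4) G'(4) by (intro add_mono mult_left_mono) auto
    also have "\<dots> = (1 + C * (1 - 1 / real p ^ e + 1 / real p ^ Suc e)) * real r ^ Suc e"
      by (simp add: power_divide algebra_simps)
    also have "\<dots> \<le> (1 + C * (1 - 1 / real p ^ Suc e)) * real r ^ Suc e"
    proof (intro mult_right_mono add_left_mono mult_left_mono \<open>0 \<le> C\<close>)
      have "2 / real p ^ Suc e \<le> 1 / real p ^ e" using p by (simp add: field_simps)
      then show "1 - 1 / real p ^ e + 1 / real p ^ Suc e \<le> 1 - 1 / real p ^ Suc e" by simp
    qed simp
    finally have "real (card ?G) \<le> (1 + C * (1 - 1 / real p ^ Suc e)) * real r ^ Suc e" .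
    moreover have "generates (Suc e) H ?G"
      using generators_prime[OF prime_ideal(1) uc _ c(2) G(3,2)] c' G'(3) unfolding J_def by simp
    moreover have "?G \<subseteq> carrier R" using G G' uc by auto
    ultimately show ?case using G G' by (intro exI[of _ ?G]) auto
  qed
  moreover have "(1 + C * (1 - 1 / real p ^ e)) * real r ^ e \<le> (1 + C) * B ^ e" for e
  proof (intro mult_mono add_left_mono power_mono)
    have "1 - 1 / real p ^ e \<le> 1" by simp
    then show "C * (1 - 1 / real p ^ e) \<le> C" using mult_left_mono[OF _ \<open>0 \<le> C\<close>, of _ 1] by simp
  qed (use r \<open>0 \<le> C\<close> in auto)
  ultimately show ?case by (intro exI[of _ "1 + C"] allI) (meson order_trans)
qed

section \<open>Lengths relative to the generic rank\<close>

abbreviation rk :: nat where "rk \<equiv> fdeg {\<zero>}"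

lemma fdeg_le_rk: "primeideal H R \<Longrightarrow> fdeg H \<le> rk"
  by (rule ht_fdeg[of H]) (use prime_gt_0_nat[OF prime_p] in auto)

lemma rk_pos: "0 < rk"
  using fdeg_pos[OF zeroprimeideal] .

lemma len_finite:
  assumes P: "primeideal P R" and N: "subm e N"
    and PN: "\<And>r x. r \<in> P \<Longrightarrow> x \<in> carrier R \<Longrightarrow> frob e r \<otimes> x \<in> N"
  obtains k where "len P e N (carrier R) = enat k"
proof -
  obtain G where G: "finite G" "G \<subseteq> carrier R" "generates e {\<zero>} G"
    using generators_bound[OF zeroideal, of "real rk"] fdeg_le_rk by (metis of_nat_le_iff)
  have "len P e N (carrier R) \<le> card G"
    using len_le_generators[OF P G(1,2) N PN] generates_mono[OF G(3)] subm_zero[OF N] by simp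
  then show ?thesis using that by (cases "len P e N (carrier R)") auto
qed

text \<open>The error term. Its decay relative to \<open>rk\<^sup>e\<close>, uniformly in \<open>P\<close>, comes from \<open>fdeg H \<le> rk / p\<close> for
  the primes \<open>H\<close> containing \<open>c\<close>.\<close>

lemma len_bound:
  assumes c: "c \<in> carrier R" "c \<noteq> \<zero>"
  shows "\<exists>C\<ge>0. \<forall>P e N k. primeideal P R \<and> subm e N \<and>
    (\<forall>r\<in>P. \<forall>x\<in>carrier R. frob e r \<otimes> x \<in> N) \<and> (\<forall>x\<in>carrier R. c \<otimes> x \<in> N) \<and>
    len P e N (carrier R) = enat k \<longrightarrow> real k \<le> C * (real rk / real p) ^ e"
proof -
  let ?J = "adjoin 0 {\<zero>} c"
  have J: "ideal ?J R" using ideal_adjoin[OF zeroideal c(1)] .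
  have "real (fdeg H) \<le> real rk / real p" if H: "primeideal H R" "?J \<subseteq> H" for H
  proof -
    have "c \<in> H" using adjoin_upper(3)[OF subm_ideal[OF zeroideal] c(1)] H(2) by blast
    moreover have "\<zero> \<in> H" using subm_zero[OF subm_ideal[OF prime_ideal[OF H(1)]]] .
    ultimately have "p * fdeg H \<le> rk" using c by (intro fdeg_strict zeroprimeideal H(1)) auto
    then have "real p * real (fdeg H) \<le> real rk" by (metis of_nat_le_iff of_nat_mult)
    then show ?thesis using prime_gt_0_nat[OF prime_p] by (simp add: field_simps)
  qed
  then obtain C where C: "\<forall>e. \<exists>G. finite G \<and> G \<subseteq> carrier R \<and> generates e ?J G \<and> real (card G) \<le> C * (real rk / real p) ^ e"
    using generators_bound[OF J, of "real rk / real p"] by blast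
  have "0 \<le> C" using C[rule_format, of 0] by (auto intro: order_trans[OF of_nat_0_le_iff])
  moreover have "real k \<le> C * (real rk / real p) ^ e"
    if P: "primeideal P R" and N: "subm e N"
      and PN: "\<And>r x. r \<in> P \<Longrightarrow> x \<in> carrier R \<Longrightarrow> frob e r \<otimes> x \<in> N"
      and cN: "\<And>x. x \<in> carrier R \<Longrightarrow> c \<otimes> x \<in> N" and k: "len P e N (carrier R) = enat k"
    for P e N k
  proof -
    obtain G where G: "finite G" "G \<subseteq> carrier R" "generates e ?J G" "real (card G) \<le> C * (real rk / real p) ^ e"
      using C by blast
    have "?J \<subseteq> N" using N cN subm_zero[OF N] c(1) by (intro adjoin_least[of e 0]) (auto simp: m_comm)
    then have "len P e N (carrier R) \<le> card G"
      using len_le_generators[OF P G(1,2) N PN] generates_mono[OF G(3)] by simp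
    then show ?thesis using k G(4) by simp
  qed
  ultimately show ?thesis by blast
qed

text \<open>The upper bound that pairs with \<open>len_direct_sum\<close>: without independence,
  adjoining one more member of u still contributes a quotient of R/J, as J annihilates it modulo
  B.\<close>

lemma len_comb_span_le:
  assumes P: "primeideal P R" and J: "subm e J" and B: "subm (e + k) B"
  shows "(\<And>i. i < n \<Longrightarrow> u i \<in> carrier R) \<Longrightarrow>
    (\<And>i z. i < n \<Longrightarrow> z \<in> J \<Longrightarrow> frob k z \<otimes> u i \<in> B) \<Longrightarrow>
    len P (e + k) B (comb_span k u n (\<lambda>_. carrier R) B) \<le> of_nat n * len P e J (carrier R)"
proof (induction n)
  case 0
  have "comb_span k u 0 (\<lambda>_. carrier R) B = B"
    using subm_carr[OF B] by (force simp: comb_span_def)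
  then show ?case by (simp add: len_self)
next
  case (Suc n)
  let ?N = "\<lambda>n. comb_span k u n (\<lambda>_. carrier R) B"
  have sN: "subm (e + k) (?N m)" if "m \<le> Suc n" for m
    using subm_comb_span[of m u e "\<lambda>_. carrier R" k B] Suc.prems B that by auto
  have BN: "B \<subseteq> ?N m" if "m \<le> Suc n" for m
    using comb_span_upper(1)[of m u "\<lambda>_. carrier R" "e + k" B k] Suc.prems B that by auto
  have un: "u n \<in> carrier R" using Suc.prems by simp
  have eq: "adjoin k (?N n) (u n) = ?N (Suc n)"
  proof
    show "adjoin k (?N n) (u n) \<subseteq> ?N (Suc n)"
    proof (rule adjoin_least[OF sN])
      show "?N n \<subseteq> ?N (Suc n)"
        using comb_span_upper(2)[of "Suc n" u "\<lambda>_. carrier R" "e + k" B _ _ k] Suc.prems B BN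
        by (intro comb_span_least[OF sN[OF order_refl]]) auto
      show "frob k y \<otimes> u n \<in> ?N (Suc n)" if "y \<in> carrier R" for y
        using comb_span_upper(2)[of "Suc n" u "\<lambda>_. carrier R" "e + k" B n y k] Suc.prems B that by auto
    qed simp
    show "?N (Suc n) \<subseteq> adjoin k (?N n) (u n)"
    proof (rule comb_span_least[OF subm_adjoin[OF sN un]])
      show "B \<subseteq> adjoin k (?N n) (u n)" using BN[of n] adjoin_upper(1)[OF sN[of n] un] by auto
      fix i z assume iz: "i < Suc n" "z \<in> carrier R"
      show "frob k z \<otimes> u i \<in> adjoin k (?N n) (u n)"
      proof (cases "i = n")
        case True
        then show ?thesis using adjoin_upper(2)[OF sN[of n] un iz(2), of k] by simp
      next
        case False
        then have "frob k z \<otimes> u i \<in> ?N n"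
          using comb_span_upper(2)[of n u "\<lambda>_. carrier R" "e + k" B i z k] Suc.prems B iz by auto
        then show ?thesis using adjoin_upper(1)[OF sN[of n] un, of k] by auto
      qed
    qed simp
  qed
  have "J \<subseteq> colon k (?N n) (u n)"
    using Suc.prems(2)[of n] BN[of n] subm_carr[OF J] by (auto simp: colon_def)
  then have "len P e (colon k (?N n) (u n)) (carrier R) \<le> len P e J (carrier R)"
    by (intro len_mono) (auto simp: colon_def)
  then have 1: "len P (e + k) (?N n) (?N (Suc n)) \<le> len P e J (carrier R)"
    using len_adjoin[OF sN[of n] un P] eq by simp
  have "len P (e + k) B (?N (Suc n)) = len P (e + k) B (?N n) + len P (e + k) (?N n) (?N (Suc n))"
    using B sN BN eq adjoin_upper(1)[OF sN[of n] un, of k] by (intro len_add[OF P]) auto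
  also have "\<dots> \<le> of_nat n * len P e J (carrier R) + len P e J (carrier R)"
    using Suc 1 by (intro add_mono) auto
  finally show ?case by (simp add: distrib_right add.commute)
qed

text \<open>The degree of the fraction field over its p^e-th powers, by multiplicativity in a tower:
  a basis over the p-th powers multiplies the length by \<open>rk\<close>.\<close>

lemma len_zero_rk: "len {\<zero>} e {\<zero>} (carrier R) = of_nat (rk ^ e)"
proof (induction e)
  case 0
  then show ?case using len_prime_0[OF zeroprimeideal] by simp
next
  case (Suc e)
  have s0: "subm k {\<zero>}" for k using subm_ideal[OF zeroideal] .
  obtain u c where u: "independent_mod 1 {\<zero>} {\<zero>} u rk" and c: "c \<in> carrier R - {\<zero>}"
    "\<And>x. x \<in> carrier R \<Longrightarrow> frob 1 c \<otimes> x \<in> comb_span 1 u rk (\<lambda>_. carrier R) {\<zero>}"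
    by (rule fdeg_basis[OF zeroprimeideal]) blast
  note uc = independent_modD(1)[OF u]
  let ?L = "comb_span 1 u rk (\<lambda>_. carrier R) {\<zero>}"
  have L: "subm 1 ?L" "subm (e + 1) ?L"
    using subm_comb_span[of rk u 0 "\<lambda>_. carrier R" 1 "{\<zero>}"] subm_comb_span[of rk u e "\<lambda>_. carrier R" 1 "{\<zero>}"] uc s0
    by auto
  have "comb_span 1 u rk (\<lambda>_. {\<zero>}) {\<zero>} = {\<zero>}"
    using comb_span_least[OF s0, of "{\<zero>}" rk "\<lambda>_. {\<zero>}" 1 u]
      comb_span_upper(1)[of rk u "\<lambda>_. {\<zero>}" 1 "{\<zero>}" 1] s0 uc by auto
  then have 1: "len {\<zero>} (e + 1) {\<zero>} ?L = of_nat rk * of_nat (rk ^ e)"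
    using len_direct_sum[OF zeroprimeideal u s0 s0, of e] Suc by simp
  have "sat {\<zero>} (e + 1) ?L = carrier R"
  proof -
    have "x \<in> sat {\<zero>} (e + 1) ?L" if x: "x \<in> carrier R" for x
    proof (rule satI[OF x c(1)])
      \<comment> \<open>Saturation at exponent e + 1 needs c^(p^(e+1)) as multiplier. This is c^p
        times a p-th power, and c^p already sends x into the span.\<close>
      obtain y where y: "y \<in> carrier R" "frob e c = c \<otimes> y" using frob_factor c by blast
      have "frob (e + 1) c \<otimes> x = frob 1 y \<otimes> (frob 1 c \<otimes> x)"
        using y c(1) x frob_frob[of c 1 e] by (simp add: frob_mult m_ac)
      also have "\<dots> \<in> ?L" using subm_smult[OF L(1) y(1) c(2)[OF x]] .
      finally show "frob (e + 1) c \<otimes> x \<in> ?L" .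
    qed
    then show ?thesis by (auto simp: sat_def)
  qed
  then have "len {\<zero>} (e + 1) {\<zero>} (carrier R) = len {\<zero>} (e + 1) {\<zero>} ?L"
    using sat_eq[OF zeroprimeideal sat_subm_carrier] by (intro len_cong_sat) auto
  then show ?case using 1 by simp
qed

end


section \<open>Maps \<open>F\<^sup>q\<^sub>*R \<rightarrow> R\<close>\<close>

context char_p_ring
begin

lemma cartier_hom_closed: "\<phi> \<in> cartier_hom R (p ^ e) \<Longrightarrow> x \<in> carrier R \<Longrightarrow> \<phi> x \<in> carrier R"
  and cartier_hom_add: "\<phi> \<in> cartier_hom R (p ^ e) \<Longrightarrow> x \<in> carrier R \<Longrightarrow> y \<in> carrier R \<Longrightarrow> \<phi> (x \<oplus> y) = \<phi> x \<oplus> \<phi> y"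
  and cartier_hom_smult: "\<phi> \<in> cartier_hom R (p ^ e) \<Longrightarrow> r \<in> carrier R \<Longrightarrow> x \<in> carrier R \<Longrightarrow> \<phi> (frob e r \<otimes> x) = r \<otimes> \<phi> x"
  and cartier_hom_extensional: "\<phi> \<in> cartier_hom R (p ^ e) \<Longrightarrow> \<phi> \<in> extensional (carrier R)"
  by (auto simp: cartier_hom_def mod_hom_def frob_push_def self_module_def frob_def PiE_def)

lemma cartier_homI:
  assumes "\<phi> \<in> extensional (carrier R)" "\<And>x. x \<in> carrier R \<Longrightarrow> \<phi> x \<in> carrier R"
    "\<And>x y. x \<in> carrier R \<Longrightarrow> y \<in> carrier R \<Longrightarrow> \<phi> (x \<oplus> y) = \<phi> x \<oplus> \<phi> y"
    "\<And>r x. r \<in> carrier R \<Longrightarrow> x \<in> carrier R \<Longrightarrow> \<phi> (frob e r \<otimes> x) = r \<otimes> \<phi> x"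
  shows "\<phi> \<in> cartier_hom R (p ^ e)"
  using assms by (auto simp: cartier_hom_def mod_hom_def frob_push_def self_module_def frob_def PiE_def)

lemma cartier_hom_zero:
  assumes "\<phi> \<in> cartier_hom R (p ^ e)" shows "\<phi> \<zero> = \<zero>"
  using cartier_hom_smult[OF assms, of \<zero> \<zero>] cartier_hom_closed[OF assms] by simp

lemma cartier_hom_minus:
  assumes "\<phi> \<in> cartier_hom R (p ^ e)" "x \<in> carrier R" shows "\<phi> (\<ominus> x) = \<ominus> \<phi> x"
proof -
  have "\<phi> (\<ominus> x) \<oplus> \<phi> x = \<zero>"
    using cartier_hom_add[OF assms(1), of "\<ominus> x" x] assms cartier_hom_zero[OF assms(1)] by (simp add: l_neg)
  then show ?thesis using assms cartier_hom_closed[OF assms(1)] by (simp add: minus_equality)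
qed

lemma cartier_hom_lcomb:
  assumes \<phi>: "\<phi> \<in> cartier_hom R (p ^ d)"
  shows "(\<And>i. i < n \<Longrightarrow> u i \<in> carrier R) \<Longrightarrow> (\<And>i. i < n \<Longrightarrow> y i \<in> carrier R) \<Longrightarrow>
    \<phi> (lcomb d u y n) = lcomb 0 (\<lambda>i. \<phi> (u i)) y n"
proof (induction n)
  case (Suc n)
  then have "lcomb d u y n \<in> carrier R" by auto
  then show ?case using Suc by (simp add: cartier_hom_add[OF \<phi>] cartier_hom_smult[OF \<phi>])
qed (simp add: cartier_hom_zero[OF \<phi>])

lemma lcomb_only:
  assumes "\<And>i. i < n \<Longrightarrow> w i \<in> carrier R" "\<And>i. i < n \<Longrightarrow> y i \<in> carrier R"
    "\<And>i. i < n \<Longrightarrow> i \<noteq> j \<Longrightarrow> w i = \<zero>"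
  shows "lcomb 0 w y n = (if j < n then y j \<otimes> w j else \<zero>)"
  using assms
proof (induction n)
  case (Suc n)
  have IH: "lcomb 0 w y n = (if j < n then y j \<otimes> w j else \<zero>)" using Suc by auto
  show ?case
  proof (cases "j = n")
    case True
    then show ?thesis using IH Suc.prems(1,2)[of n] by simp
  next
    case False
    then have "w n = \<zero>" using Suc.prems(3)[of n] by auto
    then show ?thesis using IH False Suc.prems(1,2)[of j] Suc.prems(2)[of n] by auto
  qed
qed simp

end

section \<open>Splitting ideals\<close>

locale cartier_domain = ffinite_domain R p for R (structure) and p +
  fixes D :: "nat \<Rightarrow> ('a \<Rightarrow> 'a) set"
  assumes cartier: "cartier_subalgebra p R D"
begin

lemma ppowers_power [simp]: "p ^ e \<in> ppowers p"
  by (auto simp: ppowers_def)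

lemma D_hom: "\<phi> \<in> D (p ^ e) \<Longrightarrow> \<phi> \<in> cartier_hom R (p ^ e)"
  using cartier by (auto simp: cartier_subalgebra_def)

lemma D_closed [intro]: "\<phi> \<in> D (p ^ e) \<Longrightarrow> x \<in> carrier R \<Longrightarrow> \<phi> x \<in> carrier R"
  by (rule cartier_hom_closed[OF D_hom])

lemmas D_add = cartier_hom_add[OF D_hom]
  and D_smult = cartier_hom_smult[OF D_hom]
  and D_zero_apply = cartier_hom_zero[OF D_hom]
  and D_minus_apply = cartier_hom_minus[OF D_hom]

lemma zero_in_D: "(\<lambda>x\<in>carrier R. \<zero>) \<in> D (p ^ e)"
  using cartier by (simp add: cartier_subalgebra_def)

lemma add_in_D: "\<phi> \<in> D (p ^ e) \<Longrightarrow> \<psi> \<in> D (p ^ e) \<Longrightarrow> (\<lambda>x\<in>carrier R. \<phi> x \<oplus> \<psi> x) \<in> D (p ^ e)"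
  using cartier by (simp add: cartier_subalgebra_def)

lemma compose_in_D: "\<phi> \<in> D (p ^ e) \<Longrightarrow> \<psi> \<in> D (p ^ d) \<Longrightarrow> compose (carrier R) \<phi> \<psi> \<in> D (p ^ (e + d))"
  using cartier by (simp add: cartier_subalgebra_def power_add)

text \<open>Here the condition that D is all of Hom(R, R) in degree 1 enters. It makes D stable
  under multiplication on either side, which is why \<open>split_ideal\<close> is an ideal of
  R.\<close>

lemma mult_in_D:
  assumes "a \<in> carrier R" shows "(\<lambda>x\<in>carrier R. a \<otimes> x) \<in> D (p ^ 0)"
proof -
  have "D (p ^ 0) = cartier_hom R 1" using cartier by (simp add: cartier_subalgebra_def)
  moreover have "(\<lambda>x\<in>carrier R. a \<otimes> x) \<in> cartier_hom R 1"
    using assms by (auto simp: cartier_hom_def mod_hom_def frob_push_def self_module_def r_distr m_ac)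
  ultimately show ?thesis by simp
qed

lemma smult_in_D:
  assumes "\<phi> \<in> D (p ^ e)" "a \<in> carrier R" shows "(\<lambda>x\<in>carrier R. a \<otimes> \<phi> x) \<in> D (p ^ e)"
proof -
  have "compose (carrier R) (\<lambda>x\<in>carrier R. a \<otimes> x) \<phi> \<in> D (p ^ (0 + e))"
    using compose_in_D[OF mult_in_D assms(1)] assms(2) .
  moreover have "compose (carrier R) (\<lambda>x\<in>carrier R. a \<otimes> x) \<phi> = (\<lambda>x\<in>carrier R. a \<otimes> \<phi> x)"
    using assms(1) by (auto simp: compose_def fun_eq_iff)
  ultimately show ?thesis by simp
qed

lemma premult_in_D:
  assumes "\<phi> \<in> D (p ^ e)" "a \<in> carrier R" shows "(\<lambda>x\<in>carrier R. \<phi> (a \<otimes> x)) \<in> D (p ^ e)"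
proof -
  have "compose (carrier R) \<phi> (\<lambda>x\<in>carrier R. a \<otimes> x) \<in> D (p ^ (e + 0))"
    using compose_in_D[OF assms(1) mult_in_D[OF assms(2)]] .
  moreover have "compose (carrier R) \<phi> (\<lambda>x\<in>carrier R. a \<otimes> x) = (\<lambda>x\<in>carrier R. \<phi> (a \<otimes> x))"
    by (auto simp: compose_def fun_eq_iff)
  ultimately show ?thesis by simp
qed

lemma D_lcomb:
  assumes "\<phi> \<in> D (p ^ d)" "\<And>i. i < n \<Longrightarrow> u i \<in> carrier R" "\<And>i. i < n \<Longrightarrow> y i \<in> carrier R"
  shows "\<phi> (lcomb d u y n) = lcomb 0 (\<lambda>i. \<phi> (u i)) y n"
  using assms by (intro cartier_hom_lcomb D_hom)

lemma lcomb_in_D: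
  assumes "\<And>i. i < n \<Longrightarrow> \<phi> i \<in> D (p ^ e)" "\<And>i. i < n \<Longrightarrow> a i \<in> carrier R"
  shows "(\<lambda>x\<in>carrier R. lcomb 0 (\<lambda>i. \<phi> i x) a n) \<in> D (p ^ e)"
  using assms
proof (induction n)
  case 0
  then show ?case using zero_in_D by (simp only: lcomb.simps)
next
  case (Suc n)
  have "(\<lambda>x\<in>carrier R. (\<lambda>x\<in>carrier R. lcomb 0 (\<lambda>i. \<phi> i x) a n) x \<oplus> (\<lambda>x\<in>carrier R. a n \<otimes> \<phi> n x) x) \<in> D (p ^ e)"
    using Suc by (intro add_in_D smult_in_D) auto
  moreover have "(\<lambda>x\<in>carrier R. (\<lambda>x\<in>carrier R. lcomb 0 (\<lambda>i. \<phi> i x) a n) x \<oplus> (\<lambda>x\<in>carrier R. a n \<otimes> \<phi> n x) x)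
     = (\<lambda>x\<in>carrier R. lcomb 0 (\<lambda>i. \<phi> i x) a (Suc n))"
    using Suc.prems(2)[of n] by (auto simp: fun_eq_iff)
  ultimately show ?case by (simp only:)
qed

text \<open>The preimage in \<open>R\<close> of the ideal \<open>I\<^sub>q(P)\<close>, \<open>q = p\<^sup>e\<close>.\<close>

definition split_ideal :: "nat \<Rightarrow> 'a set \<Rightarrow> 'a set" where
  "split_ideal e P = {x \<in> carrier R. \<forall>\<phi>\<in>D (p ^ e). \<phi> x \<in> P}"

lemma ideal_split_ideal:
  assumes P: "primeideal P R" shows "ideal (split_ideal e P) R"
proof (rule ideal_of_subm[of e])
  note s = subm_ideal[OF prime_ideal[OF P], of 0]
  show "subm e (split_ideal e P)"
  proof (rule submI)
    show "\<zero> \<in> split_ideal e P" using subm_zero[OF s] by (auto simp: split_ideal_def dest!: D_zero_apply)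
    show "x \<oplus> y \<in> split_ideal e P" if "x \<in> split_ideal e P" "y \<in> split_ideal e P" for x y
      using that subm_add[OF s] by (auto simp: split_ideal_def D_add[of _ e])
    show "frob e r \<otimes> x \<in> split_ideal e P" if "r \<in> carrier R" "x \<in> split_ideal e P" for r x
      using that ideal.I_l_closed[OF prime_ideal[OF P]] by (auto simp: split_ideal_def D_smult[of _ e])
  qed (auto simp: split_ideal_def)
  show "r \<otimes> x \<in> split_ideal e P" if r: "r \<in> carrier R" and x: "x \<in> split_ideal e P" for r x
  proof -
    have "\<phi> (r \<otimes> x) \<in> P" if \<phi>: "\<phi> \<in> D (p ^ e)" for \<phi>
    proof -
      have "(\<lambda>x\<in>carrier R. \<phi> (r \<otimes> x)) x \<in> P" using premult_in_D[OF \<phi> r] x unfolding split_ideal_def by blast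
      then show ?thesis using x by (simp add: split_ideal_def)
    qed
    then show ?thesis using r x by (auto simp: split_ideal_def)
  qed
qed

lemma subm_split_ideal: "primeideal P R \<Longrightarrow> subm k (split_ideal e P)"
  using ideal_split_ideal subm_ideal by blast

lemma split_ideal_frobenius:
  "primeideal P R \<Longrightarrow> r \<in> P \<Longrightarrow> x \<in> carrier R \<Longrightarrow> frob e r \<otimes> x \<in> split_ideal e P"
  using prime_subset[of P]
  by (auto simp: split_ideal_def subset_iff D_smult[of _ e] intro!: ideal.I_r_closed[OF prime_ideal])

text \<open>\<open>the_enat\<close> loses nothing: multiples of p^e-th powers of elements of P lie
  in \<open>split_ideal e P\<close>, so the length is finite.
  \<open>splitting_number_eq_split_rank\<close> identifies it with the splitting number.\<close>

definition split_rank :: "nat \<Rightarrow> 'a set \<Rightarrow> nat" where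
  "split_rank e P = the_enat (len P e (split_ideal e P) (carrier R))"

lemma len_split_ideal:
  assumes "primeideal P R" shows "len P e (split_ideal e P) (carrier R) = enat (split_rank e P)"
proof -
  obtain k where "len P e (split_ideal e P) (carrier R) = enat k"
    by (rule len_finite[OF assms subm_split_ideal[OF assms] split_ideal_frobenius[OF assms]])
  then show ?thesis by (simp add: split_rank_def)
qed

text \<open>After inverting \<open>s\<close>, such a system splits a free summand of rank \<open>n\<close> off \<open>F\<^sup>q\<^sub>*R\<close>.\<close>

definition split_system :: "nat \<Rightarrow> nat \<Rightarrow> (nat \<Rightarrow> 'a \<Rightarrow> 'a) \<Rightarrow> (nat \<Rightarrow> 'a) \<Rightarrow> 'a \<Rightarrow> bool" where
  "split_system e n \<phi> x s \<longleftrightarrow> s \<in> carrier R \<and> (\<forall>i<n. \<phi> i \<in> D (p ^ e) \<and> x i \<in> carrier R) \<and>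
     (\<forall>i<n. \<forall>j<n. \<phi> i (x j) = (if i = j then s else \<zero>))"

text \<open>Applying \<open>\<phi> i\<close> to a relation isolates the product of
  \<open>y i\<close> with \<open>\<phi> i (x i)\<close>. The diagonal values may differ from one
  another, which suits systems obtained from the localization by clearing denominators.\<close>

lemma independent_of_dual:
  assumes P: "primeideal P R"
    and \<phi>: "\<And>i. i < n \<Longrightarrow> \<phi> i \<in> D (p ^ e)" and x: "\<And>i. i < n \<Longrightarrow> x i \<in> carrier R"
    and z: "\<And>i j. i < n \<Longrightarrow> j < n \<Longrightarrow> i \<noteq> j \<Longrightarrow> \<phi> i (x j) = \<zero>" and u: "\<And>i. i < n \<Longrightarrow> \<phi> i (x i) \<notin> P"
  shows "independent_mod e (split_ideal e P) P x n"
  unfolding independent_mod_def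
proof (intro conjI allI impI x)
  fix y i assume y: "\<forall>i<n. y i \<in> carrier R" and mem: "lcomb e x y n \<in> split_ideal e P" and i: "i < n"
  have c: "\<phi> i (x j) \<in> carrier R" if "j < n" for j using \<phi>[OF i] x[OF that] by auto
  have "\<phi> i (lcomb e x y n) = lcomb 0 (\<lambda>j. \<phi> i (x j)) y n" using \<phi> x y i by (intro D_lcomb) auto
  also have "\<dots> = y i \<otimes> \<phi> i (x i)" using i z[OF i] c y by (subst lcomb_only[of _ _ _ i]) auto
  finally have "y i \<otimes> \<phi> i (x i) \<in> P" using mem \<phi>[OF i] by (auto simp: split_ideal_def)
  then show "y i \<in> P" using primeideal.I_prime[OF P _ c[OF i]] y i u[OF i] by blast
qed

lemma dual_le_split_rank:
  assumes P: "primeideal P R"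
    and "\<And>i. i < n \<Longrightarrow> \<phi> i \<in> D (p ^ e)" and "\<And>i. i < n \<Longrightarrow> x i \<in> carrier R"
    and "\<And>i j. i < n \<Longrightarrow> j < n \<Longrightarrow> i \<noteq> j \<Longrightarrow> \<phi> i (x j) = \<zero>" and "\<And>i. i < n \<Longrightarrow> \<phi> i (x i) \<notin> P"
  shows "n \<le> split_rank e P"
  using len_independent(2)[OF P independent_of_dual[OF assms] subm_split_ideal[OF P] split_ideal_frobenius[OF P]] len_split_ideal[OF P, of e]
  by (simp add: of_nat_eq_enat)

lemma split_system_le_split_rank:
  assumes P: "primeideal P R" and sys: "split_system e n \<phi> x s" and s: "s \<notin> P"
  shows "n \<le> split_rank e P"
  using sys s unfolding split_system_def by (intro dual_le_split_rank[OF P, of n \<phi> e x]) auto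

text \<open>A Gram-Schmidt step without division: z is modified so that the old functionals vanish
  on it, a new functional is modified so that it vanishes on the old vectors, and all functionals
  are rescaled to a common diagonal value.\<close>

lemma split_system_extend:
  assumes P: "primeideal P R" and sys: "split_system e n \<phi> x s" and s: "s \<notin> P"
    and z: "z \<in> carrier R" "z \<notin> sat P e (comb_span e x n (\<lambda>_. carrier R) (split_ideal e P))"
  shows "\<exists>\<phi>' x' s'. split_system e (Suc n) \<phi>' x' s' \<and> s' \<notin> P"
proof -
  have sc: "s \<in> carrier R" and \<phi>: "\<And>i. i < n \<Longrightarrow> \<phi> i \<in> D (p ^ e)" and x: "\<And>i. i < n \<Longrightarrow> x i \<in> carrier R"
    and dual: "\<And>i j. i < n \<Longrightarrow> j < n \<Longrightarrow> \<phi> i (x j) = (if i = j then s else \<zero>)"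
    using sys by (auto simp: split_system_def)
  have \<phi>c: "\<phi> i w \<in> carrier R" if "i < n" "w \<in> carrier R" for i w using \<phi>[OF that(1)] that(2) by auto
  define l where "l = lcomb e x (\<lambda>i. \<phi> i z) n"
  have l: "l \<in> carrier R" unfolding l_def using x \<phi>c z by auto
  define y where "y = frob e s \<otimes> z \<ominus> l"
  have y: "y \<in> carrier R" using l z sc by (simp add: y_def)
  \<comment> \<open>If y were in the splitting ideal, a multiple of z by a power of s would lie in
    the span, and z in its saturation. So some map in D does not send y into P.\<close>
  have "y \<notin> split_ideal e P"
  proof
    assume "y \<in> split_ideal e P"
    then have "y \<oplus> l \<in> comb_span e x n (\<lambda>_. carrier R) (split_ideal e P)"
      unfolding l_def using \<phi>c z by (intro comb_spanI) auto
    moreover have "y \<oplus> l = frob e s \<otimes> z"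
    proof -
      have "frob e s \<otimes> z \<in> carrier R" using sc z by simp
      then show ?thesis unfolding y_def using l by algebra
    qed
    ultimately show False using satI[OF z(1), of s P e] sc s z(2) by simp
  qed
  then obtain \<psi> where \<psi>: "\<psi> \<in> D (p ^ e)" "\<psi> y \<notin> P" using y by (auto simp: split_ideal_def)
  have \<psi>c: "\<psi> w \<in> carrier R" if "w \<in> carrier R" for w using \<psi>(1) that by auto
  have \<phi>y: "\<phi> i y = \<zero>" if i: "i < n" for i
  proof -
    have "\<phi> i l = lcomb 0 (\<lambda>j. \<phi> i (x j)) (\<lambda>i. \<phi> i z) n"
      unfolding l_def using \<phi> x i \<phi>c z by (intro D_lcomb) auto
    also have "\<dots> = \<phi> i z \<otimes> s" using i dual \<phi>c x z sc by (subst lcomb_only[of _ _ _ i]) auto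
    finally have "\<phi> i l = \<phi> i z \<otimes> s" .
    then have "\<phi> i y = s \<otimes> \<phi> i z \<oplus> \<ominus> (\<phi> i z \<otimes> s)"
      unfolding y_def minus_eq using D_add[OF \<phi>[OF i]] D_minus_apply[OF \<phi>[OF i]] D_smult[OF \<phi>[OF i]] l z sc by simp
    then show ?thesis using \<phi>c[OF i z(1)] sc by (simp add: m_comm r_neg)
  qed
  \<comment> \<open>The correction by the old functionals makes \<open>\<psi>'\<close> vanish on the
    old x; on y, where all old functionals vanish, it still takes the value s \<psi>(y).\<close>
  define \<psi>' where "\<psi>' = (\<lambda>w\<in>carrier R. s \<otimes> \<psi> w \<oplus> lcomb 0 (\<lambda>i. \<phi> i w) (\<lambda>i. \<ominus> \<psi> (x i)) n)"
  have \<psi>': "\<psi>' \<in> D (p ^ e)"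
  proof -
    have "(\<lambda>w\<in>carrier R. (\<lambda>w\<in>carrier R. s \<otimes> \<psi> w) w \<oplus> (\<lambda>w\<in>carrier R. lcomb 0 (\<lambda>i. \<phi> i w) (\<lambda>i. \<ominus> \<psi> (x i)) n) w) \<in> D (p ^ e)"
      using \<psi> \<psi>c x \<phi> sc by (intro add_in_D smult_in_D lcomb_in_D) auto
    then show ?thesis unfolding \<psi>'_def by (simp cong: restrict_cong)
  qed
  have \<psi>'x: "\<psi>' (x j) = \<zero>" if j: "j < n" for j
  proof -
    have "lcomb 0 (\<lambda>i. \<phi> i (x j)) (\<lambda>i. \<ominus> \<psi> (x i)) n = \<ominus> \<psi> (x j) \<otimes> s"
      using j dual \<phi>c x \<psi>c sc by (subst lcomb_only[of _ _ _ j]) auto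
    then show ?thesis unfolding \<psi>'_def using x[OF j] \<psi>c[OF x[OF j]] sc by (simp add: m_comm r_minus r_neg)
  qed
  have \<psi>'y: "\<psi>' y = s \<otimes> \<psi> y"
  proof -
    have "lcomb 0 (\<lambda>i. \<phi> i y) (\<lambda>i. \<ominus> \<psi> (x i)) n = \<zero>"
      using \<phi>y x \<psi>c by (subst lcomb_only[of _ _ _ n]) auto
    then show ?thesis unfolding \<psi>'_def using y \<psi>c sc by simp
  qed
  define t where "t = s \<otimes> \<psi> y"
  have t: "t \<in> carrier R - P" unfolding t_def using mult_notin_prime[OF P] s sc \<psi>(2) \<psi>c[OF y] by blast
  \<comment> \<open>The old diagonal value is s and the new one is t, so the factors t and s bring
    both to the product t s.\<close>
  define \<phi>' where "\<phi>' = (\<lambda>i. if i < n then (\<lambda>w\<in>carrier R. t \<otimes> \<phi> i w) else (\<lambda>w\<in>carrier R. s \<otimes> \<psi>' w))"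
  have "split_system e (Suc n) \<phi>' (x(n := y)) (t \<otimes> s)"
    unfolding split_system_def
  proof (intro conjI allI impI)
    show "t \<otimes> s \<in> carrier R" using t sc by simp
    fix i assume i: "i < Suc n"
    show "\<phi>' i \<in> D (p ^ e)" unfolding \<phi>'_def using t sc \<phi> \<psi>' by (auto intro!: smult_in_D)
    show "(x(n := y)) i \<in> carrier R" using x y i by auto
    fix j assume j: "j < Suc n"
    have tc: "t \<in> carrier R" using t by simp
    show "\<phi>' i ((x(n := y)) j) = (if i = j then t \<otimes> s else \<zero>)"
    proof (cases "i = n")
      case True
      have "\<psi>' y = t" using \<psi>'y by (simp add: t_def)
      then show ?thesis using True j \<psi>'x x y sc tc by (cases "j = n") (auto simp: \<phi>'_def m_comm)
    next
      case False
      then show ?thesis using i j \<phi>y dual x y sc tc by (cases "j = n") (auto simp: \<phi>'_def)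
    qed
  qed
  moreover have "t \<otimes> s \<notin> P" using mult_notin_prime[OF P t, of s] s sc by blast
  ultimately show ?thesis by blast
qed

text \<open>A system of maximal size cannot be extended, so its vectors span everything after
  localization, and by \<open>len_independent\<close> its size is the length.\<close>

lemma split_system_exists:
  assumes P: "primeideal P R"
  obtains \<phi> x s where "split_system e (split_rank e P) \<phi> x s" "s \<notin> P"
proof -
  define S where "S = {n. \<exists>\<phi> x s. split_system e n \<phi> x s \<and> s \<notin> P}"
  have le: "n \<le> split_rank e P" if "n \<in> S" for n using split_system_le_split_rank[OF P] that by (auto simp: S_def)
  have fin: "finite S" using le by (intro finite_subset[of S "{..split_rank e P}"]) auto
  have "split_system e 0 (\<lambda>_ _. \<zero>) (\<lambda>_. \<zero>) \<one>" by (simp add: split_system_def)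
  then have "0 \<in> S" using one_notin_prime[OF P] by (auto simp: S_def)
  then have "Max S \<in> S" using fin by (intro Max_in) auto
  then obtain \<phi> x s where sys: "split_system e (Max S) \<phi> x s" "s \<notin> P" by (auto simp: S_def)
  let ?L = "comb_span e x (Max S) (\<lambda>_. carrier R) (split_ideal e P)"
  have xc: "x i \<in> carrier R" if "i < Max S" for i using sys that by (auto simp: split_system_def)
  have L: "subm e ?L" using subm_comb_span[of _ x 0 "\<lambda>_. carrier R" e] xc subm_split_ideal[OF P] by auto
  have ind: "independent_mod e (split_ideal e P) P x (Max S)"
    using sys by (intro independent_of_dual[OF P, of _ \<phi>]) (auto simp: split_system_def)
  have "sat P e ?L = carrier R"
  proof (rule ccontr)
    assume "sat P e ?L \<noteq> carrier R"
    then obtain z where "z \<in> carrier R" "z \<notin> sat P e ?L" by (auto simp: sat_def)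
    then have "Suc (Max S) \<in> S" using split_system_extend[OF P sys] by (auto simp: S_def)
    then have "Suc (Max S) \<le> Max S" using fin by (intro Max_ge)
    then show False by simp
  qed
  then have "len P e (split_ideal e P) (carrier R) = len P e (split_ideal e P) ?L"
    using sat_eq[OF P sat_subm_carrier] by (intro len_cong_sat) auto
  also have "\<dots> = of_nat (Max S)"
    using len_independent(1)[OF P ind subm_split_ideal[OF P] split_ideal_frobenius[OF P]] .
  finally have "split_rank e P = Max S" using len_split_ideal[OF P, of e] by (simp add: of_nat_eq_enat)
  then show ?thesis using that sys by simp
qed

lemma split_system_mono: "split_system e n \<phi> x s \<Longrightarrow> m \<le> n \<Longrightarrow> split_system e m \<phi> x s"
  by (auto simp: split_system_def)

lemma le_split_rank_iff:
  assumes "primeideal P R"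
  shows "m \<le> split_rank e P \<longleftrightarrow> (\<exists>\<phi> x s. split_system e m \<phi> x s \<and> s \<notin> P)"
proof
  assume le: "m \<le> split_rank e P"
  obtain \<phi> x s where sys: "split_system e (split_rank e P) \<phi> x s" "s \<notin> P" by (rule split_system_exists[OF assms])
  then show "\<exists>\<phi> x s. split_system e m \<phi> x s \<and> s \<notin> P" using split_system_mono[OF sys(1) le] by blast
qed (use split_system_le_split_rank[OF assms] in blast)

lemma openin_le_split_rank: "openin (zariski R) {P \<in> Spec R. m \<le> split_rank e P}"
proof -
  let ?A = "{s. \<exists>\<phi> x. split_system e m \<phi> x s}"
  have "?A \<subseteq> carrier R" by (auto simp: split_system_def)
  moreover have "{P \<in> Spec R. m \<le> split_rank e P} = {P \<in> Spec R. \<not> ?A \<subseteq> P}"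
    by (intro Collect_cong conj_cong refl) (auto simp: Spec_def le_split_rank_iff)
  ultimately show ?thesis unfolding openin_zariski[OF is_cring] by blast
qed

text \<open>A splitting system at P is also one at the zero ideal, where \<open>len_zero_rk\<close>
  bounds the length.\<close>

lemma split_rank_le_rk:
  assumes P: "primeideal P R" shows "split_rank e P \<le> rk ^ e"
proof -
  obtain \<phi> x s where sys: "split_system e (split_rank e P) \<phi> x s" "s \<notin> P" by (rule split_system_exists[OF P])
  have "s \<notin> {\<zero>}" using sys(2) subm_zero[OF subm_ideal[OF prime_ideal[OF P]]] by auto
  then have le: "split_rank e P \<le> split_rank e {\<zero>}" using split_system_le_split_rank[OF zeroprimeideal sys(1)] by simp
  have "enat (split_rank e {\<zero>}) \<le> len {\<zero>} e {\<zero>} (carrier R)"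
    unfolding len_split_ideal[OF zeroprimeideal, symmetric]
    using subm_zero[OF subm_split_ideal[OF zeroprimeideal]] subm_carr[OF subm_split_ideal[OF zeroprimeideal]]
    by (intro len_mono) auto
  then show ?thesis using le len_zero_rk[of e] by (simp add: of_nat_eq_enat)
qed

text \<open>The exponents of the semigroup of D at the zero prime, in the form that D contains a
  nonzero map of that degree; see \<open>splitting_semigroup_domain_eq\<close>.\<close>

definition exps :: "nat set" where
  "exps = {e. \<exists>\<phi>\<in>D (p ^ e). \<exists>x\<in>carrier R. \<phi> x \<noteq> \<zero>}"

text \<open>One nonzero value gives a full splitting at the generic point: the splitting ideal is an
  ideal of R, so along with x it contains x^q w, and \<phi>(x^q w) = x \<phi>(w) then forces x =
  0.\<close>

lemma split_rank_zero_exps: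
  assumes "e \<in> exps" shows "split_rank e {\<zero>} = rk ^ e"
proof -
  obtain \<phi> w where \<phi>: "\<phi> \<in> D (p ^ e)" "w \<in> carrier R" "\<phi> w \<noteq> \<zero>" using assms by (auto simp: exps_def)
  have "split_ideal e {\<zero>} \<subseteq> {\<zero>}"
  proof
    fix x assume x: "x \<in> split_ideal e {\<zero>}"
    then have xc: "x \<in> carrier R" by (simp add: split_ideal_def)
    obtain y where y: "y \<in> carrier R" "frob e x = x \<otimes> y" using frob_factor xc by blast
    have "x \<otimes> (y \<otimes> w) \<in> split_ideal e {\<zero>}"
      using ideal.I_r_closed[OF ideal_split_ideal[OF zeroprimeideal] x] y \<phi> by simp
    moreover have "x \<otimes> (y \<otimes> w) = frob e x \<otimes> w" using y xc \<phi> by (simp add: m_assoc)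
    ultimately have "\<phi> (frob e x \<otimes> w) = \<zero>" using \<phi>(1) by (auto simp: split_ideal_def)
    then have "x \<otimes> \<phi> w = \<zero>" using D_smult[OF \<phi>(1) xc \<phi>(2)] by simp
    then show "x \<in> {\<zero>}" using integral[of x "\<phi> w"] xc \<phi> by auto
  qed
  then have "split_ideal e {\<zero>} = {\<zero>}" using subm_zero[OF subm_split_ideal[OF zeroprimeideal]] by blast
  then show ?thesis using len_split_ideal[OF zeroprimeideal, of e] len_zero_rk[of e] by (simp add: of_nat_eq_enat)
qed

lemma split_rank_pos_iff:
  assumes P: "primeideal P R"
  shows "0 < split_rank e P \<longleftrightarrow> (\<exists>\<phi>\<in>D (p ^ e). \<exists>x\<in>carrier R. \<phi> x \<notin> P)"
proof -
  have "1 \<le> split_rank e P \<longleftrightarrow> (\<exists>\<phi>\<in>D (p ^ e). \<exists>x\<in>carrier R. \<phi> x \<notin> P)"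
    unfolding le_split_rank_iff[OF P]
  proof
    assume "\<exists>\<phi>\<in>D (p ^ e). \<exists>x\<in>carrier R. \<phi> x \<notin> P"
    then obtain \<phi> x where "\<phi> \<in> D (p ^ e)" "x \<in> carrier R" "\<phi> x \<notin> P" by blast
    then show "\<exists>\<phi> x s. split_system e 1 \<phi> x s \<and> s \<notin> P"
      by (intro exI[of _ "\<lambda>_. \<phi>"] exI[of _ "\<lambda>_. x"] exI[of _ "\<phi> x"]) (auto simp: split_system_def)
  qed (auto simp: split_system_def)
  then show ?thesis by auto
qed

lemma split_rank_pos_exps:
  assumes P: "primeideal P R" and "0 < split_rank e P" shows "e \<in> exps"
proof -
  obtain \<phi> x where "\<phi> \<in> D (p ^ e)" "x \<in> carrier R" "\<phi> x \<notin> P" using assms split_rank_pos_iff by blast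
  then show ?thesis using subm_zero[OF subm_ideal[OF prime_ideal[OF P]]] unfolding exps_def by force
qed

lemma split_rank_pos_add:
  assumes P: "primeideal P R" and "0 < split_rank d P" "0 < split_rank e P"
  shows "0 < split_rank (d + e) P"
proof -
  obtain \<phi> x where \<phi>: "\<phi> \<in> D (p ^ d)" "x \<in> carrier R" "\<phi> x \<notin> P" using assms split_rank_pos_iff by blast
  obtain \<psi> y where \<psi>: "\<psi> \<in> D (p ^ e)" "y \<in> carrier R" "\<psi> y \<notin> P" using assms split_rank_pos_iff by blast
  define t where "t = \<psi> y"
  have t: "t \<in> carrier R - P" using \<psi> by (auto simp: t_def)
  obtain t' where t': "t' \<in> carrier R" "frob d t = t \<otimes> t'" using frob_factor t by blast
  \<comment> \<open>With t = \<psi>(y), this argument is sent by \<psi> to t^(p^d) x. Applying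
    \<phi> gives t \<phi>(x), a product of elements outside P.\<close>
  let ?z = "frob e (x \<otimes> t') \<otimes> y"
  have "\<psi> ?z = (x \<otimes> t') \<otimes> t" unfolding t_def using \<phi> \<psi> t' by (intro D_smult) auto
  also have "\<dots> = frob d t \<otimes> x" unfolding t'(2) using \<phi>(2) t' t by (simp add: m_ac)
  finally have "\<phi> (\<psi> ?z) = t \<otimes> \<phi> x" using D_smult[OF \<phi>(1) _ \<phi>(2), of t] t by simp
  moreover have "t \<otimes> \<phi> x \<notin> P" using mult_notin_prime[OF P t, of "\<phi> x"] \<phi> by blast
  ultimately have "compose (carrier R) \<phi> \<psi> ?z \<notin> P" using \<phi> \<psi> t' by (simp add: compose_def)
  moreover have "?z \<in> carrier R" using \<phi> \<psi> t' by simp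
  ultimately show ?thesis
    unfolding split_rank_pos_iff[OF P] using compose_in_D[OF \<phi>(1) \<psi>(1)] by (intro bexI)
qed

lemma exps_add: "d \<in> exps \<Longrightarrow> e \<in> exps \<Longrightarrow> d + e \<in> exps"
  using split_rank_pos_add[OF zeroprimeideal] split_rank_pos_exps[OF zeroprimeideal] split_rank_zero_exps rk_pos by simp

lemma split_rank_0: "primeideal P R \<Longrightarrow> 0 < split_rank 0 P"
  using mult_in_D[of \<one>] one_notin_prime by (intro iffD2[OF split_rank_pos_iff]) (auto intro!: bexI[of _ \<one>] bexI)


section \<open>Comparison of splitting numbers\<close>

text \<open>If a combination of the v with coefficients y lies in the splitting ideal at exponent e
  + d, then applying \<theta> \<phi>_i with \<theta> in D puts y_i c into the splitting ideal I at
  exponent e. So the v are independent relative to I : c, and the loss against I is the length of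
  R/(I + cR), an error term of \<open>len_bound\<close>.\<close>

lemma split_rank_lower:
  assumes d: "d \<in> exps"
  obtains C where "0 \<le> C" "\<And>P e. primeideal P R \<Longrightarrow>
    real rk ^ d * real (split_rank e P) \<le> real (split_rank (e + d) P) + C * (real rk / real p) ^ e"
proof -
  obtain \<phi> v c where sys: "split_system d (rk ^ d) \<phi> v c" "c \<notin> {\<zero>}"
    using split_rank_zero_exps[OF d] le_split_rank_iff[OF zeroprimeideal, of "rk ^ d" d] by auto
  have c: "c \<in> carrier R" "c \<noteq> \<zero>" and \<phi>: "\<And>i. i < rk ^ d \<Longrightarrow> \<phi> i \<in> D (p ^ d)"
    and v: "\<And>i. i < rk ^ d \<Longrightarrow> v i \<in> carrier R"
    and dual: "\<And>i j. i < rk ^ d \<Longrightarrow> j < rk ^ d \<Longrightarrow> \<phi> i (v j) = (if i = j then c else \<zero>)"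
    using sys by (auto simp: split_system_def)
  obtain C where C: "0 \<le> C" "\<forall>P e N k. primeideal P R \<and> subm e N \<and>
    (\<forall>r\<in>P. \<forall>x\<in>carrier R. frob e r \<otimes> x \<in> N) \<and> (\<forall>x\<in>carrier R. c \<otimes> x \<in> N) \<and>
    len P e N (carrier R) = enat k \<longrightarrow> real k \<le> C * (real rk / real p) ^ e"
    using len_bound[OF c] by blast
  \<comment> \<open>The loss occurs once for each of the \<open>rk ^ d\<close> members of v, which
    explains the constant.\<close>
  have "real rk ^ d * real (split_rank e P) \<le> real (split_rank (e + d) P) + (real rk ^ d * C) * (real rk / real p) ^ e"
    if P: "primeideal P R" for P e
  proof -
    let ?J = "colon 0 (split_ideal e P) c" and ?B = "split_ideal (e + d) P" and ?M = "adjoin 0 (split_ideal e P) c"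
    have J: "subm e ?J" using ideal_colon[OF ideal_split_ideal[OF P] c(1)] by (rule subm_ideal)
    have M: "subm e ?M" using ideal_adjoin[OF ideal_split_ideal[OF P] c(1)] by (rule subm_ideal)
    have B: "subm (e + d) ?B" using subm_split_ideal[OF P] .
    have ind: "independent_mod d ?B ?J v (rk ^ d)"
      unfolding independent_mod_def
    proof (intro conjI allI impI v)
      fix y i assume y: "\<forall>i<rk ^ d. y i \<in> carrier R" and mem: "lcomb d v y (rk ^ d) \<in> ?B" and i: "i < rk ^ d"
      have lc: "lcomb d v y (rk ^ d) \<in> carrier R" using v y by auto
      have "\<phi> i (lcomb d v y (rk ^ d)) = lcomb 0 (\<lambda>j. \<phi> i (v j)) y (rk ^ d)"
        using \<phi> v y i by (intro D_lcomb) auto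
      also have "\<dots> = y i \<otimes> c" using i dual c y by (subst lcomb_only[of _ _ _ i]) auto
      finally have eq: "\<phi> i (lcomb d v y (rk ^ d)) = y i \<otimes> c" .
      have "\<theta> (y i \<otimes> c) \<in> P" if \<theta>: "\<theta> \<in> D (p ^ e)" for \<theta>
      proof -
        have "compose (carrier R) \<theta> (\<phi> i) (lcomb d v y (rk ^ d)) \<in> P"
          using compose_in_D[OF \<theta> \<phi>[OF i]] mem by (auto simp: split_ideal_def)
        then show ?thesis using lc eq by (simp add: compose_def)
      qed
      then show "y i \<in> ?J" using y i c by (auto simp: colon_def split_ideal_def)
    qed
    obtain j where j: "len P e ?J (carrier R) = enat j"
    proof (rule len_finite[OF P J])
      show "frob e r \<otimes> x \<in> ?J" if "r \<in> P" "x \<in> carrier R" for r x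
        using split_ideal_frobenius[OF P that(1), of "x \<otimes> c" e] that c prime_subset[OF P] by (auto simp: colon_def m_assoc)
    qed
    obtain k where k: "len P e ?M (carrier R) = enat k"
    proof (rule len_finite[OF P M])
      show "frob e r \<otimes> x \<in> ?M" if "r \<in> P" "x \<in> carrier R" for r x
        using split_ideal_frobenius[OF P that, of e] adjoin_upper(1)[OF subm_split_ideal[OF P] c(1)] by blast
    qed
    have PM: "frob e r \<otimes> x \<in> ?M" if "r \<in> P" "x \<in> carrier R" for r x
      using split_ideal_frobenius[OF P that, of e] adjoin_upper(1)[OF subm_split_ideal[OF P] c(1)] by blast
    have cM: "c \<otimes> x \<in> ?M" if "x \<in> carrier R" for x
      using adjoin_upper(2)[OF subm_split_ideal[OF P] c(1) that, where k = 0] that c by (simp add: m_comm)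
    have kC: "real k \<le> C * (real rk / real p) ^ e"
      using C(2)[rule_format, of P e ?M k] P M k PM cM by blast
    have "split_rank e P = j + k"
      using len_extension[OF P ideal_split_ideal[OF P] c(1), of e e] len_split_ideal[OF P, of e] j k by simp
    let ?L = "comb_span d v (rk ^ d) (\<lambda>_. carrier R) ?B" and ?L' = "comb_span d v (rk ^ d) (\<lambda>_. ?J) ?B"
    have "of_nat (rk ^ d) * len P e ?J (carrier R) = len P (e + d) ?L' ?L"
      using len_direct_sum[OF P ind J B] by simp
    also have "\<dots> \<le> len P (e + d) ?B (carrier R)"
    proof (rule len_mono)
      show "?B \<subseteq> ?L'" using v B subm_zero[OF J] by (intro comb_span_upper) auto
      show "?L' \<subseteq> ?L" using subm_carr[OF J] by (intro comb_span_mono) auto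
      show "?L \<subseteq> carrier R"
        using subm_comb_span[of "rk ^ d" v e "\<lambda>_. carrier R" d ?B] v B subm_carr by blast
    qed
    finally have "rk ^ d * j \<le> split_rank (e + d) P"
      using j len_split_ideal[OF P, of "e + d"] by (simp add: of_nat_eq_enat del: of_nat_power)
    then have "real (rk ^ d) * real j \<le> real (split_rank (e + d) P)" by (metis of_nat_le_iff of_nat_mult)
    moreover have "real rk ^ d * real k \<le> real rk ^ d * (C * (real rk / real p) ^ e)"
      using kC by (intro mult_left_mono) auto
    ultimately show ?thesis using \<open>split_rank e P = j + k\<close> by (simp add: algebra_simps)
  qed
  then show ?thesis using that[of "real rk ^ d * C"] C(1) by simp
qed

text \<open>For a basis u of F_*R up to torsion, the hypothesis makes each coordinate contribute a
  quotient of R modulo the splitting ideal at e, and R modulo the span is killed by c^p. The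
  constant takes up a factor rk/p, because \<open>len_bound\<close> is used at exponent e +
  1.\<close>

lemma split_rank_upper:
  obtains C where "0 \<le> C" "\<And>P e. primeideal P R \<Longrightarrow> (\<And>x. x \<in> split_ideal e P \<Longrightarrow> frob 1 x \<in> split_ideal (Suc e) P) \<Longrightarrow>
    real (split_rank (Suc e) P) \<le> real rk * real (split_rank e P) + C * (real rk / real p) ^ e"
proof -
  obtain u c where u: "independent_mod 1 {\<zero>} {\<zero>} u rk" and c: "c \<in> carrier R - {\<zero>}"
    "\<And>x. x \<in> carrier R \<Longrightarrow> frob 1 c \<otimes> x \<in> comb_span 1 u rk (\<lambda>_. carrier R) {\<zero>}"
    by (rule fdeg_basis[OF zeroprimeideal]) blast
  note uc = independent_modD(1)[OF u]
  have c': "frob 1 c \<in> carrier R" "frob 1 c \<noteq> \<zero>" using frob_notin_prime[OF zeroprimeideal c(1), of 1] by auto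
  obtain C where C: "0 \<le> C" "\<forall>P e N k. primeideal P R \<and> subm e N \<and>
    (\<forall>r\<in>P. \<forall>x\<in>carrier R. frob e r \<otimes> x \<in> N) \<and> (\<forall>x\<in>carrier R. frob 1 c \<otimes> x \<in> N) \<and>
    len P e N (carrier R) = enat k \<longrightarrow> real k \<le> C * (real rk / real p) ^ e"
    using len_bound[OF c'] by blast
  have "real (split_rank (Suc e) P) \<le> real rk * real (split_rank e P) + (C * (real rk / real p)) * (real rk / real p) ^ e"
    if P: "primeideal P R" and frob: "\<And>x. x \<in> split_ideal e P \<Longrightarrow> frob 1 x \<in> split_ideal (Suc e) P" for P e
  proof -
    let ?B = "split_ideal (Suc e) P"
    let ?L = "comb_span 1 u rk (\<lambda>_. carrier R) ?B"
    have B: "subm (e + 1) ?B" using subm_split_ideal[OF P] .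
    have L: "subm (Suc e) ?L" using subm_comb_span[of rk u e "\<lambda>_. carrier R" 1 ?B] uc B by auto
    have BL: "?B \<subseteq> ?L" using comb_span_upper(1)[of rk u "\<lambda>_. carrier R" "Suc e" ?B 1] uc B by auto
    have PL: "frob (Suc e) r \<otimes> x \<in> ?L" if "r \<in> P" "x \<in> carrier R" for r x
      using split_ideal_frobenius[OF P that, of "Suc e"] BL by blast
    obtain k where k: "len P (Suc e) ?L (carrier R) = enat k" by (rule len_finite[OF P L PL])
    have "frob 1 c \<otimes> x \<in> ?L" if "x \<in> carrier R" for x
      using c(2)[OF that] comb_span_mono[of rk "\<lambda>_. carrier R" "\<lambda>_. carrier R" "{\<zero>}" ?B 1 u]
        subm_zero[OF B] by blast
    then have kC: "real k \<le> C * (real rk / real p) ^ Suc e" using C(2)[rule_format, of P "Suc e" ?L k] P L PL k by blast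
    have "len P (e + 1) ?B ?L \<le> of_nat rk * len P e (split_ideal e P) (carrier R)"
      using uc frob ideal.I_r_closed[OF ideal_split_ideal[OF P]] by (intro len_comb_span_le[OF P subm_split_ideal[OF P] B]) auto
    then have 1: "len P (Suc e) ?B ?L \<le> enat (rk * split_rank e P)"
      using len_split_ideal[OF P, of e] by (simp add: of_nat_eq_enat)
    have "enat (split_rank (Suc e) P) = len P (Suc e) ?B ?L + enat k"
      unfolding len_split_ideal[OF P, symmetric] k[symmetric] using B L BL subm_carr[OF L] by (intro len_add[OF P]) auto
    also have "\<dots> \<le> enat (rk * split_rank e P) + enat k" using 1 by (rule add_right_mono)
    finally have "split_rank (Suc e) P \<le> rk * split_rank e P + k" by simp
    then have "real (split_rank (Suc e) P) \<le> real rk * real (split_rank e P) + real k" by (metis of_nat_le_iff of_nat_add of_nat_mult)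
    then show ?thesis using kC by (simp add: mult_ac)
  qed
  moreover have "0 \<le> C * (real rk / real p)" using C(1) by simp
  ultimately show ?thesis using that by blast
qed

end


section \<open>Localization of a domain\<close>

text \<open>\<open>localization\<close> defines its operations as unions over all representatives;
  once the members do not depend on these, the union is evaluated at any single pair.\<close>

lemma UNION_const_pairs:
  assumes "x \<in> A" "y \<in> B" "\<And>a s b t. (a, s) \<in> A \<Longrightarrow> (b, t) \<in> B \<Longrightarrow> f a s b t = c"
  shows "(\<Union>(a, s)\<in>A. \<Union>(b, t)\<in>B. f a s b t) = c"
proof -
  have "(\<Union>(a, s)\<in>A. \<Union>(b, t)\<in>B. f a s b t) = (\<Union>x\<in>A. \<Union>y\<in>B. c)"
    using assms(3) by (intro SUP_cong refl) (auto intro!: SUP_cong)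
  then show ?thesis using assms(1,2) by auto
qed

lemma prime_chain_subset:
  assumes "prime_chain T n Q" "i \<le> n" shows "Q i \<subseteq> Q n"
  using assms(2) assms(1)
proof (induction n rule: dec_induct)
  case (step n)
  then show ?case by (force simp: prime_chain_def)
qed simp

locale domain_at_prime = domain R for R (structure) +
  fixes P :: "'a set"
  assumes prime: "primeideal P R"
begin

abbreviation S where "S \<equiv> localization R P"
abbreviation "lf \<equiv> loc_frac R P"

lemma denom_carrier: "s \<in> carrier R - P \<Longrightarrow> s \<in> carrier R"
  by simp

lemma denom_nonzero: "s \<in> carrier R - P \<Longrightarrow> s \<noteq> \<zero>"
  using prime by (auto simp: additive_subgroup.zero_closed ideal.axioms(1) primeideal.axioms(1))

lemmas denom_one = one_notin_prime[OF prime]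
  and denom_mult = mult_notin_prime[OF prime]

text \<open>Over a domain the auxiliary multiplier in \<open>loc_frac\<close> cancels, because
  elements outside P are nonzero.\<close>

lemma mem_loc_frac:
  assumes "a \<in> carrier R" "s \<in> carrier R - P"
  shows "(b, t) \<in> lf a s \<longleftrightarrow> b \<in> carrier R \<and> t \<in> carrier R - P \<and> a \<otimes> t = b \<otimes> s"
proof -
  have "(\<exists>u\<in>carrier R - P. u \<otimes> (a \<otimes> t \<ominus> b \<otimes> s) = \<zero>) \<longleftrightarrow> a \<otimes> t = b \<otimes> s"
    if bt: "b \<in> carrier R" "t \<in> carrier R - P"
  proof
    assume "\<exists>u\<in>carrier R - P. u \<otimes> (a \<otimes> t \<ominus> b \<otimes> s) = \<zero>"
    then obtain u where u: "u \<in> carrier R - P" "u \<otimes> (a \<otimes> t \<ominus> b \<otimes> s) = \<zero>" by blast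
    have "a \<otimes> t \<ominus> b \<otimes> s = \<zero>"
      using integral[OF u(2)] denom_nonzero[OF u(1)] u assms bt by simp
    then show "a \<otimes> t = b \<otimes> s" using assms bt by simp
  next
    assume "a \<otimes> t = b \<otimes> s"
    then have "\<one> \<otimes> (a \<otimes> t \<ominus> b \<otimes> s) = \<zero>" using assms bt by simp
    then show "\<exists>u\<in>carrier R - P. u \<otimes> (a \<otimes> t \<ominus> b \<otimes> s) = \<zero>" using denom_one by blast
  qed
  then show ?thesis by (auto simp: loc_frac_def)
qed

lemma loc_frac_refl: "a \<in> carrier R \<Longrightarrow> s \<in> carrier R - P \<Longrightarrow> (a, s) \<in> lf a s"
  by (simp add: mem_loc_frac)

lemma loc_frac_eq_iff:
  assumes a: "a \<in> carrier R" "s \<in> carrier R - P" and b: "b \<in> carrier R" "t \<in> carrier R - P"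
  shows "lf a s = lf b t \<longleftrightarrow> a \<otimes> t = b \<otimes> s"
proof
  assume "lf a s = lf b t"
  then have "(b, t) \<in> lf a s" using loc_frac_refl[OF b] by simp
  then show "a \<otimes> t = b \<otimes> s" using a by (simp add: mem_loc_frac)
next
  assume eq: "a \<otimes> t = b \<otimes> s"
  have "a \<otimes> w = c \<otimes> s \<longleftrightarrow> b \<otimes> w = c \<otimes> t" if c: "c \<in> carrier R" "w \<in> carrier R - P" for c w
  proof -
    have "a \<otimes> w = c \<otimes> s \<longleftrightarrow> t \<otimes> (a \<otimes> w) = t \<otimes> (c \<otimes> s)"
      using m_lcancel[OF denom_nonzero[OF b(2)]] a b c by simp
    also have "t \<otimes> (a \<otimes> w) = s \<otimes> (b \<otimes> w)"
    proof -
      have "t \<otimes> (a \<otimes> w) = (a \<otimes> t) \<otimes> w" using a b c by (simp add: m_ac)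
      also have "\<dots> = s \<otimes> (b \<otimes> w)" unfolding eq using a b c by (simp add: m_ac)
      finally show ?thesis .
    qed
    also have "t \<otimes> (c \<otimes> s) = s \<otimes> (c \<otimes> t)" using a b c by (simp add: m_ac)
    also have "s \<otimes> (b \<otimes> w) = s \<otimes> (c \<otimes> t) \<longleftrightarrow> b \<otimes> w = c \<otimes> t"
      using m_lcancel[OF denom_nonzero[OF a(2)]] a b c by simp
    finally show ?thesis .
  qed
  then show "lf a s = lf b t" using a b by (auto simp: mem_loc_frac)
qed

lemma carrier_loc: "carrier S = {lf a s | a s. a \<in> carrier R \<and> s \<in> carrier R - P}"
  by (simp add: localization_def)

lemma loc_frac_closed [intro]: "a \<in> carrier R \<Longrightarrow> s \<in> carrier R - P \<Longrightarrow> lf a s \<in> carrier S"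
  by (auto simp: carrier_loc)

lemma carrier_locE:
  assumes "z \<in> carrier S"
  obtains a s where "a \<in> carrier R" "s \<in> carrier R - P" "z = lf a s"
  using assms by (auto simp: carrier_loc)

lemma loc_one: "\<one>\<^bsub>S\<^esub> = lf \<one> \<one>" and loc_zero: "\<zero>\<^bsub>S\<^esub> = lf \<zero> \<one>"
  by (simp_all add: localization_def)

lemma loc_mult:
  assumes a: "a \<in> carrier R" "s \<in> carrier R - P" and b: "b \<in> carrier R" "t \<in> carrier R - P"
  shows "lf a s \<otimes>\<^bsub>S\<^esub> lf b t = lf (a \<otimes> b) (s \<otimes> t)"
proof -
  have "(\<Union>(a, s)\<in>lf a s. \<Union>(b, t)\<in>lf b t. lf (a \<otimes> b) (s \<otimes> t)) = lf (a \<otimes> b) (s \<otimes> t)"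
  proof (rule UNION_const_pairs[OF loc_frac_refl[OF a] loc_frac_refl[OF b]])
    fix a' s' b' t' assume "(a', s') \<in> lf a s" "(b', t') \<in> lf b t"
    then have *: "a' \<in> carrier R" "s' \<in> carrier R - P" "a \<otimes> s' = a' \<otimes> s"
      "b' \<in> carrier R" "t' \<in> carrier R - P" "b \<otimes> t' = b' \<otimes> t"
      using a b by (auto simp: mem_loc_frac)
    have car: "a \<in> carrier R" "b \<in> carrier R" "s \<in> carrier R" "t \<in> carrier R"
      "a' \<in> carrier R" "b' \<in> carrier R" "s' \<in> carrier R" "t' \<in> carrier R" using * a b by auto
    have "(a \<otimes> b) \<otimes> (s' \<otimes> t') = (a \<otimes> s') \<otimes> (b \<otimes> t')" using car by algebra
    also have "\<dots> = (a' \<otimes> b') \<otimes> (s \<otimes> t)" unfolding *(3,6) using car by algebra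
    finally show "lf (a' \<otimes> b') (s' \<otimes> t') = lf (a \<otimes> b) (s \<otimes> t)"
      using * a b denom_mult[OF a(2) b(2)] denom_mult[OF *(2,5)] by (subst loc_frac_eq_iff) auto
  qed
  then show ?thesis by (simp add: localization_def)
qed

lemma loc_add:
  assumes a: "a \<in> carrier R" "s \<in> carrier R - P" and b: "b \<in> carrier R" "t \<in> carrier R - P"
  shows "lf a s \<oplus>\<^bsub>S\<^esub> lf b t = lf (a \<otimes> t \<oplus> b \<otimes> s) (s \<otimes> t)"
proof -
  have "(\<Union>(a, s)\<in>lf a s. \<Union>(b, t)\<in>lf b t. lf (a \<otimes> t \<oplus> b \<otimes> s) (s \<otimes> t)) = lf (a \<otimes> t \<oplus> b \<otimes> s) (s \<otimes> t)"
  proof (rule UNION_const_pairs[OF loc_frac_refl[OF a] loc_frac_refl[OF b]])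
    fix a' s' b' t' assume "(a', s') \<in> lf a s" "(b', t') \<in> lf b t"
    then have *: "a' \<in> carrier R" "s' \<in> carrier R - P" "a \<otimes> s' = a' \<otimes> s"
      "b' \<in> carrier R" "t' \<in> carrier R - P" "b \<otimes> t' = b' \<otimes> t"
      using a b by (auto simp: mem_loc_frac)
    have car: "a \<in> carrier R" "b \<in> carrier R" "s \<in> carrier R" "t \<in> carrier R"
      "a' \<in> carrier R" "b' \<in> carrier R" "s' \<in> carrier R" "t' \<in> carrier R" using * a b by auto
    have "(a \<otimes> t \<oplus> b \<otimes> s) \<otimes> (s' \<otimes> t') = (a \<otimes> s') \<otimes> (t \<otimes> t') \<oplus> (b \<otimes> t') \<otimes> (s \<otimes> s')"
      using car by algebra
    also have "\<dots> = (a' \<otimes> t' \<oplus> b' \<otimes> s') \<otimes> (s \<otimes> t)" unfolding *(3,6) using car by algebra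
    finally show "lf (a' \<otimes> t' \<oplus> b' \<otimes> s') (s' \<otimes> t') = lf (a \<otimes> t \<oplus> b \<otimes> s) (s \<otimes> t)"
      using * a b denom_mult[OF a(2) b(2)] denom_mult[OF *(2,5)] by (subst loc_frac_eq_iff) auto
  qed
  then show ?thesis by (simp add: localization_def)
qed

lemma cring_localization: "cring S"
proof (rule cringI)
  note d = denom_mult
  show "abelian_group S"
  proof (rule abelian_groupI)
    show "\<zero>\<^bsub>S\<^esub> \<in> carrier S" using denom_one by (auto simp: loc_zero)
    fix x assume "x \<in> carrier S"
    then obtain a s where x: "a \<in> carrier R" "s \<in> carrier R - P" "x = lf a s" by (rule carrier_locE)
    show "\<zero>\<^bsub>S\<^esub> \<oplus>\<^bsub>S\<^esub> x = x"
      unfolding loc_zero x(3) using x denom_one d[OF denom_one x(2)]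
      by (subst loc_add) (auto simp: loc_frac_eq_iff)
    have "lf (\<ominus> a) s \<oplus>\<^bsub>S\<^esub> x = \<zero>\<^bsub>S\<^esub>"
      unfolding loc_zero x(3) using x denom_one d[OF x(2) x(2)]
      by (subst loc_add) (auto simp: loc_frac_eq_iff l_minus l_neg)
    then show "\<exists>y\<in>carrier S. y \<oplus>\<^bsub>S\<^esub> x = \<zero>\<^bsub>S\<^esub>" using x by blast
    fix y assume "y \<in> carrier S"
    then obtain b t where y: "b \<in> carrier R" "t \<in> carrier R - P" "y = lf b t" by (rule carrier_locE)
    note st = d[OF x(2) y(2)]
    show "x \<oplus>\<^bsub>S\<^esub> y \<in> carrier S" unfolding x(3) y(3) using x y st by (subst loc_add) auto
    show "x \<oplus>\<^bsub>S\<^esub> y = y \<oplus>\<^bsub>S\<^esub> x"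
      unfolding x(3) y(3) using x y by (simp add: loc_add a_comm m_comm)
    fix z assume "z \<in> carrier S"
    then obtain c w where z: "c \<in> carrier R" "w \<in> carrier R - P" "z = lf c w" by (rule carrier_locE)
    have "(a \<otimes> t \<oplus> b \<otimes> s) \<otimes> w \<oplus> c \<otimes> (s \<otimes> t) = a \<otimes> (t \<otimes> w) \<oplus> (b \<otimes> w \<oplus> c \<otimes> t) \<otimes> s"
      using x y z by (simp add: l_distr a_assoc) (simp add: m_ac)
    then show "x \<oplus>\<^bsub>S\<^esub> y \<oplus>\<^bsub>S\<^esub> z = x \<oplus>\<^bsub>S\<^esub> (y \<oplus>\<^bsub>S\<^esub> z)"
      unfolding x(3) y(3) z(3) using x y z st d[OF y(2) z(2)] by (simp add: loc_add m_assoc)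
  qed
  show "Group.comm_monoid S"
  proof (rule comm_monoidI)
    show "\<one>\<^bsub>S\<^esub> \<in> carrier S" using denom_one by (auto simp: loc_one)
    fix x assume "x \<in> carrier S"
    then obtain a s where x: "a \<in> carrier R" "s \<in> carrier R - P" "x = lf a s" by (rule carrier_locE)
    show "\<one>\<^bsub>S\<^esub> \<otimes>\<^bsub>S\<^esub> x = x"
      unfolding loc_one x(3) using x denom_one by (subst loc_mult) auto
    fix y assume "y \<in> carrier S"
    then obtain b t where y: "b \<in> carrier R" "t \<in> carrier R - P" "y = lf b t" by (rule carrier_locE)
    note st = d[OF x(2) y(2)]
    show "x \<otimes>\<^bsub>S\<^esub> y \<in> carrier S" unfolding x(3) y(3) using x y st by (subst loc_mult) auto
    show "x \<otimes>\<^bsub>S\<^esub> y = y \<otimes>\<^bsub>S\<^esub> x"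
      unfolding x(3) y(3) using x y by (simp add: loc_mult m_comm)
    fix z assume "z \<in> carrier S"
    then obtain c w where z: "c \<in> carrier R" "w \<in> carrier R - P" "z = lf c w" by (rule carrier_locE)
    show "x \<otimes>\<^bsub>S\<^esub> y \<otimes>\<^bsub>S\<^esub> z = x \<otimes>\<^bsub>S\<^esub> (y \<otimes>\<^bsub>S\<^esub> z)"
      unfolding x(3) y(3) z(3) using x y z st d[OF y(2) z(2)] by (simp add: loc_mult m_assoc)
  qed
  fix x y z assume "x \<in> carrier S" "y \<in> carrier S" "z \<in> carrier S"
  then obtain a s b t c w where x: "a \<in> carrier R" "s \<in> carrier R - P" "x = lf a s"
    and y: "b \<in> carrier R" "t \<in> carrier R - P" "y = lf b t"
    and z: "c \<in> carrier R" "w \<in> carrier R - P" "z = lf c w" by (metis carrier_locE)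
  have "((a \<otimes> t \<oplus> b \<otimes> s) \<otimes> c) \<otimes> ((s \<otimes> w) \<otimes> (t \<otimes> w))
      = ((a \<otimes> c) \<otimes> (t \<otimes> w) \<oplus> (b \<otimes> c) \<otimes> (s \<otimes> w)) \<otimes> ((s \<otimes> t) \<otimes> w)"
    using x y z by (simp add: l_distr r_distr m_ac)
  then show "(x \<oplus>\<^bsub>S\<^esub> y) \<otimes>\<^bsub>S\<^esub> z = x \<otimes>\<^bsub>S\<^esub> z \<oplus>\<^bsub>S\<^esub> y \<otimes>\<^bsub>S\<^esub> z"
    unfolding x(3) y(3) z(3)
    using x y z d[OF x(2) y(2)] d[OF x(2) z(2)] d[OF y(2) z(2)] d[OF d[OF x(2) y(2)] z(2)]
      d[OF d[OF x(2) z(2)] d[OF y(2) z(2)]]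
    by (simp add: loc_add loc_mult loc_frac_eq_iff)
qed

end

text \<open>Primes, dimension and residue field of the localization are derived from these
  properties alone, so that classes of pairs do not appear in those arguments.\<close>

locale localization_map = R: domain R + S: cring S for R (structure) and S (structure) +
  fixes P :: "'a set" and j :: "'a \<Rightarrow> 'c"
  assumes prime: "primeideal P R"
    and j_hom: "j \<in> ring_hom R S"
    and j_inj: "inj_on j (carrier R)"
    and j_frac: "\<And>z. z \<in> carrier S \<Longrightarrow> \<exists>x\<in>carrier R. \<exists>s\<in>carrier R - P. j s \<otimes>\<^bsub>S\<^esub> z = j x"
    and j_unit: "\<And>s. s \<in> carrier R - P \<Longrightarrow> \<exists>w\<in>carrier S. j s \<otimes>\<^bsub>S\<^esub> w = \<one>\<^bsub>S\<^esub>"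

lemma (in domain_at_prime) localization_map: "localization_map R S P (\<lambda>x. lf x \<one>)"
proof -
  interpret S: cring S by (rule cring_localization)
  show ?thesis
  proof (intro localization_map.intro localization_map_axioms.intro domain_axioms S.cring_axioms)
    note d = denom_mult denom_one
    show "primeideal P R" by (rule prime)
    show "(\<lambda>x. lf x \<one>) \<in> ring_hom R S"
      using d by (intro ring_hom_memI) (auto simp: loc_mult loc_add loc_one)
    show "inj_on (\<lambda>x. lf x \<one>) (carrier R)"
      using d by (intro inj_onI) (simp add: loc_frac_eq_iff)
    show "\<exists>x\<in>carrier R. \<exists>s\<in>carrier R - P. lf s \<one> \<otimes>\<^bsub>S\<^esub> z = lf x \<one>" if z: "z \<in> carrier S" for z
    proof -
      obtain a s where a: "a \<in> carrier R" "s \<in> carrier R - P" "z = lf a s" using z by (rule carrier_locE)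
      have "lf s \<one> \<otimes>\<^bsub>S\<^esub> z = lf a \<one>"
        unfolding a(3) using a d by (simp add: loc_mult loc_frac_eq_iff m_comm)
      then show ?thesis using a by blast
    qed
    show "\<exists>w\<in>carrier S. lf s \<one> \<otimes>\<^bsub>S\<^esub> w = \<one>\<^bsub>S\<^esub>" if s: "s \<in> carrier R - P" for s
      using s d by (intro bexI[of _ "lf \<one> s"]) (auto simp: loc_mult loc_one loc_frac_eq_iff)
  qed
qed

lemma (in domain_at_prime) mem_extended_prime:
  assumes "x \<in> carrier R" "s \<in> carrier R - P"
  shows "lf x s \<in> extended_prime R P \<longleftrightarrow> x \<in> P"
proof
  assume "lf x s \<in> extended_prime R P"
  then obtain a t where a: "a \<in> P" "t \<in> carrier R - P" "lf x s = lf a t" by (auto simp: extended_prime_def)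
  have ac: "a \<in> carrier R" using a ideal.Icarr primeideal.axioms(1)[OF prime] by metis
  have "x \<otimes> t = a \<otimes> s" using a(3) loc_frac_eq_iff[OF assms ac a(2)] by simp
  also have "\<dots> \<in> P" using a assms ideal.I_r_closed primeideal.axioms(1)[OF prime] by (metis denom_carrier)
  finally show "x \<in> P" using primeideal.I_prime[OF prime, of x t] assms a by auto
qed (use assms in \<open>auto simp: extended_prime_def\<close>)


section \<open>Splitting numbers\<close>

context char_p_ring
begin

lemma finsum_frob_push: "finsum (frob_push R q) f A = finsum R f A"
  by (simp add: finsum_def finprod_def frob_push_def)

lemma submodule_frob_push: "submodule N R (frob_push R (p ^ e)) \<longleftrightarrow> subm e N"
proof
  assume "submodule N R (frob_push R (p ^ e))"
  then interpret submodule N R "frob_push R (p ^ e)" .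
  show "subm e N"
  proof (rule submI)
    show "N \<subseteq> carrier R" using subset by (simp add: frob_push_def)
    show "\<zero> \<in> N" using one_closed by (simp add: frob_push_def)
    show "x \<oplus> y \<in> N" if "x \<in> N" "y \<in> N" for x y using m_closed[OF that] by (simp add: frob_push_def)
    show "frob e r \<otimes> x \<in> N" if "r \<in> carrier R" "x \<in> N" for r x
      using smult_closed[OF that] by (simp add: frob_push_def frob_def)
  qed
next
  assume s: "subm e N"
  show "submodule N R (frob_push R (p ^ e))"
  proof (intro submodule.intro submodule_axioms.intro subgroup.intro)
    show "x \<otimes>\<^bsub>add_monoid (frob_push R (p ^ e))\<^esub> y \<in> N" if "x \<in> N" "y \<in> N" for x y
      using subm_add[OF s that] by (simp add: frob_push_def)
    show "inv\<^bsub>add_monoid (frob_push R (p ^ e))\<^esub> x \<in> N" if "x \<in> N" for x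
      using subm_neg[OF s that] by (simp add: frob_push_def a_inv_def m_inv_def)
    show "a \<odot>\<^bsub>frob_push R (p ^ e)\<^esub> x \<in> N" if "a \<in> carrier R" "x \<in> N" for a x
      using subm_smult[OF s that] by (simp add: frob_push_def frob_def)
  qed (use subm_carr[OF s] subm_zero[OF s] in \<open>auto simp: frob_push_def\<close>)
qed

lemma finsum_lcomb:
  "(\<And>i. i < n \<Longrightarrow> u i \<in> carrier R) \<Longrightarrow> (\<And>i. i < n \<Longrightarrow> y i \<in> carrier R) \<Longrightarrow>
    (\<And>i. i < n \<Longrightarrow> f i = frob k (y i) \<otimes> u i) \<Longrightarrow> finsum R f {..<n} = lcomb k u y n"
proof (induction n)
  case (Suc n)
  have "finsum R f {..<Suc n} = f n \<oplus> finsum R f {..<n}"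
    using Suc.prems unfolding lessThan_Suc by (intro finsum_insert) auto
  also have "finsum R f {..<n} = lcomb k u y n" using Suc by simp
  finally show ?case using Suc.prems by (simp add: a_comm)
qed simp

text \<open>For a summand with isomorphism \<theta>, the functional is \<theta> after the projection
  and the vector is the preimage of 1; the projections to the other summands annihilate this
  vector.\<close>

lemma dual_of_summands:
  assumes dec: "direct_sum_decomp R (frob_push R (p ^ e)) n N"
    and E: "E (p ^ e) \<subseteq> cartier_hom R (p ^ e)"
    and I: "\<And>i. i \<in> I \<Longrightarrow> i < n \<and> is_E_summand R E (p ^ e) n N i"
  shows "\<exists>\<psi> z. \<forall>i\<in>I. \<psi> i \<in> E (p ^ e) \<and> z i \<in> carrier R \<and> (\<forall>k\<in>I. \<psi> i (z k) = (if i = k then \<one> else \<zero>))"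
proof -
  let ?q = "p ^ e"
  let ?M = "frob_push R ?q"
  have sub: "subm e (N i)" if "i < n" for i
    using dec that by (simp add: direct_sum_decomp_def submodule_frob_push)
  have uniq: "\<exists>!f. f \<in> (\<Pi>\<^sub>E i\<in>{..<n}. N i) \<and> x = finsum R f {..<n}" if "x \<in> carrier R" for x
  proof -
    have "x \<in> carrier ?M" using that by (simp add: frob_push_def)
    then show ?thesis using dec unfolding direct_sum_decomp_def finsum_frob_push by blast
  qed
  have proj: "summand_proj ?M n N i z = (if i = k then z else \<zero>)" if i: "i < n" and k: "k < n" and z: "z \<in> N k" for i k z
  proof -
    let ?f = "\<lambda>l\<in>{..<n}. if l = k then z else \<zero>"
    have zc: "z \<in> carrier R" using subm_carr[OF sub[OF k] z] .
    have "?f \<in> (\<Pi>\<^sub>E i\<in>{..<n}. N i)" using z subm_zero[OF sub] by auto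
    moreover have "z = finsum R ?f {..<n}"
    proof -
      have "finsum R ?f {..<n} = finsum R (\<lambda>l. if k = l then (\<lambda>_. z) l else \<zero>) {..<n}"
        using zc by (intro finsum_cong') auto
      also have "\<dots> = z" using k zc by (subst finsum_singleton) auto
      finally show ?thesis by simp
    qed
    ultimately have "(THE f. f \<in> (\<Pi>\<^sub>E i\<in>{..<n}. N i) \<and> z = finsum R f {..<n}) = ?f"
      by (intro the1_equality[OF uniq[OF zc]] conjI)
    then show ?thesis unfolding summand_proj_def finsum_frob_push using i by simp
  qed
  have "\<forall>i\<in>I. \<exists>\<theta>. \<theta> \<in> mod_iso R (?M\<lparr>carrier := N i\<rparr>) (self_module R) \<and>
      (\<lambda>x\<in>carrier R. \<theta> (summand_proj ?M n N i x)) \<in> E ?q"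
    using I unfolding is_E_summand_def by blast
  then obtain \<theta> where \<theta>: "\<And>i. i \<in> I \<Longrightarrow> \<theta> i \<in> mod_iso R (?M\<lparr>carrier := N i\<rparr>) (self_module R)"
    and \<theta>E: "\<And>i. i \<in> I \<Longrightarrow> (\<lambda>x\<in>carrier R. \<theta> i (summand_proj ?M n N i x)) \<in> E ?q" by metis
  have "\<forall>i\<in>I. \<exists>z\<in>N i. \<theta> i z = \<one>"
  proof
    fix i assume "i \<in> I"
    then have "bij_betw (\<theta> i) (N i) (carrier R)" using \<theta> by (simp add: mod_iso_def self_module_def)
    then have "\<one> \<in> \<theta> i ` N i" by (simp add: bij_betw_def)
    then show "\<exists>z\<in>N i. \<theta> i z = \<one>" by force
  qed
  then obtain z where z: "\<And>i. i \<in> I \<Longrightarrow> z i \<in> N i" "\<And>i. i \<in> I \<Longrightarrow> \<theta> i (z i) = \<one>" by metis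
  have \<theta>0: "\<theta> i \<zero> = \<zero>" if i: "i \<in> I" for i
  proof -
    have h: "\<theta> i \<in> mod_hom R (?M\<lparr>carrier := N i\<rparr>) (self_module R)" using \<theta>[OF i] by (simp add: mod_iso_def)
    have n0: "\<zero> \<in> N i" using subm_zero[OF sub] I[OF i] by blast
    have c: "\<theta> i \<zero> \<in> carrier R" using h n0 by (auto simp: mod_hom_def self_module_def)
    have "\<forall>x\<in>N i. \<forall>y\<in>N i. \<theta> i (x \<oplus> y) = \<theta> i x \<oplus> \<theta> i y"
      using h unfolding mod_hom_def by (simp add: self_module_def frob_push_def)
    then have "\<theta> i (\<zero> \<oplus> \<zero>) = \<theta> i \<zero> \<oplus> \<theta> i \<zero>" using n0 by blast
    then show ?thesis using c by simp
  qed
  have zc: "z i \<in> carrier R" if "i \<in> I" for i using z(1)[OF that] sub I[OF that] subm_carr by blast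
  show ?thesis
  proof (intro exI[of _ "\<lambda>i. \<lambda>x\<in>carrier R. \<theta> i (summand_proj ?M n N i x)"] exI[of _ z] ballI conjI)
    fix i k assume i: "i \<in> I" and k: "k \<in> I"
    have "summand_proj ?M n N i (z k) = (if i = k then z k else \<zero>)" using proj z(1) I i k by blast
    then show "(\<lambda>x\<in>carrier R. \<theta> i (summand_proj ?M n N i x)) (z k) = (if i = k then \<one> else \<zero>)"
      using zc[OF k] z(2)[OF i] \<theta>0[OF i] by auto
  qed (use \<theta>E zc in auto)
qed

text \<open>The cyclic submodules of the x i, and the common kernel of the \<psi> i as a further
  summand with index m, decompose F^q_*R; the components of an element are read off from the values
  of the \<psi> i.\<close>

lemma summands_of_dual:
  assumes E: "E (p ^ e) \<subseteq> cartier_hom R (p ^ e)"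
    and \<psi>: "\<And>i. i < m \<Longrightarrow> \<psi> i \<in> E (p ^ e)" and x: "\<And>i. i < m \<Longrightarrow> x i \<in> carrier R"
    and dual: "\<And>i k. i < m \<Longrightarrow> k < m \<Longrightarrow> \<psi> i (x k) = (if i = k then \<one> else \<zero>)"
  shows "\<exists>n N. direct_sum_decomp R (frob_push R (p ^ e)) n N \<and> m \<le> card {i. i < n \<and> is_E_summand R E (p ^ e) n N i}"
proof -
  let ?q = "p ^ e"
  let ?M = "frob_push R ?q"
  have h: "\<psi> i \<in> cartier_hom R ?q" if "i < m" for i using E \<psi>[OF that] by blast
  have hc: "\<psi> i z \<in> carrier R" if "i < m" "z \<in> carrier R" for i z using cartier_hom_closed[OF h] that by blast
  define N where "N = (\<lambda>i. if i < m then (\<lambda>a. frob e a \<otimes> x i) ` carrier R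
    else {z \<in> carrier R. \<forall>i<m. \<psi> i z = \<zero>})"
  have \<psi>x: "\<psi> i (frob e a \<otimes> x k) = (if i = k then a else \<zero>)" if "i < m" "k < m" "a \<in> carrier R" for i k a
    using cartier_hom_smult[OF h[OF that(1)] that(3) x[OF that(2)]] dual[OF that(1,2)] that(3) by simp
  have sub: "subm e (N i)" for i
  proof (cases "i < m")
    case True
    have "subm e ((\<lambda>a. frob e a \<otimes> x i) ` carrier R)"
    proof (rule submI)
      show "\<zero> \<in> (\<lambda>a. frob e a \<otimes> x i) ` carrier R" using x[OF True] by (intro image_eqI[of _ _ \<zero>]) auto
      show "y \<oplus> z \<in> (\<lambda>a. frob e a \<otimes> x i) ` carrier R"
        if yz: "y \<in> (\<lambda>a. frob e a \<otimes> x i) ` carrier R" "z \<in> (\<lambda>a. frob e a \<otimes> x i) ` carrier R" for y z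
      proof -
        obtain a b where "a \<in> carrier R" "b \<in> carrier R" "y = frob e a \<otimes> x i" "z = frob e b \<otimes> x i" using yz by auto
        then show ?thesis using x[OF True] by (intro image_eqI[of _ _ "a \<oplus> b"]) (auto simp: frob_add l_distr)
      qed
      show "frob e r \<otimes> y \<in> (\<lambda>a. frob e a \<otimes> x i) ` carrier R"
        if r: "r \<in> carrier R" and y: "y \<in> (\<lambda>a. frob e a \<otimes> x i) ` carrier R" for r y
      proof -
        obtain a where "a \<in> carrier R" "y = frob e a \<otimes> x i" using y by auto
        then show ?thesis using x[OF True] r by (intro image_eqI[of _ _ "r \<otimes> a"]) (auto simp: frob_mult m_assoc)
      qed
    qed (use x[OF True] in auto)
    then show ?thesis using True by (simp add: N_def)
  next
    case False
    have "subm e {z \<in> carrier R. \<forall>i<m. \<psi> i z = \<zero>}"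
      using cartier_hom_zero[OF h] cartier_hom_add[OF h] cartier_hom_smult[OF h] by (intro submI) auto
    then show ?thesis using False by (simp add: N_def)
  qed
  define F where "F = (\<lambda>z. \<lambda>i\<in>{..<Suc m}. if i < m then frob e (\<psi> i z) \<otimes> x i else z \<ominus> lcomb e x (\<lambda>i. \<psi> i z) m)"
  have lc: "lcomb e x y m \<in> carrier R" if "\<And>i. i < m \<Longrightarrow> y i \<in> carrier R" for y using x that by auto
  have \<psi>l: "\<psi> i (lcomb e x y m) = y i" if "i < m" "\<And>i. i < m \<Longrightarrow> y i \<in> carrier R" for i y
  proof -
    have "\<psi> i (lcomb e x y m) = lcomb 0 (\<lambda>k. \<psi> i (x k)) y m" using x that h by (intro cartier_hom_lcomb) auto
    also have "\<dots> = y i" using that dual hc x by (subst lcomb_only[of _ _ _ i]) auto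
    finally show ?thesis .
  qed
  have sum: "finsum R f {..<Suc m} = f m \<oplus> lcomb e x y m"
    if "\<And>i. i < m \<Longrightarrow> y i \<in> carrier R" "\<And>i. i < m \<Longrightarrow> f i = frob e (y i) \<otimes> x i" "f m \<in> carrier R" for f y
  proof -
    have "finsum R f {..<Suc m} = f m \<oplus> finsum R f {..<m}"
      using that x unfolding lessThan_Suc by (intro finsum_insert) auto
    also have "finsum R f {..<m} = lcomb e x y m" using that x by (intro finsum_lcomb) auto
    finally show ?thesis .
  qed
  have F: "F z \<in> (\<Pi>\<^sub>E i\<in>{..<Suc m}. N i) \<and> z = finsum R (F z) {..<Suc m}" if z: "z \<in> carrier R" for z
  proof
    have l: "lcomb e x (\<lambda>i. \<psi> i z) m \<in> carrier R" by (intro lc hc z)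
    have "\<psi> i (z \<ominus> lcomb e x (\<lambda>i. \<psi> i z) m) = \<zero>" if i: "i < m" for i
    proof -
      have "\<psi> i (z \<ominus> lcomb e x (\<lambda>i. \<psi> i z) m) = \<psi> i z \<oplus> \<ominus> \<psi> i (lcomb e x (\<lambda>i. \<psi> i z) m)"
        unfolding minus_eq using cartier_hom_add[OF h[OF i]] cartier_hom_minus[OF h[OF i]] z l by simp
      then show ?thesis using \<psi>l[OF i, of "\<lambda>i. \<psi> i z"] hc z i by (simp add: r_neg)
    qed
    then have ker: "z \<ominus> lcomb e x (\<lambda>i. \<psi> i z) m \<in> {w \<in> carrier R. \<forall>i<m. \<psi> i w = \<zero>}" using z l by simp
    show "F z \<in> (\<Pi>\<^sub>E i\<in>{..<Suc m}. N i)"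
    proof (rule PiE_I)
      fix i assume i: "i \<in> {..<Suc m}"
      show "F z i \<in> N i"
      proof (cases "i < m")
        case True
        then show ?thesis using hc[OF True z] by (simp add: F_def N_def)
      next
        case False
        then show ?thesis using ker i by (simp add: F_def N_def)
      qed
    qed (simp add: F_def)
    have "finsum R (F z) {..<Suc m} = (z \<ominus> lcomb e x (\<lambda>i. \<psi> i z) m) \<oplus> lcomb e x (\<lambda>i. \<psi> i z) m"
      using hc z l by (subst sum[of "\<lambda>i. \<psi> i z"]) (auto simp: F_def)
    also have "\<dots> = z"
    proof -
      have "(z \<ominus> w) \<oplus> w = z" if "w \<in> carrier R" for w using z that by algebra
      then show ?thesis using l by blast
    qed
    finally show "z = finsum R (F z) {..<Suc m}" by simp
  qed
  have uniq: "f = F z" if f: "f \<in> (\<Pi>\<^sub>E i\<in>{..<Suc m}. N i)" and z: "z = finsum R f {..<Suc m}" for f z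
  proof -
    have "\<forall>i. \<exists>a. i < m \<longrightarrow> a \<in> carrier R \<and> f i = frob e a \<otimes> x i"
    proof
      fix i show "\<exists>a. i < m \<longrightarrow> a \<in> carrier R \<and> f i = frob e a \<otimes> x i"
      proof (cases "i < m")
        case True
        then have "f i \<in> N i" using PiE_mem[OF f, of i] by simp
        then show ?thesis using True by (auto simp: N_def)
      qed simp
    qed
    from choice[OF this] obtain a where "\<forall>i. i < m \<longrightarrow> a i \<in> carrier R \<and> f i = frob e (a i) \<otimes> x i" by blast
    then have a: "\<And>i. i < m \<Longrightarrow> a i \<in> carrier R" "\<And>i. i < m \<Longrightarrow> f i = frob e (a i) \<otimes> x i" by simp_all
    have "f m \<in> N m" using PiE_mem[OF f, of m] by simp
    then have fm: "f m \<in> carrier R" "\<And>i. i < m \<Longrightarrow> \<psi> i (f m) = \<zero>" by (auto simp: N_def)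
    have zeq: "z = f m \<oplus> lcomb e x a m" unfolding z using a fm by (intro sum)
    have l: "lcomb e x a m \<in> carrier R" by (intro lc a)
    have \<psi>z: "\<psi> i z = a i" if i: "i < m" for i
      unfolding zeq using cartier_hom_add[OF h[OF i] fm(1) l] fm(2)[OF i] \<psi>l[OF i, of a] a i by simp
    have eq: "lcomb e x (\<lambda>i. \<psi> i z) m = lcomb e x a m" using \<psi>z by (intro lcomb_cong) auto
    have "f m = z \<ominus> lcomb e x a m" unfolding zeq using fm(1) l by algebra
    then have "f i = F z i" if "i < Suc m" for i
      using that a \<psi>z eq by (auto simp: F_def less_Suc_eq)
    moreover have "z \<in> carrier R" unfolding zeq using fm(1) l by simp
    then have "F z \<in> (\<Pi>\<^sub>E i\<in>{..<Suc m}. N i)" using F by blast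
    ultimately show ?thesis by (intro PiE_ext[OF f]) auto
  qed
  have dec: "direct_sum_decomp R ?M (Suc m) N"
    unfolding direct_sum_decomp_def finsum_frob_push submodule_frob_push
  proof (intro conjI allI impI ballI sub)
    fix z assume "z \<in> carrier ?M"
    then have "z \<in> carrier R" by (simp add: frob_push_def)
    then show "\<exists>!f. f \<in> (\<Pi>\<^sub>E i\<in>{..<Suc m}. N i) \<and> z = finsum R f {..<Suc m}"
      using F uniq by (intro ex1I[of _ "F z"]) blast+
  qed
  have proj: "summand_proj ?M (Suc m) N i z = frob e (\<psi> i z) \<otimes> x i" if "i < m" "z \<in> carrier R" for i z
  proof -
    have "(THE f. f \<in> (\<Pi>\<^sub>E i\<in>{..<Suc m}. N i) \<and> z = finsum R f {..<Suc m}) = F z"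
      using F[OF that(2)] uniq by (intro the_equality) blast+
    then show ?thesis unfolding summand_proj_def finsum_frob_push using that(1) by (simp add: F_def)
  qed
  have "is_E_summand R E ?q (Suc m) N i" if i: "i < m" for i
    unfolding is_E_summand_def
  proof
    let ?\<theta> = "\<lambda>z\<in>N i. \<psi> i z"
    have Nc: "z \<in> carrier R" if "z \<in> N i" for z using subm_carr[OF sub that] .
    \<comment> \<open>The projection replaces z by \<psi>_i(z)^q x_i, and \<psi>_i takes the same
      value on both, so the composite is \<psi>_i itself and lies in E.\<close>
    have "(\<lambda>z\<in>carrier R. ?\<theta> (summand_proj ?M (Suc m) N i z)) = \<psi> i"
    proof
      fix z
      show "(\<lambda>z\<in>carrier R. ?\<theta> (summand_proj ?M (Suc m) N i z)) z = \<psi> i z"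
      proof (cases "z \<in> carrier R")
        case True
        have "frob e (\<psi> i z) \<otimes> x i \<in> N i" using i hc[OF i True] by (simp add: N_def)
        then show ?thesis using True proj[OF i True] \<psi>x[OF i i hc[OF i True]] by simp
      next
        case False
        then show ?thesis using cartier_hom_extensional[OF h[OF i]] by (simp add: extensional_def)
      qed
    qed
    then show "(\<lambda>z\<in>carrier R. ?\<theta> (summand_proj ?M (Suc m) N i z)) \<in> E ?q" using \<psi>[OF i] by simp
    have "bij_betw ?\<theta> (N i) (carrier R)"
    proof (rule bij_betwI[where g = "\<lambda>a. frob e a \<otimes> x i"])
      show "?\<theta> \<in> N i \<rightarrow> carrier R" using hc[OF i] Nc by auto
      show "(\<lambda>a. frob e a \<otimes> x i) \<in> carrier R \<rightarrow> N i" using i by (auto simp: N_def)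
      show "frob e (?\<theta> z) \<otimes> x i = z" if "z \<in> N i" for z
      proof -
        obtain a where "a \<in> carrier R" "z = frob e a \<otimes> x i" using \<open>z \<in> N i\<close> i by (auto simp: N_def)
        then show ?thesis using \<psi>x[OF i i] that by simp
      qed
      show "?\<theta> (frob e a \<otimes> x i) = a" if "a \<in> carrier R" for a
        using \<psi>x[OF i i that] i that by (simp add: N_def)
    qed
    moreover have "?\<theta> \<in> mod_hom R (?M\<lparr>carrier := N i\<rparr>) (self_module R)"
      unfolding mod_hom_def
      using hc[OF i] Nc subm_add[OF sub] subm_smult[OF sub] cartier_hom_add[OF h[OF i]] cartier_hom_smult[OF h[OF i]]
      by (auto simp: frob_push_def self_module_def frob_def[symmetric])
    ultimately show "?\<theta> \<in> mod_iso R (?M\<lparr>carrier := N i\<rparr>) (self_module R)"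
      by (simp add: mod_iso_def self_module_def)
  qed
  then have "{..<m} \<subseteq> {i. i < Suc m \<and> is_E_summand R E ?q (Suc m) N i}" by auto
  then have "card {..<m} \<le> card {i. i < Suc m \<and> is_E_summand R E ?q (Suc m) N i}" by (intro card_mono) auto
  then show ?thesis using dec by auto
qed

end


section \<open>Primes and residue field of a localization\<close>

context localization_map
begin

lemma hom: "ring_hom_ring R S j"
  using j_hom by (intro ring_hom_ringI2 R.ring_axioms S.ring_axioms)

lemma j_closed [simp, intro]: "x \<in> carrier R \<Longrightarrow> j x \<in> carrier S"
  and j_mult: "x \<in> carrier R \<Longrightarrow> y \<in> carrier R \<Longrightarrow> j (x \<otimes> y) = j x \<otimes>\<^bsub>S\<^esub> j y"
  and j_add: "x \<in> carrier R \<Longrightarrow> y \<in> carrier R \<Longrightarrow> j (x \<oplus> y) = j x \<oplus>\<^bsub>S\<^esub> j y"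
  and j_one [simp]: "j \<one> = \<one>\<^bsub>S\<^esub>"
  using ring_hom_memE[OF j_hom] by auto

lemma j_zero [simp]: "j \<zero> = \<zero>\<^bsub>S\<^esub>"
  using ring_hom_zero[OF j_hom R.ring_axioms S.ring_axioms] .

lemma j_eq_iff: "x \<in> carrier R \<Longrightarrow> y \<in> carrier R \<Longrightarrow> j x = j y \<longleftrightarrow> x = y"
  using j_inj by (auto dest: inj_onD)

lemmas P_one = R.one_notin_prime[OF prime]
  and P_mult = R.mult_notin_prime[OF prime]

lemma j_cancel:
  assumes s: "s \<in> carrier R - P" and w: "w \<in> carrier S" "z \<in> carrier S" and eq: "j s \<otimes>\<^bsub>S\<^esub> w = j s \<otimes>\<^bsub>S\<^esub> z"
  shows "w = z"
proof -
  obtain u where u: "u \<in> carrier S" "j s \<otimes>\<^bsub>S\<^esub> u = \<one>\<^bsub>S\<^esub>" using j_unit[OF s] by blast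
  have *: "v = u \<otimes>\<^bsub>S\<^esub> (j s \<otimes>\<^bsub>S\<^esub> v)" if v: "v \<in> carrier S" for v
  proof -
    have "u \<otimes>\<^bsub>S\<^esub> (j s \<otimes>\<^bsub>S\<^esub> v) = (j s \<otimes>\<^bsub>S\<^esub> u) \<otimes>\<^bsub>S\<^esub> v" using u(1) v s by (simp add: S.m_ac)
    then show ?thesis using u v by simp
  qed
  show ?thesis using *[OF w(1)] *[OF w(2)] eq by simp
qed

text \<open>The equation z = x/s with the denominator cleared. It is a relation, because z
  determines neither numerator nor denominator.\<close>

definition frac :: "'c \<Rightarrow> 'a \<Rightarrow> 'a \<Rightarrow> bool" where
  "frac z x s \<longleftrightarrow> z \<in> carrier S \<and> x \<in> carrier R \<and> s \<in> carrier R - P \<and> j s \<otimes>\<^bsub>S\<^esub> z = j x"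

lemma fracE:
  assumes "z \<in> carrier S" obtains x s where "frac z x s"
  using j_frac[OF assms] assms unfolding frac_def by blast

lemma frac_j: "x \<in> carrier R \<Longrightarrow> frac (j x) x \<one>"
  using P_one by (simp add: frac_def)

lemma frac_mult:
  assumes z: "frac z x s" and w: "frac w y t" shows "frac (z \<otimes>\<^bsub>S\<^esub> w) (x \<otimes> y) (s \<otimes> t)"
proof -
  have c: "z \<in> carrier S" "w \<in> carrier S" "x \<in> carrier R" "y \<in> carrier R" "s \<in> carrier R" "t \<in> carrier R"
    using assms by (auto simp: frac_def)
  have "j (s \<otimes> t) \<otimes>\<^bsub>S\<^esub> (z \<otimes>\<^bsub>S\<^esub> w) = (j s \<otimes>\<^bsub>S\<^esub> z) \<otimes>\<^bsub>S\<^esub> (j t \<otimes>\<^bsub>S\<^esub> w)"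
    using c by (simp add: j_mult S.m_ac)
  then show ?thesis using assms c P_mult by (simp add: frac_def j_mult)
qed

lemma frac_add:
  assumes z: "frac z x s" and w: "frac w y t" shows "frac (z \<oplus>\<^bsub>S\<^esub> w) (t \<otimes> x \<oplus> s \<otimes> y) (s \<otimes> t)"
proof -
  have c: "z \<in> carrier S" "w \<in> carrier S" "x \<in> carrier R" "y \<in> carrier R" "s \<in> carrier R" "t \<in> carrier R"
    using assms by (auto simp: frac_def)
  have "j (s \<otimes> t) \<otimes>\<^bsub>S\<^esub> (z \<oplus>\<^bsub>S\<^esub> w) = j t \<otimes>\<^bsub>S\<^esub> (j s \<otimes>\<^bsub>S\<^esub> z) \<oplus>\<^bsub>S\<^esub> j s \<otimes>\<^bsub>S\<^esub> (j t \<otimes>\<^bsub>S\<^esub> w)"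
    using c by (simp add: j_mult S.r_distr S.m_ac)
  then show ?thesis using assms c P_mult by (simp add: frac_def j_mult j_add)
qed

lemma frac_unique:
  assumes z: "frac z x s" and w: "frac z y t" shows "t \<otimes> x = s \<otimes> y"
proof -
  have c: "z \<in> carrier S" "x \<in> carrier R" "y \<in> carrier R" "s \<in> carrier R" "t \<in> carrier R"
    using assms by (auto simp: frac_def)
  have "j t \<otimes>\<^bsub>S\<^esub> (j s \<otimes>\<^bsub>S\<^esub> z) = j s \<otimes>\<^bsub>S\<^esub> (j t \<otimes>\<^bsub>S\<^esub> z)" using c by (simp add: S.m_lcomm)
  then show ?thesis using assms c j_eq_iff[of "t \<otimes> x" "s \<otimes> y"] by (simp add: frac_def j_mult)
qed

definition extend :: "'a set \<Rightarrow> 'c set" where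
  "extend Q = {z. \<exists>x\<in>Q. \<exists>s. frac z x s}"

definition contract :: "'c set \<Rightarrow> 'a set" where
  "contract H = {x \<in> carrier R. j x \<in> H}"

lemma mem_extend:
  assumes Q: "primeideal Q R" "Q \<subseteq> P" and z: "frac z x s"
  shows "z \<in> extend Q \<longleftrightarrow> x \<in> Q"
proof
  assume "z \<in> extend Q"
  then obtain y t where y: "y \<in> Q" "frac z y t" by (auto simp: extend_def)
  have "t \<otimes> x = s \<otimes> y" using frac_unique[OF z y(2)] .
  also have "\<dots> \<in> Q" using y z ideal.I_l_closed[OF primeideal.axioms(1)[OF Q(1)]] by (auto simp: frac_def)
  finally show "x \<in> Q" using primeideal.I_prime[OF Q(1), of t x] y(2) z Q(2) by (auto simp: frac_def)
qed (use z in \<open>auto simp: extend_def\<close>)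

lemma prime_extend:
  assumes Q: "primeideal Q R" "Q \<subseteq> P"
  shows "primeideal (extend Q) S"
proof -
  interpret Q: primeideal Q R by (rule Q(1))
  note mem = mem_extend[OF Q]
  have sub: "extend Q \<subseteq> carrier S" by (auto simp: extend_def frac_def)
  have mult: "z \<otimes>\<^bsub>S\<^esub> w \<in> extend Q" if z: "z \<in> extend Q" and w: "w \<in> carrier S" for z w
  proof -
    obtain x s where x: "x \<in> Q" "frac z x s" using z by (auto simp: extend_def)
    obtain y t where y: "frac w y t" using w by (rule fracE)
    then have "x \<otimes> y \<in> Q" using x Q.I_r_closed by (simp add: frac_def)
    then show ?thesis using mem[OF frac_mult[OF x(2) y]] by simp
  qed
  have "ideal (extend Q) S"
  proof (rule idealI[OF S.ring_axioms])
    show "subgroup (extend Q) (add_monoid S)"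
    proof (rule S.add.subgroupI)
      show "extend Q \<subseteq> carrier S" by (rule sub)
      have "\<zero>\<^bsub>S\<^esub> \<in> extend Q" using mem[OF frac_j[of \<zero>]] Q.zero_closed by simp
      then show "extend Q \<noteq> {}" by blast
      show "\<ominus>\<^bsub>S\<^esub> z \<in> extend Q" if z: "z \<in> extend Q" for z
      proof -
        have zc: "z \<in> carrier S" using z sub by blast
        have "z \<otimes>\<^bsub>S\<^esub> (\<ominus>\<^bsub>S\<^esub> \<one>\<^bsub>S\<^esub>) \<in> extend Q" using mult[OF z, of "\<ominus>\<^bsub>S\<^esub> \<one>\<^bsub>S\<^esub>"] by simp
        moreover have "z \<otimes>\<^bsub>S\<^esub> (\<ominus>\<^bsub>S\<^esub> \<one>\<^bsub>S\<^esub>) = \<ominus>\<^bsub>S\<^esub> z" using zc by (simp add: S.r_minus)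
        ultimately show ?thesis by simp
      qed
      show "z \<oplus>\<^bsub>S\<^esub> w \<in> extend Q" if zw: "z \<in> extend Q" "w \<in> extend Q" for z w
      proof -
        obtain x s where x: "x \<in> Q" "frac z x s" using zw by (auto simp: extend_def)
        obtain y t where y: "y \<in> Q" "frac w y t" using zw by (auto simp: extend_def)
        have "t \<otimes> x \<oplus> s \<otimes> y \<in> Q"
          using x y Q.I_l_closed by (intro Q.a_closed) (auto simp: frac_def)
        then show ?thesis using mem[OF frac_add[OF x(2) y(2)]] by simp
      qed
    qed
    show "a \<otimes>\<^bsub>S\<^esub> x \<in> extend Q" "x \<otimes>\<^bsub>S\<^esub> a \<in> extend Q" if a: "a \<in> extend Q" and x: "x \<in> carrier S" for a x
    proof -
      show *: "a \<otimes>\<^bsub>S\<^esub> x \<in> extend Q" using mult[OF a x] .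
      have "a \<in> carrier S" using a sub by blast
      then show "x \<otimes>\<^bsub>S\<^esub> a \<in> extend Q" using * x S.m_comm by metis
    qed
  qed
  then show ?thesis
  proof (rule primeidealI[OF _ S.cring_axioms])
    have "\<one> \<notin> Q" using P_one Q(2) by blast
    then have "j \<one> \<notin> extend Q" using mem[OF frac_j[OF R.one_closed]] by blast
    then show "carrier S \<noteq> extend Q" by auto
    fix a b assume ab: "a \<in> carrier S" "b \<in> carrier S" "a \<otimes>\<^bsub>S\<^esub> b \<in> extend Q"
    obtain x s where x: "frac a x s" using ab(1) by (rule fracE)
    obtain y t where y: "frac b y t" using ab(2) by (rule fracE)
    have "x \<otimes> y \<in> Q" using mem[OF frac_mult[OF x y]] ab(3) by simp
    then have "x \<in> Q \<or> y \<in> Q" using Q.I_prime x y by (simp add: frac_def)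
    then show "a \<in> extend Q \<or> b \<in> extend Q" using mem[OF x] mem[OF y] by blast
  qed
qed

lemma prime_contract: "primeideal H S \<Longrightarrow> primeideal (contract H) R"
  unfolding contract_def using ring_hom_ring.primeideal_vimage[OF hom R.is_cring] .

lemma mem_contract:
  assumes H: "primeideal H S" and z: "frac z x s"
  shows "z \<in> H \<longleftrightarrow> x \<in> contract H"
proof
  interpret H: primeideal H S by (rule H)
  have c: "z \<in> carrier S" "x \<in> carrier R" "s \<in> carrier R" "j s \<otimes>\<^bsub>S\<^esub> z = j x" using z by (auto simp: frac_def)
  show "x \<in> contract H" if "z \<in> H"
    using H.I_l_closed[OF that, of "j s"] c by (simp add: contract_def)
  assume "x \<in> contract H"
  then have mem: "j s \<otimes>\<^bsub>S\<^esub> z \<in> H" using c by (simp add: contract_def)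
  obtain u where u: "u \<in> carrier S" "j s \<otimes>\<^bsub>S\<^esub> u = \<one>\<^bsub>S\<^esub>" using j_unit z by (auto simp: frac_def)
  have "u \<otimes>\<^bsub>S\<^esub> (j s \<otimes>\<^bsub>S\<^esub> z) = (j s \<otimes>\<^bsub>S\<^esub> u) \<otimes>\<^bsub>S\<^esub> z" using u(1) c by (simp add: S.m_ac)
  then show "z \<in> H" using H.I_l_closed[OF mem u(1)] u c by simp
qed

lemma contract_subset:
  assumes H: "primeideal H S" shows "contract H \<subseteq> P"
proof
  interpret H: primeideal H S by (rule H)
  fix x assume x: "x \<in> contract H"
  show "x \<in> P"
  proof (rule ccontr)
    assume "x \<notin> P"
    then obtain u where u: "u \<in> carrier S" "j x \<otimes>\<^bsub>S\<^esub> u = \<one>\<^bsub>S\<^esub>" using j_unit[of x] x by (auto simp: contract_def)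
    have "\<one>\<^bsub>S\<^esub> \<in> H" using H.I_r_closed[of "j x" u] x u by (simp add: contract_def)
    then show False using H.one_imp_carrier H.I_notcarr by simp
  qed
qed

lemma contract_strict:
  assumes "primeideal H S" "primeideal K S" "H \<subset> K"
  shows "contract H \<subset> contract K"
proof -
  obtain z where z: "z \<in> K" "z \<notin> H" using assms by blast
  have "z \<in> carrier S" using z(1) ideal.Icarr primeideal.axioms(1)[OF assms(2)] by metis
  then obtain x s where "frac z x s" by (rule fracE)
  then have "x \<in> contract K" "x \<notin> contract H" using mem_contract assms z by blast+
  then show ?thesis using assms(3) by (auto simp: contract_def)
qed

lemma extend_strict:
  assumes H: "primeideal H R" "H \<subseteq> P" and K: "primeideal K R" "K \<subseteq> P" and "H \<subset> K"
  shows "extend H \<subset> extend K"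
proof -
  obtain x where x: "x \<in> K" "x \<notin> H" using assms by blast
  have xc: "x \<in> carrier R" using x(1) ideal.Icarr primeideal.axioms(1)[OF K(1)] by metis
  have "j x \<in> extend K" "j x \<notin> extend H" using mem_extend[OF H frac_j[OF xc]] mem_extend[OF K frac_j[OF xc]] x by auto
  moreover have "extend H \<subseteq> extend K" using assms(5) by (auto simp: extend_def)
  ultimately show ?thesis by blast
qed

lemma krull_dim_eq_ht: "krull_dim S = ht R P"
proof (rule antisym)
  show "krull_dim S \<le> ht R P"
    unfolding krull_dim_def
  proof (rule Sup_least)
    fix y assume "y \<in> {enat n | n Q. prime_chain S n Q}"
    then obtain n Q where y: "y = enat n" and Q: "prime_chain S n Q" by blast
    have Qp: "primeideal (Q i) S" if "i \<le> n" for i using Q that by (auto simp: prime_chain_def Spec_def)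
    have c: "prime_chain R n (\<lambda>i. contract (Q i))"
      using Q Qp prime_contract contract_strict by (auto simp: prime_chain_def Spec_def)
    \<comment> \<open>The height only counts chains that end at P. A contracted chain may stop below
      P, and appending P only makes it longer.\<close>
    have "\<exists>m Q'. n \<le> m \<and> prime_chain R m Q' \<and> Q' m = P"
    proof (cases "contract (Q n) = P")
      case True
      then show ?thesis using c by blast
    next
      case False
      then have "contract (Q n) \<subset> P" using contract_subset[OF Qp[of n]] by blast
      then have "prime_chain R (Suc n) ((\<lambda>i. contract (Q i))(Suc n := P))"
        using c prime by (auto simp: prime_chain_def Spec_def less_Suc_eq le_Suc_eq)
      then show ?thesis by (intro exI[of _ "Suc n"] exI[of _ "(\<lambda>i. contract (Q i))(Suc n := P)"]) simp
    qed
    then obtain m Q' where m: "n \<le> m" "prime_chain R m Q'" "Q' m = P" by blast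
    have "enat m \<le> ht R P" unfolding ht_def using m by (intro Sup_upper) blast
    moreover have "enat n \<le> enat m" using m by simp
    ultimately show "y \<le> ht R P" unfolding y by (rule order_trans[rotated])
  qed
  show "ht R P \<le> krull_dim S"
    unfolding ht_def
  proof (rule Sup_least)
    fix y assume "y \<in> {enat n | n Q. prime_chain R n Q \<and> Q n = P}"
    then obtain n Q where y: "y = enat n" and Q: "prime_chain R n Q" "Q n = P" by blast
    have Qp: "primeideal (Q i) R" "Q i \<subseteq> P" if "i \<le> n" for i
      using Q that prime_chain_subset[OF Q(1) that] by (auto simp: prime_chain_def Spec_def)
    have "prime_chain S n (\<lambda>i. extend (Q i))"
      unfolding prime_chain_def Spec_def
    proof (intro conjI allI impI)
      show "extend (Q i) \<in> {P. primeideal P S}" if "i \<le> n" for i using prime_extend[OF Qp[OF that]] by simp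
      show "extend (Q i) \<subset> extend (Q (Suc i))" if "i < n" for i
        using Q(1) that by (intro extend_strict Qp) (auto simp: prime_chain_def)
    qed
    then show "y \<le> krull_dim S" unfolding y krull_dim_def by (intro Sup_upper) blast
  qed
qed

lemma maximal_extend: "maximalideal (extend P) S"
proof -
  interpret M: primeideal "extend P" S using prime_extend[OF prime] by simp
  show ?thesis
  proof (rule maximalidealI[OF M.is_ideal M.I_notcarr])
    fix J assume J: "ideal J S" "extend P \<subseteq> J" "J \<subseteq> carrier S"
    show "J = extend P \<or> J = carrier S"
    proof (cases "J = extend P")
      case False
      then obtain z where z: "z \<in> J" "z \<notin> extend P" using J by blast
      obtain x s where x: "frac z x s" using fracE[of z] z J by blast
      then have "x \<notin> P" using z mem_extend[OF prime _ x] by simp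
      then obtain u where u: "u \<in> carrier S" "j x \<otimes>\<^bsub>S\<^esub> u = \<one>\<^bsub>S\<^esub>" using j_unit[of x] x by (auto simp: frac_def)
      have "j s \<otimes>\<^bsub>S\<^esub> z \<in> J" using ideal.I_l_closed[OF J(1) z(1), of "j s"] x by (simp add: frac_def)
      then have "j x \<in> J" using x by (simp add: frac_def)
      then have "j x \<otimes>\<^bsub>S\<^esub> u \<in> J" using ideal.I_r_closed[OF J(1) _ u(1)] by blast
      then show ?thesis using ideal.one_imp_carrier[OF J(1)] u by simp
    qed simp
  qed
qed

lemma unique_maximal: "(THE M. maximalideal M S) = extend P"
proof (rule the_equality[of "\<lambda>M. maximalideal M S", OF maximal_extend])
  fix H assume H: "maximalideal H S"
  have Hp: "primeideal H S" using S.maximalideal_prime[OF H] .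
  have "H \<subseteq> extend P"
  proof
    fix z assume z: "z \<in> H"
    then obtain x s where x: "frac z x s" using fracE[of z] ideal.Icarr[OF primeideal.axioms(1)[OF Hp]] by metis
    then have "x \<in> P" using mem_contract[OF Hp x] contract_subset[OF Hp] z by blast
    then show "z \<in> extend P" using x by (auto simp: extend_def)
  qed
  moreover have "ideal (extend P) S" using maximal_extend by (rule maximalideal.axioms(1))
  moreover have "extend P \<noteq> carrier S" using maximalideal.I_notcarr[OF maximal_extend] by blast
  moreover have "extend P \<subseteq> carrier S" by (auto simp: extend_def frac_def)
  ultimately show "H = extend P" using maximalideal.I_maximal[OF H, of "extend P"] by blast
qed

text \<open>These are the properties that \<open>dim_residue_field\<close> assumes: \<rho> has
  kernel P, and every element of k is a quotient of values of \<rho>.\<close>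

lemma residue_field_map:
  defines "k \<equiv> residue_field S" and "\<rho> \<equiv> \<lambda>x. extend P +>\<^bsub>S\<^esub> j x"
  shows "field k" "\<rho> \<in> ring_hom R k"
    "\<And>x. x \<in> carrier R \<Longrightarrow> \<rho> x = \<zero>\<^bsub>k\<^esub> \<longleftrightarrow> x \<in> P"
    "\<And>\<kappa>. \<kappa> \<in> carrier k \<Longrightarrow> \<exists>x\<in>carrier R. \<exists>s\<in>carrier R - P. \<rho> s \<otimes>\<^bsub>k\<^esub> \<kappa> = \<rho> x"
proof -
  interpret M: maximalideal "extend P" S by (rule maximal_extend)
  have k: "k = S Quot extend P" unfolding k_def residue_field_def unique_maximal ..
  show "field k" unfolding k using M.quotient_is_field[OF S.is_cring] .
  have hom': "(+>\<^bsub>S\<^esub>) (extend P) \<in> ring_hom S k" unfolding k by (rule M.rcos_ring_hom)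
  have eq: "\<rho> = (+>\<^bsub>S\<^esub>) (extend P) \<circ> j" by (auto simp: \<rho>_def)
  show "\<rho> \<in> ring_hom R k" unfolding eq using ring_hom_trans[OF j_hom hom'] .
  show "\<rho> x = \<zero>\<^bsub>k\<^esub> \<longleftrightarrow> x \<in> P" if x: "x \<in> carrier R" for x
  proof -
    have "\<rho> x = \<zero>\<^bsub>k\<^esub> \<longleftrightarrow> j x \<in> extend P"
    proof
      assume "\<rho> x = \<zero>\<^bsub>k\<^esub>"
      then have "extend P +>\<^bsub>S\<^esub> j x = extend P" unfolding \<rho>_def k by (simp add: FactRing_def)
      then show "j x \<in> extend P" using M.a_rcos_self[of "j x"] x by simp
    next
      assume "j x \<in> extend P"
      then have "extend P +>\<^bsub>S\<^esub> j x = extend P" by (rule M.a_rcos_const)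
      then show "\<rho> x = \<zero>\<^bsub>k\<^esub>" unfolding \<rho>_def k by (simp add: FactRing_def)
    qed
    then show ?thesis using mem_extend[OF prime _ frac_j[OF x]] by simp
  qed
  fix \<kappa> assume "\<kappa> \<in> carrier k"
  then obtain z where z: "z \<in> carrier S" "\<kappa> = extend P +>\<^bsub>S\<^esub> z"
    unfolding k by (auto simp: FactRing_def A_RCOSETS_def')
  obtain x s where x: "frac z x s" using z(1) by (rule fracE)
  have "\<rho> s \<otimes>\<^bsub>k\<^esub> \<kappa> = extend P +>\<^bsub>S\<^esub> (j s \<otimes>\<^bsub>S\<^esub> z)"
    unfolding \<rho>_def z(2) using ring_hom_mult[OF hom', of "j s" z] x z by (auto simp: frac_def)
  then have "\<rho> s \<otimes>\<^bsub>k\<^esub> \<kappa> = \<rho> x" using x by (simp add: frac_def \<rho>_def)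
  then show "\<exists>x\<in>carrier R. \<exists>s\<in>carrier R - P. \<rho> s \<otimes>\<^bsub>k\<^esub> \<kappa> = \<rho> x" using x by (auto simp: frac_def)
qed

end


section \<open>Residue degrees as vector space dimensions\<close>

lemma (in char_p_ring) char_p_image:
  assumes "cring S" "h \<in> ring_hom R S"
  shows "char_p_ring S p"
proof -
  interpret S: cring S by fact
  have add: "h ([n] \<cdot> \<one>) = [n] \<cdot>\<^bsub>S\<^esub> \<one>\<^bsub>S\<^esub>" for n :: nat
  proof (induction n)
    case 0
    then show ?case using ring_hom_zero[OF assms(2) ring_axioms S.ring_axioms] by simp
  next
    case (Suc n)
    then show ?case using ring_hom_memE[OF assms(2)] by simp
  qed
  show ?thesis
  proof (intro char_p_ring.intro char_p_ring_axioms.intro assms(1) prime_p)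
    show "[p] \<cdot>\<^bsub>S\<^esub> \<one>\<^bsub>S\<^esub> = \<zero>\<^bsub>S\<^esub>"
      using add[of p] char_p ring_hom_zero[OF assms(2) ring_axioms S.ring_axioms] by simp
  qed
qed

text \<open>The dimension of k over its p-th powers is built up by line extensions, so the family u
  is added one member at a time. Independence keeps each new image outside the span so far, and
  spanning after localization makes the last span all of k.\<close>

lemma (in char_p_ring) dim_residue_field:
  assumes P: "primeideal P R" and k: "field k" and \<rho>: "\<rho> \<in> ring_hom R k"
    and ker: "\<And>x. x \<in> carrier R \<Longrightarrow> \<rho> x = \<zero>\<^bsub>k\<^esub> \<longleftrightarrow> x \<in> P"
    and frac: "\<And>\<kappa>. \<kappa> \<in> carrier k \<Longrightarrow> \<exists>x\<in>carrier R. \<exists>s\<in>carrier R - P. \<rho> s \<otimes>\<^bsub>k\<^esub> \<kappa> = \<rho> x"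
    and u: "independent_mod 1 P P u n"
    and span: "sat P 1 (comb_span 1 u n (\<lambda>_. carrier R) P) = carrier R"
  shows "ring.dim k ((\<lambda>x. x [^]\<^bsub>k\<^esub> p) ` carrier k) (carrier k) = n"
proof -
  interpret k: field k by (rule k)
  interpret kp: char_p_ring k p by (rule char_p_image[OF k.cring_axioms \<rho>])
  note uc = independent_modD(1)[OF u]
  have \<rho>c: "\<rho> x \<in> carrier k" if "x \<in> carrier R" for x using ring_hom_closed[OF \<rho> that] .
  have \<rho>m: "\<rho> (x \<otimes> y) = \<rho> x \<otimes>\<^bsub>k\<^esub> \<rho> y" if "x \<in> carrier R" "y \<in> carrier R" for x y
    using ring_hom_mult[OF \<rho> that] .
  have \<rho>a: "\<rho> (x \<oplus> y) = \<rho> x \<oplus>\<^bsub>k\<^esub> \<rho> y" if "x \<in> carrier R" "y \<in> carrier R" for x y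
    using ring_hom_add[OF \<rho> that] .
  have \<rho>1: "\<rho> \<one> = \<one>\<^bsub>k\<^esub>" using ring_hom_one[OF \<rho>] .
  have \<rho>0: "\<rho> x = \<zero>\<^bsub>k\<^esub>" if "x \<in> P" for x using ker[of x] that prime_subset[OF P] by blast
  have \<rho>pow: "\<rho> (x [^] i) = \<rho> x [^]\<^bsub>k\<^esub> i" if "x \<in> carrier R" for x and i :: nat
    using that by (induction i) (auto simp: \<rho>1 \<rho>m)
  have \<rho>frob: "\<rho> (frob 1 x) = kp.frob 1 (\<rho> x)" if "x \<in> carrier R" for x
    using \<rho>pow[OF that] by (simp add: frob_def kp.frob_def)
  have nz: "\<rho> s \<noteq> \<zero>\<^bsub>k\<^esub>" if "s \<in> carrier R - P" for s using ker[of s] that by simp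
  define K where "K = (\<lambda>x. x [^]\<^bsub>k\<^esub> p) ` carrier k"
  have K: "K = kp.frob 1 ` carrier k" by (simp add: K_def kp.frob_def)
  have frob: "kp.frob 1 \<in> ring_hom k k"
    by (intro ring_hom_memI) (auto simp: kp.frob_mult kp.frob_add)
  interpret frob: ring_hom_ring k k "kp.frob 1"
    using frob by (intro ring_hom_ringI2 k.ring_axioms)
  have sub: "subfield K k"
    unfolding K using frob.img_is_subfield(2)[OF k.carrier_is_subfield] by simp
  \<comment> \<open>The span of the images of the first m members over the field of p-th powers,
    written with one denominator s from R so that membership can be checked in R.\<close>
  define E where "E = (\<lambda>m. {\<kappa> \<in> carrier k. \<exists>s\<in>carrier R - P. \<exists>y. (\<forall>i<m. y i \<in> carrier R) \<and>
    kp.frob 1 (\<rho> s) \<otimes>\<^bsub>k\<^esub> \<kappa> = \<rho> (lcomb 1 u y m)})"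
  have kcancel: "a = b" if "c \<otimes>\<^bsub>k\<^esub> a = c \<otimes>\<^bsub>k\<^esub> b" "c \<noteq> \<zero>\<^bsub>k\<^esub>" "a \<in> carrier k" "b \<in> carrier k" "c \<in> carrier k" for a b c
    using k.m_lcancel[of c a b] that by simp
  have frnz: "kp.frob 1 (\<rho> s) \<noteq> \<zero>\<^bsub>k\<^esub>" if s: "s \<in> carrier R - P" for s
    using nz[OF frob_notin_prime[OF P s, of 1]] \<rho>frob[of s] s by simp
  have E0: "E 0 = {\<zero>\<^bsub>k\<^esub>}"
  proof
    show "E 0 \<subseteq> {\<zero>\<^bsub>k\<^esub>}"
    proof
      fix \<kappa> assume "\<kappa> \<in> E 0"
      then obtain s where s: "\<kappa> \<in> carrier k" "s \<in> carrier R - P" "kp.frob 1 (\<rho> s) \<otimes>\<^bsub>k\<^esub> \<kappa> = \<rho> \<zero>"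
        by (auto simp: E_def)
      have "\<rho> \<zero> = \<zero>\<^bsub>k\<^esub>" using \<rho>0 subm_zero[OF subm_ideal[OF prime_ideal[OF P]]] by blast
      then have "\<kappa> = \<zero>\<^bsub>k\<^esub>" using s frnz[OF s(2)] \<rho>c k.integral[of "kp.frob 1 (\<rho> s)" \<kappa>] by simp
      then show "\<kappa> \<in> {\<zero>\<^bsub>k\<^esub>}" by simp
    qed
    have "\<rho> \<zero> = \<zero>\<^bsub>k\<^esub>" using \<rho>0 subm_zero[OF subm_ideal[OF prime_ideal[OF P]]] by blast
    then show "{\<zero>\<^bsub>k\<^esub>} \<subseteq> E 0" using one_notin_prime[OF P] \<rho>1 by (auto simp: E_def intro!: bexI[of _ \<one>])
  qed
  have step: "E (Suc m) = k.line_extension K (\<rho> (u m)) (E m)" if m: "m < n" for m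
  proof (intro Set.set_eqI iffI)
    have um: "u m \<in> carrier R" using uc m by simp
    have lcc: "lcomb 1 u y m \<in> carrier R" if "\<And>i. i < m \<Longrightarrow> y i \<in> carrier R" for y
      using uc m that by (intro lcomb_closed) auto
    fix \<kappa>
    {
      assume "\<kappa> \<in> E (Suc m)"
      then obtain s y where s: "\<kappa> \<in> carrier k" "s \<in> carrier R - P" and y: "\<And>i. i < Suc m \<Longrightarrow> y i \<in> carrier R"
        and eq: "kp.frob 1 (\<rho> s) \<otimes>\<^bsub>k\<^esub> \<kappa> = \<rho> (lcomb 1 u y (Suc m))" by (auto simp: E_def)
      let ?i = "inv\<^bsub>k\<^esub> \<rho> s"
      have "\<rho> s \<in> Units k" using nz[OF s(2)] \<rho>c s k.field_Units by simp
      then have i: "?i \<in> carrier k" "?i \<otimes>\<^bsub>k\<^esub> \<rho> s = \<one>\<^bsub>k\<^esub>" by auto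
      have sc: "\<rho> s \<in> carrier k" using s \<rho>c by simp
      have i': "kp.frob 1 ?i \<otimes>\<^bsub>k\<^esub> kp.frob 1 (\<rho> s) = \<one>\<^bsub>k\<^esub>" using kp.frob_mult[OF i(1) sc, of 1] i(2) by simp
      have l: "\<rho> (lcomb 1 u y m) \<in> carrier k" using lcc y \<rho>c by simp
      have ym: "\<rho> (y m) \<in> carrier k" using y \<rho>c by simp
      have "\<kappa> = kp.frob 1 ?i \<otimes>\<^bsub>k\<^esub> (kp.frob 1 (\<rho> s) \<otimes>\<^bsub>k\<^esub> \<kappa>)"
        using i i' s sc by (simp add: k.m_assoc[symmetric])
      also have "\<dots> = kp.frob 1 ?i \<otimes>\<^bsub>k\<^esub> (\<rho> (lcomb 1 u y m) \<oplus>\<^bsub>k\<^esub> kp.frob 1 (\<rho> (y m)) \<otimes>\<^bsub>k\<^esub> \<rho> (u m))"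
        unfolding eq using lcc y um by (simp add: \<rho>a \<rho>m \<rho>frob[unfolded One_nat_def])
      also have "\<dots> = kp.frob 1 (?i \<otimes>\<^bsub>k\<^esub> \<rho> (y m)) \<otimes>\<^bsub>k\<^esub> \<rho> (u m) \<oplus>\<^bsub>k\<^esub> kp.frob 1 ?i \<otimes>\<^bsub>k\<^esub> \<rho> (lcomb 1 u y m)"
        using i(1) l ym \<rho>c[OF um] by (simp add: kp.frob_mult k.r_distr k.m_assoc k.a_comm)
      finally have dec: "\<kappa> = kp.frob 1 (?i \<otimes>\<^bsub>k\<^esub> \<rho> (y m)) \<otimes>\<^bsub>k\<^esub> \<rho> (u m) \<oplus>\<^bsub>k\<^esub> kp.frob 1 ?i \<otimes>\<^bsub>k\<^esub> \<rho> (lcomb 1 u y m)" .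
      have "kp.frob 1 (?i \<otimes>\<^bsub>k\<^esub> \<rho> (y m)) \<in> K" unfolding K using i ym by blast
      moreover have "kp.frob 1 ?i \<otimes>\<^bsub>k\<^esub> \<rho> (lcomb 1 u y m) \<in> E m"
      proof -
        have "kp.frob 1 (\<rho> s) \<otimes>\<^bsub>k\<^esub> (kp.frob 1 ?i \<otimes>\<^bsub>k\<^esub> \<rho> (lcomb 1 u y m)) = \<rho> (lcomb 1 u y m)"
        proof -
          have "kp.frob 1 (\<rho> s) \<otimes>\<^bsub>k\<^esub> (kp.frob 1 ?i \<otimes>\<^bsub>k\<^esub> \<rho> (lcomb 1 u y m))
            = (kp.frob 1 ?i \<otimes>\<^bsub>k\<^esub> kp.frob 1 (\<rho> s)) \<otimes>\<^bsub>k\<^esub> \<rho> (lcomb 1 u y m)"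
            using i(1) sc l by (simp add: k.m_ac)
          then show ?thesis using i' l by simp
        qed
        then show ?thesis unfolding E_def using s(2) y i l by (auto intro!: bexI[of _ s] exI[of _ y])
      qed
      ultimately show "\<kappa> \<in> k.line_extension K (\<rho> (u m)) (E m)"
        unfolding k.line_extension_mem_iff using dec by blast
    }
    assume "\<kappa> \<in> k.line_extension K (\<rho> (u m)) (E m)"
    then obtain b v where b: "b \<in> carrier k" and v: "v \<in> E m" and eq: "\<kappa> = kp.frob 1 b \<otimes>\<^bsub>k\<^esub> \<rho> (u m) \<oplus>\<^bsub>k\<^esub> v"
      unfolding k.line_extension_mem_iff K by blast
    obtain x t where x: "x \<in> carrier R" "t \<in> carrier R - P" "\<rho> t \<otimes>\<^bsub>k\<^esub> b = \<rho> x" using frac[OF b] by blast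
    obtain s y where s: "v \<in> carrier k" "s \<in> carrier R - P" and y: "\<And>i. i < m \<Longrightarrow> y i \<in> carrier R"
      and vq: "kp.frob 1 (\<rho> s) \<otimes>\<^bsub>k\<^esub> v = \<rho> (lcomb 1 u y m)" using v by (auto simp: E_def)
    let ?y = "\<lambda>i. if i < m then t \<otimes> y i else s \<otimes> x"
    have c: "\<rho> t \<in> carrier k" "\<rho> s \<in> carrier k" "\<rho> x \<in> carrier k" "\<rho> (u m) \<in> carrier k" "s \<in> carrier R" "t \<in> carrier R"
      using \<rho>c x s um by auto
    have "lcomb 1 u ?y m = lcomb 1 u (\<lambda>i. t \<otimes> y i) m" by (intro lcomb_cong) auto
    also have "\<dots> = frob 1 t \<otimes> lcomb 1 u y m" using uc m y c by (intro lcomb_smult) auto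
    finally have "lcomb 1 u ?y (Suc m) = frob 1 t \<otimes> lcomb 1 u y m \<oplus> frob 1 (s \<otimes> x) \<otimes> u m" by simp
    then have "\<rho> (lcomb 1 u ?y (Suc m)) = \<rho> (frob 1 t) \<otimes>\<^bsub>k\<^esub> \<rho> (lcomb 1 u y m) \<oplus>\<^bsub>k\<^esub> \<rho> (frob 1 (s \<otimes> x)) \<otimes>\<^bsub>k\<^esub> \<rho> (u m)"
      using lcc[OF y] c um x(1) by (simp add: \<rho>a \<rho>m)
    also have "\<rho> (frob 1 (s \<otimes> x)) = kp.frob 1 (\<rho> s) \<otimes>\<^bsub>k\<^esub> kp.frob 1 (\<rho> x)"
      using c x by (simp add: \<rho>frob \<rho>m kp.frob_mult del: One_nat_def)
    also have "kp.frob 1 (\<rho> x) = kp.frob 1 (\<rho> t) \<otimes>\<^bsub>k\<^esub> kp.frob 1 b"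
      using x(3)[symmetric] c b by (simp add: kp.frob_mult)
    also have "\<rho> (frob 1 t) = kp.frob 1 (\<rho> t)" using \<rho>frob c by simp
    also have "kp.frob 1 (\<rho> t) \<otimes>\<^bsub>k\<^esub> \<rho> (lcomb 1 u y m) \<oplus>\<^bsub>k\<^esub>
        kp.frob 1 (\<rho> s) \<otimes>\<^bsub>k\<^esub> (kp.frob 1 (\<rho> t) \<otimes>\<^bsub>k\<^esub> kp.frob 1 b) \<otimes>\<^bsub>k\<^esub> \<rho> (u m)
      = kp.frob 1 (\<rho> (s \<otimes> t)) \<otimes>\<^bsub>k\<^esub> \<kappa>"
    proof -
      have "(T \<otimes>\<^bsub>k\<^esub> (T' \<otimes>\<^bsub>k\<^esub> v)) \<oplus>\<^bsub>k\<^esub> T' \<otimes>\<^bsub>k\<^esub> (T \<otimes>\<^bsub>k\<^esub> B) \<otimes>\<^bsub>k\<^esub> U = (T' \<otimes>\<^bsub>k\<^esub> T) \<otimes>\<^bsub>k\<^esub> (B \<otimes>\<^bsub>k\<^esub> U \<oplus>\<^bsub>k\<^esub> v)"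
        if "T \<in> carrier k" "T' \<in> carrier k" "B \<in> carrier k" "U \<in> carrier k" for T T' B U
        using that s(1) by algebra
      from this[of "kp.frob 1 (\<rho> t)" "kp.frob 1 (\<rho> s)" "kp.frob 1 b" "\<rho> (u m)"]
      show ?thesis unfolding vq[symmetric] eq using c b by (simp add: \<rho>m kp.frob_mult)
    qed
    finally have "kp.frob 1 (\<rho> (s \<otimes> t)) \<otimes>\<^bsub>k\<^esub> \<kappa> = \<rho> (lcomb 1 u ?y (Suc m))" by simp
    moreover have "\<kappa> \<in> carrier k" unfolding eq using b c s by simp
    moreover have "s \<otimes> t \<in> carrier R - P" using mult_notin_prime[OF P s(2) x(2)] .
    ultimately show "\<kappa> \<in> E (Suc m)" unfolding E_def using y c x by (auto intro!: bexI[of _ "s \<otimes> t"] exI[of _ ?y])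
  qed
  have notin: "\<rho> (u m) \<notin> E m" if m: "m < n" for m
  proof
    assume "\<rho> (u m) \<in> E m"
    then obtain s y where s: "s \<in> carrier R - P" and y: "\<And>i. i < m \<Longrightarrow> y i \<in> carrier R"
      and eq: "kp.frob 1 (\<rho> s) \<otimes>\<^bsub>k\<^esub> \<rho> (u m) = \<rho> (lcomb 1 u y m)" by (auto simp: E_def)
    have um: "u m \<in> carrier R" and sc: "s \<in> carrier R" using uc m s by auto
    have l: "lcomb 1 u y m \<in> carrier R" using uc m y by (intro lcomb_closed) auto
    \<comment> \<open>The relation involves the members up to m only, while independence speaks of
      all n, so it is padded by zeros. Its coefficient s at m is outside P, which is the
      contradiction.\<close>
    let ?y = "\<lambda>i. if i < m then \<ominus> y i else if i = m then s else \<zero>"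
    have tail: "lcomb 1 u ?y (Suc m + d) = lcomb 1 u ?y (Suc m)" if "Suc m + d \<le> n" for d
      using that
    proof (induction d)
      case (Suc d)
      have "lcomb 1 u ?y (Suc m + d) \<in> carrier R" using Suc.prems uc y sc by (intro lcomb_closed) auto
      then show ?case using Suc uc[of "Suc m + d"] by simp
    qed simp
    have "lcomb 1 u ?y n = lcomb 1 u ?y (Suc m)" using tail[of "n - Suc m"] m by simp
    also have "\<dots> = lcomb 1 u (\<lambda>i. \<ominus> y i) m \<oplus> frob 1 s \<otimes> u m"
      using lcomb_cong[of m ?y "\<lambda>i. \<ominus> y i" u u 1] by simp
    also have "lcomb 1 u (\<lambda>i. \<ominus> y i) m = \<ominus> lcomb 1 u y m" using uc m y by (intro lcomb_minus) auto
    finally have eq': "lcomb 1 u ?y n = \<ominus> lcomb 1 u y m \<oplus> frob 1 s \<otimes> u m" .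
    have "\<rho> (lcomb 1 u ?y n \<oplus> lcomb 1 u y m) = \<rho> (lcomb 1 u y m)"
    proof -
      have "lcomb 1 u ?y n \<oplus> lcomb 1 u y m = frob 1 s \<otimes> u m"
      proof -
        have "(\<ominus> a \<oplus> b) \<oplus> a = b" if "a \<in> carrier R" "b \<in> carrier R" for a b using that by algebra
        then show ?thesis unfolding eq' using l um sc by simp
      qed
      then show ?thesis using eq um sc \<rho>m \<rho>frob by simp
    qed
    moreover have lc: "lcomb 1 u ?y n \<in> carrier R" unfolding eq' using l um sc by simp
    ultimately have "\<rho> (lcomb 1 u ?y n) \<oplus>\<^bsub>k\<^esub> \<rho> (lcomb 1 u y m) = \<rho> (lcomb 1 u y m)" using l by (simp add: \<rho>a)
    then have "\<rho> (lcomb 1 u ?y n) = \<zero>\<^bsub>k\<^esub>" using k.add.r_cancel_one[OF \<rho>c[OF l] \<rho>c[OF lc]] by blast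
    then have "lcomb 1 u ?y n \<in> P" using ker[OF lc] by simp
    then have "?y m \<in> P" using y sc m by (intro independent_modD(2)[OF u, of ?y m]) auto
    then show False using s by simp
  qed
  have En: "E n = carrier k"
  proof
    show "E n \<subseteq> carrier k" by (auto simp: E_def)
    show "carrier k \<subseteq> E n"
    proof
      fix \<kappa> assume \<kappa>: "\<kappa> \<in> carrier k"
      obtain x t where x: "x \<in> carrier R" "t \<in> carrier R - P" "\<rho> t \<otimes>\<^bsub>k\<^esub> \<kappa> = \<rho> x" using frac[OF \<kappa>] by blast
      have tc: "t \<in> carrier R" using x by simp
      obtain t' where t': "t' \<in> carrier R" "frob 1 t = t \<otimes> t'" using frob_factor[OF tc] by blast
      \<comment> \<open>The scalars are p-th powers, so the fraction x/t is rewritten as t' x over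
        t^p before spanning is applied.\<close>
      have "t' \<otimes> x \<in> sat P 1 (comb_span 1 u n (\<lambda>_. carrier R) P)" unfolding span using t' x by simp
      then obtain s where s: "s \<in> carrier R - P" "frob 1 s \<otimes> (t' \<otimes> x) \<in> comb_span 1 u n (\<lambda>_. carrier R) P"
        by (auto simp: sat_def)
      then obtain b y where b: "b \<in> P" and y: "\<And>i. i < n \<Longrightarrow> y i \<in> carrier R"
        and eq: "frob 1 s \<otimes> (t' \<otimes> x) = b \<oplus> lcomb 1 u y n" by (elim comb_spanE) blast
      have sc: "s \<in> carrier R" and bc: "b \<in> carrier R" using s b prime_subset[OF P] by auto
      have l: "lcomb 1 u y n \<in> carrier R" using uc y by (intro lcomb_closed) auto
      have "\<rho> (lcomb 1 u y n) = \<rho> (frob 1 s \<otimes> (t' \<otimes> x))"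
        unfolding eq using \<rho>0[OF b] bc l \<rho>c by (simp add: \<rho>a)
      also have "\<dots> = \<rho> (frob 1 s) \<otimes>\<^bsub>k\<^esub> (\<rho> t' \<otimes>\<^bsub>k\<^esub> (\<rho> t \<otimes>\<^bsub>k\<^esub> \<kappa>))"
        unfolding x(3) using sc t' x by (simp add: \<rho>m)
      also have "\<dots> = \<rho> (frob 1 s \<otimes> frob 1 t) \<otimes>\<^bsub>k\<^esub> \<kappa>"
        unfolding t'(2) using sc tc t' \<kappa> \<rho>c by (simp add: \<rho>m k.m_ac)
      also have "frob 1 s \<otimes> frob 1 t = frob 1 (s \<otimes> t)" using sc tc by (simp add: frob_mult)
      also have "\<rho> (frob 1 (s \<otimes> t)) = kp.frob 1 (\<rho> (s \<otimes> t))" using sc tc \<rho>frob by simp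
      finally show "\<kappa> \<in> E n"
        unfolding E_def using \<kappa> y mult_notin_prime[OF P s(1) x(2)] by (auto intro!: bexI[of _ "s \<otimes> t"] exI[of _ y])
    qed
  qed
  have "k.dimension m K (E m)" if "m \<le> n" for m
    using that
  proof (induction m)
    case 0
    then show ?case using E0 by simp
  next
    case (Suc m)
    then show ?case using step[of m] notin[of m] uc \<rho>c by (auto intro!: k.Suc_dim)
  qed
  then have "k.dimension n K (carrier k)" using En by (metis order_refl)
  then have "k.dim K (carrier k) = n" using k.dimI[OF sub] by (simp add: over_def)
  then show ?thesis by (simp add: K_def)
qed


section \<open>Limits along semigroups of exponents\<close>

text \<open>The estimates run over exponents, the definitions over the powers q; this carries
  eventual statements from one filter to the other.\<close>

lemma eventually_ppowers:
  fixes p :: nat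
  assumes p: "1 < p" and ev: "eventually (\<lambda>e. Q (p ^ e)) (inf at_top (principal E))"
  shows "eventually Q (inf at_top (principal ((\<lambda>e. p ^ e) ` E)))"
proof -
  obtain N where N: "\<And>e. N \<le> e \<Longrightarrow> e \<in> E \<Longrightarrow> Q (p ^ e)"
    using ev unfolding eventually_inf_principal eventually_at_top_linorder by auto
  have "Q q" if q: "p ^ N \<le> q" "q \<in> (\<lambda>e. p ^ e) ` E" for q
  proof -
    obtain e where e: "e \<in> E" "q = p ^ e" using q(2) by auto
    have "N \<le> e" using q(1) e(2) p by (simp add: power_increasing_iff)
    then show ?thesis using N e by simp
  qed
  then show ?thesis
    unfolding eventually_inf_principal eventually_at_top_linorder by blast
qed

lemma semigroup_mult_closed:
  fixes E :: "nat set"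
  assumes "0 \<in> E" "\<And>d e. d \<in> E \<Longrightarrow> e \<in> E \<Longrightarrow> d + e \<in> E" "d \<in> E"
  shows "m * d \<in> E"
  using assms by (induction m) auto

text \<open>A numerical semigroup contains the difference of two of its members once that is large:
  modulo \<open>d0\<close> its residues form a group.\<close>

lemma semigroup_residues:
  fixes E :: "nat set"
  assumes E0: "0 \<in> E" and add: "\<And>d e. d \<in> E \<Longrightarrow> e \<in> E \<Longrightarrow> d + e \<in> E" and d0: "d0 \<in> E" "0 < d0"
  obtains T where "finite T" "T \<subseteq> E" "\<And>d. d \<in> E \<Longrightarrow> \<exists>t\<in>T. \<exists>m. d = t + m * d0"
    "\<And>d e. d \<in> E \<Longrightarrow> e \<in> E \<Longrightarrow> e + \<Sum>T \<le> d \<Longrightarrow> d - e \<in> E"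
proof -
  \<comment> \<open>The least member of E in each residue class modulo d0 that E meets. There are
    finitely many of these, and every member of E arises from one of them by adding a multiple of
    d0.\<close>
  define t where "t = (\<lambda>r. LEAST d. d \<in> E \<and> d mod d0 = r)"
  define T where "T = t ` ((\<lambda>d. d mod d0) ` E)"
  have "(\<lambda>d. d mod d0) ` E \<subseteq> {..<d0}" using d0 by auto
  then have fin: "finite T" unfolding T_def using finite_subset by blast
  have t: "t (d mod d0) \<in> E" "t (d mod d0) mod d0 = d mod d0" "t (d mod d0) \<le> d" if "d \<in> E" for d
    using LeastI[of "\<lambda>x. x \<in> E \<and> x mod d0 = d mod d0" d] Least_le[of "\<lambda>x. x \<in> E \<and> x mod d0 = d mod d0" d] that
    unfolding t_def by auto
  have dec: "\<exists>m. d = c + m * d0" if "c mod d0 = d mod d0" "c \<le> d" for c d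
  proof -
    have "d0 dvd d - c" using mod_eq_dvd_iff_nat[OF that(2), of d0] that(1) by simp
    then obtain m where "d - c = d0 * m" by (elim dvdE)
    then have "d = c + m * d0" using that(2) by (simp add: mult.commute)
    then show ?thesis by blast
  qed
  have "d - e \<in> E" if d: "d \<in> E" and e: "e \<in> E" and le: "e + \<Sum>T \<le> d" for d e
  proof -
    \<comment> \<open>f is a member of E congruent to d - e modulo d0, so E meets the class of d -
      e. As d - e is at least the sum of T, it is not below the least member of that class.\<close>
    define f where "f = d + (d0 - 1) * e"
    have f: "f \<in> E" unfolding f_def using add d semigroup_mult_closed[OF E0 add e] by blast
    have "e + (d0 - 1) * e = e * d0" using d0 by (cases d0) simp_all
    then have "f = (d - e) + e * d0" unfolding f_def using le by simp
    then have eq: "(d - e) mod d0 = f mod d0" by simp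
    have "t (f mod d0) \<in> T" unfolding T_def using f by blast
    then have "t (f mod d0) \<le> \<Sum>T" using member_le_sum[of "t (f mod d0)" T "\<lambda>x. x"] fin by simp
    then have "t (f mod d0) \<le> d - e" using le by simp
    moreover have "t (f mod d0) mod d0 = (d - e) mod d0" using t(2)[OF f] eq by simp
    ultimately obtain m where "d - e = t (f mod d0) + m * d0" using dec by blast
    then show ?thesis using add[OF t(1)[OF f] semigroup_mult_closed[OF E0 add d0(1)]] by simp
  qed
  moreover have "\<exists>c\<in>T. \<exists>m. d = c + m * d0" if "d \<in> E" for d
    using dec[OF t(2,3)[OF that]] that unfolding T_def by blast
  moreover have "T \<subseteq> E" unfolding T_def using t(1) by auto
  ultimately show ?thesis using that fin by blast
qed

text \<open>The errors along the multiples of d form a geometric series whose ratio 1/p^d is at most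
  1/2, whence the factor 2.\<close>

lemma geometric_iterate:
  fixes s :: "nat \<Rightarrow> real" and p :: nat
  assumes p: "2 \<le> p" and d: "0 < d" and C: "0 \<le> C" and step: "\<And>e. s e \<le> s (e + d) + C / p ^ e"
  shows "s e \<le> s (e + m * d) + 2 * C / p ^ e"
proof (induction m arbitrary: e)
  case 0
  then show ?case using C by simp
next
  case (Suc m)
  have pd: "2 \<le> real p ^ d"
  proof -
    have "real p \<le> real p ^ d" using p d by (intro self_le_power) auto
    then show ?thesis using p by linarith
  qed
  have "2 * C / p ^ (e + d) = (2 / real p ^ d) * (C / real p ^ e)" by (simp add: power_add)
  also have "\<dots> \<le> 1 * (C / real p ^ e)" using pd C by (intro mult_right_mono) (auto simp: divide_le_eq)
  finally have "2 * C / p ^ (e + d) \<le> C / p ^ e" by simp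
  moreover have "2 * C / p ^ e = C / p ^ e + C / p ^ e" by simp
  moreover have "s (e + d) \<le> s (e + Suc m * d) + 2 * C / p ^ (e + d)"
    using Suc.IH[of "e + d"] by (simp add: add.assoc)
  ultimately show ?case using step[of e] by linarith
qed

text \<open>The constant in the hypothesis depends on d. Writing d as t + m d0 with t in a finite
  set makes it uniform, with \<open>geometric_iterate\<close> for the multiples of d0. The limit is
  the supremum over e in E of \<open>s e x\<close> lowered by the error C/p^e.\<close>

lemma semigroup_limit:
  fixes s :: "nat \<Rightarrow> 'x \<Rightarrow> real" and p :: nat
  assumes p: "2 \<le> p" and E0: "0 \<in> E" and add: "\<And>d e. d \<in> E \<Longrightarrow> e \<in> E \<Longrightarrow> d + e \<in> E"
    and d0: "d0 \<in> E" "0 < d0"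
    and lower: "\<And>d. d \<in> E \<Longrightarrow> \<exists>C\<ge>0. \<forall>x\<in>A. \<forall>e. s e x \<le> s (e + d) x + C / p ^ e"
    and bound: "\<And>e x. x \<in> A \<Longrightarrow> s e x \<le> 1"
  obtains C l where "0 \<le> C" "\<And>e x. x \<in> A \<Longrightarrow> e \<in> E \<Longrightarrow> s e x \<le> l x + C / p ^ e"
    "\<And>x. x \<in> A \<Longrightarrow> ((\<lambda>e. s e x) \<longlongrightarrow> l x) (inf at_top (principal E))"
proof -
  obtain T where T: "finite T" "T \<subseteq> E" "\<And>d. d \<in> E \<Longrightarrow> \<exists>t\<in>T. \<exists>m. d = t + m * d0"
    "\<And>d e. d \<in> E \<Longrightarrow> e \<in> E \<Longrightarrow> e + \<Sum>T \<le> d \<Longrightarrow> d - e \<in> E"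
    using semigroup_residues[OF E0 add d0] by blast
  obtain c where c: "\<And>d. d \<in> E \<Longrightarrow> 0 \<le> c d"
    "\<And>d x e. d \<in> E \<Longrightarrow> x \<in> A \<Longrightarrow> s e x \<le> s (e + d) x + c d / p ^ e"
  proof -
    have "\<forall>d. \<exists>C. d \<in> E \<longrightarrow> 0 \<le> C \<and> (\<forall>x\<in>A. \<forall>e. s e x \<le> s (e + d) x + C / p ^ e)" using lower by blast
    from choice[OF this] show ?thesis using that by blast
  qed
  define C where "C = (\<Sum>t\<in>T. c t) + 2 * c d0"
  have Cpos: "0 \<le> C" unfolding C_def using c(1) T(2) d0 by (intro add_nonneg_nonneg sum_nonneg) auto
  have unif: "s e x \<le> s (e + d) x + C / p ^ e" if d: "d \<in> E" and x: "x \<in> A" for d e x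
  proof -
    obtain t m where t: "t \<in> T" "d = t + m * d0" using T(3)[OF d] by blast
    have "s e x \<le> s (e + m * d0) x + 2 * c d0 / p ^ e"
      using c d0 x by (intro geometric_iterate[where s = "\<lambda>e. s e x"] p) auto
    also have "s (e + m * d0) x \<le> s (e + m * d0 + t) x + c t / p ^ (e + m * d0)"
      using c(2) t(1) T(2) x by blast
    also have "c t / p ^ (e + m * d0) \<le> c t / p ^ e"
      using c(1)[of t] t(1) T(2) p by (intro divide_left_mono power_increasing mult_pos_pos) auto
    also have "c t \<le> (\<Sum>t\<in>T. c t)" using t(1) T c(1) by (intro member_le_sum) auto
    then have "c t / p ^ e \<le> (\<Sum>t\<in>T. c t) / p ^ e" by (intro divide_right_mono) auto
    finally have "s e x \<le> s (e + m * d0 + t) x + (\<Sum>t\<in>T. c t) / p ^ e + 2 * c d0 / p ^ e" by simp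
    then show ?thesis using t(2) by (simp add: C_def add_divide_distrib ac_simps)
  qed
  define l where "l = (\<lambda>x. SUP e\<in>E. s e x - C / p ^ e)"
  have bdd: "bdd_above ((\<lambda>e. s e x - C / p ^ e) ` E)" if "x \<in> A" for x
  proof (rule bdd_aboveI2)
    show "s e x - C / p ^ e \<le> 1" for e using bound[OF that, of e] Cpos
      by (smt (verit) divide_nonneg_nonneg of_nat_0_le_iff)
  qed
  have le: "s e x \<le> l x + C / p ^ e" if "x \<in> A" "e \<in> E" for e x
    using cSUP_upper[OF that(2) bdd[OF that(1)]] unfolding l_def by linarith
  have "((\<lambda>e. s e x) \<longlongrightarrow> l x) (inf at_top (principal E))" if x: "x \<in> A" for x
  proof (rule order_tendstoI)
    fix a assume "a < l x"
    then obtain e where e: "e \<in> E" "a < s e x - C / p ^ e"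
      unfolding l_def using less_cSUP_iff[OF _ bdd[OF x]] E0 by blast
    \<comment> \<open>From e one can pass to every large d in E, because d - e is then itself in
      E.\<close>
    have "a < s d x" if d: "e + \<Sum>T \<le> d" "d \<in> E" for d
    proof -
      have "d - e \<in> E" using T(4)[OF d(2) e(1) d(1)] .
      from unif[OF this x, of e] show ?thesis using d(1) e(2) by simp
    qed
    then show "\<forall>\<^sub>F d in inf at_top (principal E). a < s d x"
      unfolding eventually_inf_principal eventually_at_top_linorder by blast
  next
    fix a assume a: "l x < a"
    have "((\<lambda>e. C / real p ^ e) \<longlongrightarrow> 0) at_top"
      using tendsto_mult[OF tendsto_const[of C] LIMSEQ_realpow_zero[of "1 / real p"]] p
      by (simp add: power_divide)
    then have "\<forall>\<^sub>F e in at_top. C / real p ^ e < a - l x" using a by (intro order_tendstoD(2)) auto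
    then show "\<forall>\<^sub>F d in inf at_top (principal E). s d x < a"
      unfolding eventually_inf_principal by eventually_elim (use le[OF x] in fastforce)
  qed
  then show ?thesis using that Cpos le by blast
qed

lemma geometric_uniform_limit:
  fixes s :: "nat \<Rightarrow> 'x \<Rightarrow> real" and p :: nat
  assumes p: "2 \<le> p" and C: "\<And>e x. x \<in> A \<Longrightarrow> e \<in> E \<Longrightarrow> \<bar>s e x - l x\<bar> \<le> C / p ^ e"
  shows "uniform_limit A s l (inf at_top (principal E))"
proof (rule uniform_limitI)
  fix \<epsilon> :: real assume "0 < \<epsilon>"
  have "((\<lambda>e. C / real p ^ e) \<longlongrightarrow> 0) at_top"
    using tendsto_mult[OF tendsto_const[of C] LIMSEQ_realpow_zero[of "1 / real p"]] p
    by (simp add: power_divide)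
  then have "\<forall>\<^sub>F e in at_top. C / real p ^ e < \<epsilon>" using \<open>0 < \<epsilon>\<close> by (intro order_tendstoD(2)) auto
  then show "\<forall>\<^sub>F e in inf at_top (principal E). \<forall>x\<in>A. dist (s e x) (l x) < \<epsilon>"
    unfolding eventually_inf_principal
    by eventually_elim (use C in \<open>auto simp: dist_real_def intro: le_less_trans\<close>)
qed


section \<open>Localizing a Cartier algebra\<close>

locale cartier_at_prime = cartier_domain R p D + domain_at_prime R P
  for R (structure) and p D P
begin

abbreviation "j \<equiv> \<lambda>x. lf x \<one>"
abbreviation "E \<equiv> cartier_localization R P D"

sublocale loc: localization_map R "localization R P" P "\<lambda>x. loc_frac R P x \<one>"
  by (rule localization_map)

sublocale S: char_p_ring "localization R P" p
  by (rule char_p_image[OF cring_localization loc.j_hom])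

lemma j_frob: "x \<in> carrier R \<Longrightarrow> j (frob e x) = S.frob e (j x)"
proof -
  assume x: "x \<in> carrier R"
  have "j (x [^] n) = j x [^]\<^bsub>S\<^esub> n" for n :: nat
    using x by (induction n) (auto simp: loc.j_mult)
  then show ?thesis by (simp add: frob_def S.frob_def)
qed

lemma frac_loc_frac: "x \<in> carrier R \<Longrightarrow> s \<in> carrier R - P \<Longrightarrow> loc.frac (lf x s) x s"
  using denom_one denom_mult by (simp add: loc.frac_def loc_frac_closed loc_mult loc_frac_eq_iff m_comm)

text \<open>An element of the localized algebra is \<phi>/s, and on a fraction x/t^q it takes the
  value \<phi>(x)/(s t), since a denominator t^q leaves the map as t.\<close>

lemma E_dest:
  assumes \<psi>: "\<psi> \<in> E (p ^ e)"
  obtains \<phi> s where "\<phi> \<in> D (p ^ e)" "s \<in> carrier R - P"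
    "\<And>x t z. x \<in> carrier R \<Longrightarrow> t \<in> carrier R - P \<Longrightarrow> z \<in> carrier S \<Longrightarrow> j (frob e t) \<otimes>\<^bsub>S\<^esub> z = j x \<Longrightarrow>
      j (s \<otimes> t) \<otimes>\<^bsub>S\<^esub> \<psi> z = j (\<phi> x)"
proof -
  obtain \<phi> s where \<phi>: "\<phi> \<in> D (p ^ e)" "s \<in> carrier R - P" "\<And>x. x \<in> carrier R \<Longrightarrow> \<psi> (j x) = lf (\<phi> x) s"
    using \<psi> unfolding cartier_localization_def by blast
  have h: "\<psi> \<in> cartier_hom S (p ^ e)" using \<psi> by (simp add: cartier_localization_def)
  have "j (s \<otimes> t) \<otimes>\<^bsub>S\<^esub> \<psi> z = j (\<phi> x)"
    if x: "x \<in> carrier R" and t: "t \<in> carrier R - P" and z: "z \<in> carrier S" and eq: "j (frob e t) \<otimes>\<^bsub>S\<^esub> z = j x" for x t z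
  proof -
    have tc: "t \<in> carrier R" "s \<in> carrier R" using t \<phi> by auto
    have \<psi>z: "\<psi> z \<in> carrier S" using S.cartier_hom_closed[OF h z] .
    have "\<psi> (j x) = j t \<otimes>\<^bsub>S\<^esub> \<psi> z"
      unfolding eq[symmetric] j_frob[OF tc(1)] using S.cartier_hom_smult[OF h _ z] tc by blast
    moreover have "j s \<otimes>\<^bsub>S\<^esub> \<psi> (j x) = j (\<phi> x)"
      using frac_loc_frac[OF D_closed[OF \<phi>(1) x] \<phi>(2)] \<phi>(3)[OF x] by (simp add: loc.frac_def)
    ultimately show ?thesis using tc \<psi>z by (simp add: loc.j_mult loc.S.m_assoc)
  qed
  then show ?thesis using that[OF \<phi>(1,2)] by blast
qed

lemma q_fracE:
  assumes "z \<in> carrier S"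
  obtains x t where "x \<in> carrier R" "t \<in> carrier R - P" "j (frob e t) \<otimes>\<^bsub>S\<^esub> z = j x"
proof -
  obtain x t where x: "loc.frac z x t" using assms by (rule loc.fracE)
  then have c: "x \<in> carrier R" "t \<in> carrier R - P" "j t \<otimes>\<^bsub>S\<^esub> z = j x" by (auto simp: loc.frac_def)
  obtain t' where t': "t' \<in> carrier R" "frob e t = t \<otimes> t'" using frob_factor c by blast
  have "j (frob e t) \<otimes>\<^bsub>S\<^esub> z = j t' \<otimes>\<^bsub>S\<^esub> (j t \<otimes>\<^bsub>S\<^esub> z)"
    unfolding t'(2) using c(1,2) t'(1) assms by (simp add: loc.j_mult loc.S.m_ac)
  also have "\<dots> = j (t' \<otimes> x)" unfolding c(3) using c t' by (simp add: loc.j_mult)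
  finally show ?thesis using that[of "t' \<otimes> x" t] c t' by simp
qed

lemma E_exists:
  assumes \<phi>: "\<phi> \<in> D (p ^ e)" and s: "s \<in> carrier R - P"
  obtains \<psi> where "\<psi> \<in> E (p ^ e)" "\<And>x. x \<in> carrier R \<Longrightarrow> j s \<otimes>\<^bsub>S\<^esub> \<psi> (j x) = j (\<phi> x)"
proof -
  have sc: "s \<in> carrier R" using s by simp
  \<comment> \<open>One value w that serves all representations x/t^q of z. Additivity and linearity
    can then be checked with whichever representation is convenient.\<close>
  have "\<exists>w. w \<in> carrier S \<and> (\<forall>x\<in>carrier R. \<forall>t\<in>carrier R - P. j (frob e t) \<otimes>\<^bsub>S\<^esub> z = j x \<longrightarrow> j (s \<otimes> t) \<otimes>\<^bsub>S\<^esub> w = j (\<phi> x))"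
    if z: "z \<in> carrier S" for z
  proof -
    obtain x0 t0 where 0: "x0 \<in> carrier R" "t0 \<in> carrier R - P" "j (frob e t0) \<otimes>\<^bsub>S\<^esub> z = j x0" using z by (rule q_fracE)
    obtain u where u: "u \<in> carrier S" "j (s \<otimes> t0) \<otimes>\<^bsub>S\<^esub> u = \<one>\<^bsub>S\<^esub>" using loc.j_unit[OF denom_mult[OF s 0(2)]] by blast
    have \<phi>0: "\<phi> x0 \<in> carrier R" using \<phi> 0 by auto
    define w where "w = u \<otimes>\<^bsub>S\<^esub> j (\<phi> x0)"
    have w: "w \<in> carrier S" using u \<phi>0 by (simp add: w_def)
    have w0: "j (s \<otimes> t0) \<otimes>\<^bsub>S\<^esub> w = j (\<phi> x0)"
    proof -
      have "j (s \<otimes> t0) \<otimes>\<^bsub>S\<^esub> w = (j (s \<otimes> t0) \<otimes>\<^bsub>S\<^esub> u) \<otimes>\<^bsub>S\<^esub> j (\<phi> x0)"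
        unfolding w_def using sc 0(1,2) u(1) \<phi>0 by (simp add: loc.S.m_assoc)
      then show ?thesis using u \<phi>0 by simp
    qed
    have "j (s \<otimes> t) \<otimes>\<^bsub>S\<^esub> w = j (\<phi> x)"
      if x: "x \<in> carrier R" and t: "t \<in> carrier R - P" and eq: "j (frob e t) \<otimes>\<^bsub>S\<^esub> z = j x" for x t
    proof (rule loc.j_cancel[OF 0(2)])
      have c: "t \<in> carrier R" "t0 \<in> carrier R" "\<phi> x \<in> carrier R" using t 0 \<phi> x by auto
      have "j (frob e t0 \<otimes> x) = j (frob e t \<otimes> x0)"
        using c x 0(1) z by (simp add: loc.j_mult eq[symmetric] 0(3)[symmetric] loc.S.m_lcomm)
      then have "frob e t0 \<otimes> x = frob e t \<otimes> x0" using loc.j_eq_iff c x 0(1) by simp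
      then have eq': "t0 \<otimes> \<phi> x = t \<otimes> \<phi> x0" using D_smult[OF \<phi>] c x 0(1) by metis
      have "j t0 \<otimes>\<^bsub>S\<^esub> (j (s \<otimes> t) \<otimes>\<^bsub>S\<^esub> w) = j t \<otimes>\<^bsub>S\<^esub> (j (s \<otimes> t0) \<otimes>\<^bsub>S\<^esub> w)"
        using c sc w by (simp add: loc.j_mult loc.S.m_ac)
      also have "\<dots> = j (t0 \<otimes> \<phi> x)" unfolding w0 eq' using c \<phi>0 by (simp add: loc.j_mult)
      finally show "j t0 \<otimes>\<^bsub>S\<^esub> (j (s \<otimes> t) \<otimes>\<^bsub>S\<^esub> w) = j t0 \<otimes>\<^bsub>S\<^esub> j (\<phi> x)" using c by (simp add: loc.j_mult)
      show "j (s \<otimes> t) \<otimes>\<^bsub>S\<^esub> w \<in> carrier S" "j (\<phi> x) \<in> carrier S" using c sc w by auto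
    qed
    then show ?thesis using w by blast
  qed
  then have "\<forall>z\<in>carrier S. \<exists>w. w \<in> carrier S \<and> (\<forall>x\<in>carrier R. \<forall>t\<in>carrier R - P. j (frob e t) \<otimes>\<^bsub>S\<^esub> z = j x \<longrightarrow> j (s \<otimes> t) \<otimes>\<^bsub>S\<^esub> w = j (\<phi> x))"
    by blast
  from bchoice[OF this] obtain \<psi>0 where all:
    "\<forall>z\<in>carrier S. \<psi>0 z \<in> carrier S \<and> (\<forall>x\<in>carrier R. \<forall>t\<in>carrier R - P. j (frob e t) \<otimes>\<^bsub>S\<^esub> z = j x \<longrightarrow> j (s \<otimes> t) \<otimes>\<^bsub>S\<^esub> \<psi>0 z = j (\<phi> x))" ..
  then have \<psi>0c: "\<psi>0 z \<in> carrier S" if "z \<in> carrier S" for z using that by blast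
  have \<psi>0: "j (s \<otimes> t) \<otimes>\<^bsub>S\<^esub> \<psi>0 z = j (\<phi> x)"
    if "z \<in> carrier S" "x \<in> carrier R" "t \<in> carrier R - P" "j (frob e t) \<otimes>\<^bsub>S\<^esub> z = j x" for z x t
    using that all by blast
  define \<psi> where "\<psi> = restrict \<psi>0 (carrier S)"
  have add: "\<psi>0 (z \<oplus>\<^bsub>S\<^esub> w) = \<psi>0 z \<oplus>\<^bsub>S\<^esub> \<psi>0 w" if z: "z \<in> carrier S" and w: "w \<in> carrier S" for z w
  proof -
    obtain x t where x: "x \<in> carrier R" "t \<in> carrier R - P" "j (frob e t) \<otimes>\<^bsub>S\<^esub> z = j x" using z by (rule q_fracE)
    obtain y v where y: "y \<in> carrier R" "v \<in> carrier R - P" "j (frob e v) \<otimes>\<^bsub>S\<^esub> w = j y" using w by (rule q_fracE)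
    have c: "t \<in> carrier R" "v \<in> carrier R" "\<phi> x \<in> carrier R" "\<phi> y \<in> carrier R" using x y \<phi> by auto
    have tv: "t \<otimes> v \<in> carrier R - P" using denom_mult x y by blast
    have "j (frob e (t \<otimes> v)) \<otimes>\<^bsub>S\<^esub> (z \<oplus>\<^bsub>S\<^esub> w)
        = j (frob e v) \<otimes>\<^bsub>S\<^esub> (j (frob e t) \<otimes>\<^bsub>S\<^esub> z) \<oplus>\<^bsub>S\<^esub> j (frob e t) \<otimes>\<^bsub>S\<^esub> (j (frob e v) \<otimes>\<^bsub>S\<^esub> w)"
      using c z w by (simp add: frob_mult loc.j_mult loc.S.r_distr loc.S.l_distr loc.S.m_ac)
    also have "\<dots> = j (frob e v \<otimes> x \<oplus> frob e t \<otimes> y)" unfolding x(3) y(3) using c x(1) y(1) by (simp add: loc.j_mult loc.j_add)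
    finally have "j (s \<otimes> (t \<otimes> v)) \<otimes>\<^bsub>S\<^esub> \<psi>0 (z \<oplus>\<^bsub>S\<^esub> w) = j (\<phi> (frob e v \<otimes> x \<oplus> frob e t \<otimes> y))"
      using z w c x(1) y(1) tv by (intro \<psi>0) auto
    also have "\<phi> (frob e v \<otimes> x \<oplus> frob e t \<otimes> y) = v \<otimes> \<phi> x \<oplus> t \<otimes> \<phi> y"
      using D_add[OF \<phi>] D_smult[OF \<phi>] c x(1) y(1) by simp
    also have "j \<dots> = j v \<otimes>\<^bsub>S\<^esub> j (\<phi> x) \<oplus>\<^bsub>S\<^esub> j t \<otimes>\<^bsub>S\<^esub> j (\<phi> y)" using c by (simp add: loc.j_mult loc.j_add)
    also have "\<dots> = j (s \<otimes> (t \<otimes> v)) \<otimes>\<^bsub>S\<^esub> (\<psi>0 z \<oplus>\<^bsub>S\<^esub> \<psi>0 w)"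
      unfolding \<psi>0[OF z x, symmetric] \<psi>0[OF w y, symmetric] using c sc \<psi>0c z w
      by (simp add: loc.j_mult loc.S.r_distr loc.S.m_ac)
    finally show ?thesis using loc.j_cancel[OF denom_mult[OF s tv]] z w \<psi>0c by simp
  qed
  have smult: "\<psi>0 (S.frob e r \<otimes>\<^bsub>S\<^esub> z) = r \<otimes>\<^bsub>S\<^esub> \<psi>0 z" if r: "r \<in> carrier S" and z: "z \<in> carrier S" for r z
  proof -
    obtain x t where x: "x \<in> carrier R" "t \<in> carrier R - P" "j (frob e t) \<otimes>\<^bsub>S\<^esub> z = j x" using z by (rule q_fracE)
    obtain y v where "loc.frac r y v" using r by (rule loc.fracE)
    then have y: "y \<in> carrier R" "v \<in> carrier R - P" "j v \<otimes>\<^bsub>S\<^esub> r = j y" by (auto simp: loc.frac_def)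
    have c: "t \<in> carrier R" "v \<in> carrier R" "\<phi> x \<in> carrier R" using x y \<phi> by auto
    have tv: "t \<otimes> v \<in> carrier R - P" using denom_mult x y by blast
    have "j (frob e (t \<otimes> v)) \<otimes>\<^bsub>S\<^esub> (S.frob e r \<otimes>\<^bsub>S\<^esub> z) = S.frob e (j v \<otimes>\<^bsub>S\<^esub> r) \<otimes>\<^bsub>S\<^esub> (j (frob e t) \<otimes>\<^bsub>S\<^esub> z)"
      using c z r by (simp add: frob_mult j_frob loc.j_mult S.frob_mult loc.S.m_ac)
    also have "\<dots> = j (frob e y \<otimes> x)" unfolding x(3) y(3) using x(1) y(1) by (simp add: j_frob loc.j_mult)
    finally have "j (s \<otimes> (t \<otimes> v)) \<otimes>\<^bsub>S\<^esub> \<psi>0 (S.frob e r \<otimes>\<^bsub>S\<^esub> z) = j (\<phi> (frob e y \<otimes> x))"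
      using z r c x(1) y(1) tv by (intro \<psi>0) auto
    also have "\<dots> = j y \<otimes>\<^bsub>S\<^esub> j (\<phi> x)" using D_smult[OF \<phi>] c x(1) y(1) by (simp add: loc.j_mult)
    also have "\<dots> = j (s \<otimes> (t \<otimes> v)) \<otimes>\<^bsub>S\<^esub> (r \<otimes>\<^bsub>S\<^esub> \<psi>0 z)"
      unfolding y(3)[symmetric] \<psi>0[OF z x, symmetric] using c sc \<psi>0c z r by (simp add: loc.j_mult loc.S.m_ac)
    finally show ?thesis using loc.j_cancel[OF denom_mult[OF s tv]] z r \<psi>0c by simp
  qed
  have hom: "\<psi> \<in> cartier_hom S (p ^ e)"
    using \<psi>0c add smult by (intro S.cartier_homI) (auto simp: \<psi>_def)
  have val: "j s \<otimes>\<^bsub>S\<^esub> \<psi> (j x) = j (\<phi> x)" if x: "x \<in> carrier R" for x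
    using \<psi>0[of "j x" x \<one>] x denom_one sc by (simp add: \<psi>_def)
  have "\<psi> (j x) = lf (\<phi> x) s" if x: "x \<in> carrier R" for x
  proof (rule loc.j_cancel[OF s])
    show "j s \<otimes>\<^bsub>S\<^esub> \<psi> (j x) = j s \<otimes>\<^bsub>S\<^esub> lf (\<phi> x) s"
      using val[OF x] frac_loc_frac[OF D_closed[OF \<phi> x] s] by (simp add: loc.frac_def)
    show "\<psi> (j x) \<in> carrier S" using S.cartier_hom_closed[OF hom] x by simp
    show "lf (\<phi> x) s \<in> carrier S" using D_closed[OF \<phi> x] s by blast
  qed
  then have "\<psi> \<in> E (p ^ e)" unfolding cartier_localization_def using hom \<phi> s by blast
  then show ?thesis using that val by blast
qed

lemma E_subset: "E q \<subseteq> cartier_hom S q"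
  by (auto simp: cartier_localization_def)

text \<open>Clearing denominators in functionals and vectors gives pairs over R whose off-diagonal
  values are zero, while the diagonal values are products of denominators and so lie outside
  P.\<close>

lemma summands_le_split_rank:
  assumes dec: "direct_sum_decomp S (frob_push S (p ^ e)) n N"
  shows "card {i. i < n \<and> is_E_summand S E (p ^ e) n N i} \<le> split_rank e P"
proof -
  let ?I = "{i. i < n \<and> is_E_summand S E (p ^ e) n N i}"
  obtain \<psi> z where \<psi>: "\<And>i. i \<in> ?I \<Longrightarrow> \<psi> i \<in> E (p ^ e)" and z: "\<And>i. i \<in> ?I \<Longrightarrow> z i \<in> carrier S"
    and dual: "\<And>i k. i \<in> ?I \<Longrightarrow> k \<in> ?I \<Longrightarrow> \<psi> i (z k) = (if i = k then \<one>\<^bsub>S\<^esub> else \<zero>\<^bsub>S\<^esub>)"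
  proof -
    have "\<exists>\<psi> z. \<forall>i\<in>?I. \<psi> i \<in> E (p ^ e) \<and> z i \<in> carrier S \<and>
        (\<forall>k\<in>?I. \<psi> i (z k) = (if i = k then \<one>\<^bsub>S\<^esub> else \<zero>\<^bsub>S\<^esub>))"
      by (rule S.dual_of_summands[where E = E, OF dec E_subset]) simp
    then show ?thesis using that by blast
  qed
  have "\<forall>i\<in>?I. \<exists>f. fst f \<in> D (p ^ e) \<and> snd f \<in> carrier R - P \<and>
      (\<forall>x t z. x \<in> carrier R \<and> t \<in> carrier R - P \<and> z \<in> carrier S \<and> j (frob e t) \<otimes>\<^bsub>S\<^esub> z = j x \<longrightarrow>
      j (snd f \<otimes> t) \<otimes>\<^bsub>S\<^esub> \<psi> i z = j (fst f x))"
  proof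
    fix i assume "i \<in> ?I"
    from \<psi>[OF this] show "\<exists>f. fst f \<in> D (p ^ e) \<and> snd f \<in> carrier R - P \<and>
      (\<forall>x t z. x \<in> carrier R \<and> t \<in> carrier R - P \<and> z \<in> carrier S \<and> j (frob e t) \<otimes>\<^bsub>S\<^esub> z = j x \<longrightarrow>
      j (snd f \<otimes> t) \<otimes>\<^bsub>S\<^esub> \<psi> i z = j (fst f x))"
    proof (rule E_dest)
      fix \<phi> s assume *: "\<phi> \<in> D (p ^ e)" "s \<in> carrier R - P"
        "\<And>x t z. x \<in> carrier R \<Longrightarrow> t \<in> carrier R - P \<Longrightarrow> z \<in> carrier S \<Longrightarrow> j (frob e t) \<otimes>\<^bsub>S\<^esub> z = j x \<Longrightarrow>
          j (s \<otimes> t) \<otimes>\<^bsub>S\<^esub> \<psi> i z = j (\<phi> x)"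
      show ?thesis by (rule exI[of _ "(\<phi>, s)"]) (use * in auto)
    qed
  qed
  from bchoice[OF this] obtain f where f: "\<forall>i\<in>?I. fst (f i) \<in> D (p ^ e) \<and> snd (f i) \<in> carrier R - P \<and>
      (\<forall>x t z. x \<in> carrier R \<and> t \<in> carrier R - P \<and> z \<in> carrier S \<and> j (frob e t) \<otimes>\<^bsub>S\<^esub> z = j x \<longrightarrow>
      j (snd (f i) \<otimes> t) \<otimes>\<^bsub>S\<^esub> \<psi> i z = j (fst (f i) x))" ..
  have "\<forall>i\<in>?I. \<exists>g. fst g \<in> carrier R \<and> snd g \<in> carrier R - P \<and> j (frob e (snd g)) \<otimes>\<^bsub>S\<^esub> z i = j (fst g)"
  proof
    fix i assume "i \<in> ?I"
    from z[OF this] show "\<exists>g. fst g \<in> carrier R \<and> snd g \<in> carrier R - P \<and> j (frob e (snd g)) \<otimes>\<^bsub>S\<^esub> z i = j (fst g)"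
    proof (rule q_fracE[of _ e])
      fix x t assume "x \<in> carrier R" "t \<in> carrier R - P" "j (frob e t) \<otimes>\<^bsub>S\<^esub> z i = j x"
      then show ?thesis by (intro exI[of _ "(x, t)"]) simp
    qed
  qed
  from bchoice[OF this] obtain g where g: "\<forall>i\<in>?I. fst (g i) \<in> carrier R \<and> snd (g i) \<in> carrier R - P \<and>
      j (frob e (snd (g i))) \<otimes>\<^bsub>S\<^esub> z i = j (fst (g i))" ..
  define \<phi> x where "\<phi> = (\<lambda>i. fst (f i))" and "x = (\<lambda>i. fst (g i))"
  have \<phi>: "\<phi> i \<in> D (p ^ e)" if "i \<in> ?I" for i using f that by (simp add: \<phi>_def)
  have x: "x i \<in> carrier R" if "i \<in> ?I" for i using g that by (simp add: x_def)
  have st: "snd (f i) \<otimes> snd (g k) \<in> carrier R - P" if "i \<in> ?I" "k \<in> ?I" for i k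
    using bspec[OF f that(1)] bspec[OF g that(2)] by (intro denom_mult) simp_all
  have val: "j (snd (f i) \<otimes> snd (g k)) \<otimes>\<^bsub>S\<^esub> \<psi> i (z k) = j (\<phi> i (x k))" if "i \<in> ?I" "k \<in> ?I" for i k
    using bspec[OF f that(1)] bspec[OF g that(2)] z[OF that(2)] unfolding \<phi>_def x_def by blast
  have off: "\<phi> i (x k) = \<zero>" if "i \<in> ?I" "k \<in> ?I" "i \<noteq> k" for i k
  proof -
    have "j (\<phi> i (x k)) = j \<zero>" using val[OF that(1,2)] dual[OF that(1,2)] that(3) st[OF that(1,2)] by simp
    then show ?thesis using loc.j_eq_iff[OF D_closed[OF \<phi>[OF that(1)] x[OF that(2)]] zero_closed] by blast
  qed
  have diag: "\<phi> i (x i) \<notin> P" if "i \<in> ?I" for i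
  proof -
    have "j (\<phi> i (x i)) = j (snd (f i) \<otimes> snd (g i))" using val[OF that that] dual[OF that that] st[OF that that] by simp
    then have "\<phi> i (x i) = snd (f i) \<otimes> snd (g i)" using loc.j_eq_iff D_closed[OF \<phi> x] that st[OF that that] by simp
    then show ?thesis using st[OF that that] by simp
  qed
  have "finite ?I" by simp
  \<comment> \<open>\<open>dual_le_split_rank\<close> takes an initial segment of the natural
    numbers as index set.\<close>
  then obtain h where h: "bij_betw h {0..<card ?I} ?I" using ex_bij_betw_nat_finite by blast
  have hI: "h i \<in> ?I" if "i < card ?I" for i using bij_betwE[OF h] that by simp
  have hn: "h i \<noteq> h k" if "i < card ?I" "k < card ?I" "i \<noteq> k" for i k
    using bij_betw_imp_inj_on[OF h] that by (auto dest: inj_onD)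
  show ?thesis
  proof (rule dual_le_split_rank[OF prime, of _ "\<lambda>i. \<phi> (h i)" e "\<lambda>i. x (h i)"])
    show "\<phi> (h i) \<in> D (p ^ e)" if "i < card ?I" for i using \<phi>[OF hI[OF that]] .
    show "x (h i) \<in> carrier R" if "i < card ?I" for i using x[OF hI[OF that]] .
    show "\<phi> (h i) (x (h k)) = \<zero>" if "i < card ?I" "k < card ?I" "i \<noteq> k" for i k
      using off[OF hI[OF that(1)] hI[OF that(2)] hn[OF that]] .
    show "\<phi> (h i) (x (h i)) \<notin> P" if "i < card ?I" for i using diag[OF hI[OF that]] .
  qed
qed

text \<open>Dividing the functionals of a splitting system by s, which is a unit at P, turns the
  diagonal value into 1.\<close>

lemma summands_ge_split_rank:
  "\<exists>n N. direct_sum_decomp S (frob_push S (p ^ e)) n N \<and>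
     split_rank e P \<le> card {i. i < n \<and> is_E_summand S E (p ^ e) n N i}"
proof -
  obtain \<phi> x s where sys: "split_system e (split_rank e P) \<phi> x s" "s \<notin> P" by (rule split_system_exists[OF prime])
  then have s: "s \<in> carrier R - P" and \<phi>: "\<And>i. i < split_rank e P \<Longrightarrow> \<phi> i \<in> D (p ^ e)"
    and x: "\<And>i. i < split_rank e P \<Longrightarrow> x i \<in> carrier R"
    and dual: "\<And>i k. i < split_rank e P \<Longrightarrow> k < split_rank e P \<Longrightarrow> \<phi> i (x k) = (if i = k then s else \<zero>)"
    by (auto simp: split_system_def)
  have sc: "s \<in> carrier R" using s by simp
  have "\<forall>i\<in>{..<split_rank e P}. \<exists>\<psi>. \<psi> \<in> E (p ^ e) \<and> (\<forall>y\<in>carrier R. j s \<otimes>\<^bsub>S\<^esub> \<psi> (j y) = j (\<phi> i y))"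
  proof
    fix i assume "i \<in> {..<split_rank e P}"
    then have "\<phi> i \<in> D (p ^ e)" using \<phi> by simp
    from this s show "\<exists>\<psi>. \<psi> \<in> E (p ^ e) \<and> (\<forall>y\<in>carrier R. j s \<otimes>\<^bsub>S\<^esub> \<psi> (j y) = j (\<phi> i y))"
      by (rule E_exists) blast
  qed
  from bchoice[OF this] obtain \<psi> where \<psi>: "\<forall>i\<in>{..<split_rank e P}. \<psi> i \<in> E (p ^ e) \<and> (\<forall>y\<in>carrier R. j s \<otimes>\<^bsub>S\<^esub> \<psi> i (j y) = j (\<phi> i y))" ..
  show ?thesis
  proof (rule S.summands_of_dual[where E = E and \<psi> = \<psi> and x = "\<lambda>i. j (x i)", OF E_subset])
    show "\<psi> i \<in> E (p ^ e)" if "i < split_rank e P" for i using \<psi> that by simp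
    show "j (x i) \<in> carrier S" if "i < split_rank e P" for i using x[OF that] by simp
    fix i k assume i: "i < split_rank e P" and k: "k < split_rank e P"
    have h: "\<psi> i \<in> cartier_hom S (p ^ e)" using \<psi> i E_subset by blast
    show "\<psi> i (j (x k)) = (if i = k then \<one>\<^bsub>S\<^esub> else \<zero>\<^bsub>S\<^esub>)"
    proof (rule loc.j_cancel[OF s])
      show "\<psi> i (j (x k)) \<in> carrier S" using S.cartier_hom_closed[OF h] x[OF k] by simp
      have "j s \<otimes>\<^bsub>S\<^esub> \<psi> i (j (x k)) = j (\<phi> i (x k))" using \<psi> i x[OF k] by simp
      then show "j s \<otimes>\<^bsub>S\<^esub> \<psi> i (j (x k)) = j s \<otimes>\<^bsub>S\<^esub> (if i = k then \<one>\<^bsub>S\<^esub> else \<zero>\<^bsub>S\<^esub>)"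
        using dual[OF i k] sc by simp
    qed simp
  qed
qed

lemma splitting_number_eq_split_rank: "splitting_number S E (p ^ e) = split_rank e P"
  unfolding splitting_number_def
proof (rule Max_eqI)
  let ?C = "{card {i. i < n \<and> is_E_summand S E (p ^ e) n M i} | n M. direct_sum_decomp S (frob_push S (p ^ e)) n M}"
  have le: "c \<le> split_rank e P" if "c \<in> ?C" for c using that summands_le_split_rank by auto
  then show "finite ?C" by (intro finite_subset[of ?C "{..split_rank e P}"]) auto
  show "c \<le> split_rank e P" if "c \<in> ?C" for c using le[OF that] .
  obtain n N where N: "direct_sum_decomp S (frob_push S (p ^ e)) n N"
     "split_rank e P \<le> card {i. i < n \<and> is_E_summand S E (p ^ e) n N i}" using summands_ge_split_rank by blast
  then have "split_rank e P = card {i. i < n \<and> is_E_summand S E (p ^ e) n N i}" using summands_le_split_rank[OF N(1)] by simp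
  then show "split_rank e P \<in> ?C" using N(1) by blast
qed

text \<open>By definition of \<open>alpha\<close>, p to the power \<alpha>(P) is
  \<open>fdeg P\<close>, and by \<open>ht_fdeg\<close> p to the power of the height is the remaining
  factor of \<open>rk\<close>. The normalization of s_q is therefore the same at all primes.\<close>

lemma powr_alpha_ht:
  "real (p ^ e) powr (alpha p S + real (the_enat (ht R P))) = real rk ^ e"
proof -
  obtain u c where u: "independent_mod 1 P P u (fdeg P)" and c: "c \<in> carrier R - P"
    "\<And>x. x \<in> carrier R \<Longrightarrow> frob 1 c \<otimes> x \<in> comb_span 1 u (fdeg P) (\<lambda>_. carrier R) P"
    by (rule fdeg_basis[OF prime]) blast
  have sp: "sat P 1 (comb_span 1 u (fdeg P) (\<lambda>_. carrier R) P) = carrier R"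
    using satI[OF _ c(1) c(2)] by (auto simp: sat_def)
  have "ring.dim (residue_field S) ((\<lambda>x. x [^]\<^bsub>residue_field S\<^esub> p) ` carrier (residue_field S)) (carrier (residue_field S)) = fdeg P"
    by (rule dim_residue_field[OF prime loc.residue_field_map u sp])
  then have "alpha p S = log (real p) (real (fdeg P))" by (simp add: alpha_def Let_def)
  moreover have p: "1 < real p" using prime_gt_1_nat[OF prime_p] by simp
  ultimately have \<alpha>: "real p powr alpha p S = real (fdeg P)" using fdeg_pos[OF prime] by simp
  obtain n where n: "ht R P = enat n" "rk = p ^ n * fdeg P" by (rule ht_fdeg[OF prime])
  have "real p powr (alpha p S + real n) = real rk"
    unfolding powr_add \<alpha> n(2) using p by (simp add: powr_realpow)
  then have "(real p powr (alpha p S + real n)) ^ e = real rk ^ e" by simp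
  moreover have "real (p ^ e) powr (alpha p S + real n) = (real p powr (alpha p S + real n)) ^ e"
    using p by (simp add: powr_power powr_powr flip: powr_realpow) (simp add: mult.commute)
  ultimately show ?thesis using n(1) by simp
qed

lemma splitting_semigroup_eq: "splitting_semigroup p S E = (\<lambda>e. p ^ e) ` {e. 0 < split_rank e P}"
  by (auto simp: splitting_semigroup_def ppowers_def splitting_number_eq_split_rank)

lemma s_q_at_eq: "s_q_at p R D (p ^ e) P = real (split_rank e P) / real rk ^ e"
  unfolding s_q_at_def a_at_def powr_alpha_ht splitting_number_eq_split_rank ..

lemma s_at_eq:
  "s_at p R D P = (if {e. 0 < split_rank e P} = {0} then 0 else
     Lim (inf at_top (principal ((\<lambda>e. p ^ e) ` {e. 0 < split_rank e P}))) (\<lambda>q. s_q_at p R D q P))"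
proof -
  have "(\<lambda>e. p ^ e) ` {e. 0 < split_rank e P} = {1} \<longleftrightarrow> {e. 0 < split_rank e P} = {0}"
  proof
    assume "(\<lambda>e. p ^ e) ` {e. 0 < split_rank e P} = {1}"
    then have "p ^ e = 1" if "0 < split_rank e P" for e using that by blast
    then have "e = 0" if "0 < split_rank e P" for e using that prime_gt_1_nat[OF prime_p] by (metis nat_power_eq_Suc_0_iff One_nat_def less_irrefl)
    then show "{e. 0 < split_rank e P} = {0}" using split_rank_0[OF prime] by blast
  qed simp
  then show ?thesis
    unfolding s_at_def F_signature_def splitting_semigroup_eq loc.krull_dim_eq_ht s_q_at_def a_at_def by simp
qed

text \<open>The hypothesis speaks of ideals of the localization, the estimates of their preimages in
  R. Elements x pass to x/1, and maps \<phi> in D pass to \<phi>/1 by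
  \<open>E_exists\<close>.\<close>

lemma split_ideal_frobenius_of_hyp:
  assumes hyp: "frobenius_power p S (splitting_ideal R D (p ^ e) P) \<subseteq> splitting_ideal R D (p ^ e * p) P"
    and x: "x \<in> split_ideal e P"
  shows "frob 1 x \<in> split_ideal (Suc e) P"
proof -
  have xc: "x \<in> carrier R" using x by (simp add: split_ideal_def)
  have "j x \<in> splitting_ideal R D (p ^ e) P"
    unfolding splitting_ideal_def
  proof (intro CollectI conjI ballI)
    show "j x \<in> carrier S" using xc by simp
    fix \<psi> assume "\<psi> \<in> E (p ^ e)"
    then obtain \<phi> s where \<phi>: "\<phi> \<in> D (p ^ e)" "s \<in> carrier R - P" "\<psi> (j x) = lf (\<phi> x) s"
      unfolding cartier_localization_def using xc by blast
    then show "\<psi> (j x) \<in> extended_prime R P"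
      using x mem_extended_prime[OF D_closed[OF \<phi>(1) xc] \<phi>(2)] by (auto simp: split_ideal_def)
  qed
  moreover have sub: "splitting_ideal R D (p ^ e) P \<subseteq> carrier S" by (auto simp: splitting_ideal_def)
  ultimately have "j x [^]\<^bsub>S\<^esub> p \<in> frobenius_power p S (splitting_ideal R D (p ^ e) P)"
    unfolding frobenius_power_def using loc.S.genideal_self[of "(\<lambda>x. x [^]\<^bsub>S\<^esub> p) ` splitting_ideal R D (p ^ e) P"] by blast
  moreover have "j x [^]\<^bsub>S\<^esub> p = j (frob 1 x)" using j_frob[OF xc, of 1] by (simp add: S.frob_def)
  ultimately have mem: "j (frob 1 x) \<in> splitting_ideal R D (p ^ Suc e) P" using hyp by (auto simp: mult.commute)
  have fc: "frob 1 x \<in> carrier R" using xc by simp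
  have "\<phi> (frob 1 x) \<in> P" if \<phi>: "\<phi> \<in> D (p ^ Suc e)" for \<phi>
  proof -
    obtain \<psi> where \<psi>: "\<psi> \<in> E (p ^ Suc e)" "\<And>y. y \<in> carrier R \<Longrightarrow> j \<one> \<otimes>\<^bsub>S\<^esub> \<psi> (j y) = j (\<phi> y)"
      by (rule E_exists[OF \<phi> denom_one]) blast
    have h: "\<psi> \<in> cartier_hom S (p ^ Suc e)" using \<psi>(1) E_subset by blast
    have "\<psi> (j (frob 1 x)) \<in> carrier S" by (rule S.cartier_hom_closed[OF h loc.j_closed[OF fc]])
    then have "\<psi> (j (frob 1 x)) = j (\<phi> (frob 1 x))" using \<psi>(2)[OF fc] by simp
    moreover have "\<psi> (j (frob 1 x)) \<in> extended_prime R P" using mem \<psi>(1) by (simp add: splitting_ideal_def)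
    ultimately show ?thesis using mem_extended_prime[OF D_closed[OF \<phi> fc] denom_one] by simp
  qed
  then show ?thesis using fc by (simp add: split_ideal_def)
qed

end


section \<open>The F-signature function\<close>

lemma inf_at_top_principal_nontrivial:
  fixes E :: "nat set"
  assumes "infinite E" shows "inf at_top (principal E) \<noteq> bot"
proof
  assume "inf at_top (principal E) = bot"
  then have "eventually (\<lambda>_. False) (inf at_top (principal E))" by simp
  then obtain N where "\<And>n. N \<le> n \<Longrightarrow> n \<notin> E"
    unfolding eventually_inf_principal eventually_at_top_linorder by auto
  then have "E \<subseteq> {..N}" by (meson atMost_iff nat_le_linear subsetI)
  then show False using assms finite_subset by blast
qed

lemma infinite_multiples:
  fixes E :: "nat set"
  assumes "0 \<in> E" "\<And>d e. d \<in> E \<Longrightarrow> e \<in> E \<Longrightarrow> d + e \<in> E" "d \<in> E" "0 < d"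
  shows "infinite E"
proof -
  have "range (\<lambda>m. m * d) \<subseteq> E" using semigroup_mult_closed[OF assms(1-3)] by auto
  moreover have "infinite (range (\<lambda>m. m * d))" using assms(4) by (intro range_inj_infinite injI) simp
  ultimately show ?thesis using infinite_super by blast
qed

context cartier_domain
begin

lemma at_prime: "Q \<in> Spec R \<Longrightarrow> cartier_at_prime R p D Q"
  by (intro cartier_at_prime.intro cartier_domain_axioms domain_at_prime.intro domain_axioms
    domain_at_prime_axioms.intro) (simp add: Spec_def)

definition split_rank_ratio :: "nat \<Rightarrow> 'a set \<Rightarrow> real" where
  "split_rank_ratio e Q = real (split_rank e Q) / real rk ^ e"

lemma zero_in_Spec: "{\<zero>} \<in> Spec R"
  using zeroprimeideal by (simp add: Spec_def)

lemma exps_eq: "{e. 0 < split_rank e {\<zero>}} = exps"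
  using split_rank_pos_exps[OF zeroprimeideal] split_rank_zero_exps rk_pos by auto

lemma splitting_semigroup_domain_eq: "splitting_semigroup_domain p R D = (\<lambda>e. p ^ e) ` exps"
  unfolding splitting_semigroup_domain_def cartier_at_prime.splitting_semigroup_eq[OF at_prime[OF zero_in_Spec]] exps_eq ..

lemma zero_exps: "0 \<in> exps"
  using split_rank_0[OF zeroprimeideal] exps_eq by auto

lemma split_rank_ratio_le_1: "Q \<in> Spec R \<Longrightarrow> split_rank_ratio e Q \<le> 1"
  using split_rank_le_rk[of Q e] rk_pos unfolding split_rank_ratio_def Spec_def
  by (simp add: divide_le_eq flip: of_nat_power)

lemma split_rank_ratio_lower:
  assumes "d \<in> exps"
  shows "\<exists>C\<ge>0. \<forall>Q\<in>Spec R. \<forall>e. split_rank_ratio e Q \<le> split_rank_ratio (e + d) Q + C / real (p ^ e)"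
proof -
  obtain C where C: "0 \<le> C" "\<And>P e. primeideal P R \<Longrightarrow>
    real rk ^ d * real (split_rank e P) \<le> real (split_rank (e + d) P) + C * (real rk / real p) ^ e"
    using split_rank_lower[OF assms] by blast
  have r: "0 < real rk" using rk_pos by simp
  have "split_rank_ratio e Q \<le> split_rank_ratio (e + d) Q + (C / real rk ^ d) / real (p ^ e)" if Q: "Q \<in> Spec R" for e Q
  proof -
    have "split_rank_ratio e Q = (real rk ^ d * real (split_rank e Q)) / real rk ^ (e + d)"
      using r by (simp add: split_rank_ratio_def power_add)
    also have "\<dots> \<le> (real (split_rank (e + d) Q) + C * (real rk / real p) ^ e) / real rk ^ (e + d)"
      using C(2)[of Q e] Q r by (intro divide_right_mono) (auto simp: Spec_def)
    also have "\<dots> = split_rank_ratio (e + d) Q + (C / real rk ^ d) / real (p ^ e)"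
      using r by (simp add: split_rank_ratio_def add_divide_distrib power_add power_divide)
    finally show ?thesis .
  qed
  then show ?thesis using C(1) r by (intro exI[of _ "C / real rk ^ d"]) auto
qed

lemma s_at_trivial:
  assumes "exps = {0}" "Q \<in> Spec R" shows "s_at p R D Q = 0"
proof -
  have Qp: "primeideal Q R" using assms(2) by (simp add: Spec_def)
  have "{e. 0 < split_rank e Q} = {0}" using split_rank_pos_exps[OF Qp] split_rank_0[OF Qp] assms(1) by auto
  then show ?thesis using cartier_at_prime.s_at_eq[OF at_prime[OF assms(2)]] by simp
qed

text \<open>The signature at Q is a limit along the exponents with nonzero splitting number at Q, a
  subset of \<open>exps\<close>. If this subset is {0}, the ratios vanish for e \<ge> 1 and the
  limit along \<open>exps\<close> is 0, in accordance with the convention; otherwise the subset is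
  infinite and restricting to it keeps the limit.\<close>

lemma s_at_limit:
  assumes Q: "Q \<in> Spec R" and d0: "d0 \<in> exps" "0 < d0"
    and lim: "((\<lambda>e. split_rank_ratio e Q) \<longlongrightarrow> l) (inf at_top (principal exps))"
  shows "s_at p R D Q = l"
proof -
  interpret Q: cartier_at_prime R p D Q by (rule at_prime[OF Q])
  let ?G = "{e. 0 < split_rank e Q}"
  have G: "?G \<subseteq> exps" using split_rank_pos_exps[OF Q.prime] by auto
  have G0: "0 \<in> ?G" using split_rank_0[OF Q.prime] by simp
  show ?thesis
  proof (cases "?G = {0}")
    case True
    have "split_rank_ratio e Q = 0" if "1 \<le> e" for e
    proof -
      have "e \<notin> ?G" using True that by simp
      then show ?thesis by (simp add: split_rank_ratio_def)
    qed
    then have "\<forall>\<^sub>F e in inf at_top (principal exps). split_rank_ratio e Q = 0"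
      unfolding eventually_inf_principal eventually_at_top_linorder by blast
    then have "((\<lambda>e. split_rank_ratio e Q) \<longlongrightarrow> 0) (inf at_top (principal exps))" by (rule tendsto_eventually)
    moreover have "inf at_top (principal exps) \<noteq> bot"
      using infinite_multiples[OF zero_exps exps_add d0] by (intro inf_at_top_principal_nontrivial)
    ultimately have "l = 0" using lim tendsto_unique by blast
    then show ?thesis using Q.s_at_eq True by simp
  next
    case False
    then obtain e1 where e1: "e1 \<in> ?G" "0 < e1" using G0 by blast
    have inf: "infinite ?G"
      using split_rank_pos_add[OF Q.prime] by (intro infinite_multiples[OF G0 _ e1]) auto
    let ?F = "inf at_top (principal ((\<lambda>e. p ^ e) ` ?G))"
    have p1: "1 < p" using prime_gt_1_nat[OF prime_p] .
    have "((\<lambda>e. split_rank_ratio e Q) \<longlongrightarrow> l) (inf at_top (principal ?G))"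
      by (rule tendsto_mono[OF _ lim]) (use G in \<open>intro inf_mono order_refl, simp\<close>)
    have "((\<lambda>q. s_q_at p R D q Q) \<longlongrightarrow> l) ?F"
    proof (rule topological_tendstoI)
      fix V assume "open V" "l \<in> V"
      then have "\<forall>\<^sub>F e in inf at_top (principal ?G). split_rank_ratio e Q \<in> V"
        using \<open>((\<lambda>e. split_rank_ratio e Q) \<longlongrightarrow> l) (inf at_top (principal ?G))\<close> by (auto dest: topological_tendstoD)
      then have "\<forall>\<^sub>F e in inf at_top (principal ?G). s_q_at p R D (p ^ e) Q \<in> V"
        by (simp add: Q.s_q_at_eq split_rank_ratio_def)
      then show "\<forall>\<^sub>F q in ?F. s_q_at p R D q Q \<in> V"
        by (rule eventually_ppowers[OF p1])
    qed
    moreover have "?F \<noteq> bot"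
    proof (rule inf_at_top_principal_nontrivial)
      have "inj_on (\<lambda>e. p ^ e) ?G" using p1 by (intro inj_onI) simp
      then show "infinite ((\<lambda>e. p ^ e) ` ?G)" using inf finite_imageD by blast
    qed
    ultimately have "Lim ?F (\<lambda>q. s_q_at p R D q Q) = l" by (intro tendsto_Lim)
    then show ?thesis using Q.s_at_eq False by simp
  qed
qed

lemma split_rank_ratio_limit:
  assumes d0: "d0 \<in> exps" "0 < d0"
  obtains C where "0 \<le> C"
    "\<And>e Q. Q \<in> Spec R \<Longrightarrow> e \<in> exps \<Longrightarrow> split_rank_ratio e Q \<le> s_at p R D Q + C / real (p ^ e)"
    "\<And>Q. Q \<in> Spec R \<Longrightarrow> ((\<lambda>e. split_rank_ratio e Q) \<longlongrightarrow> s_at p R D Q) (inf at_top (principal exps))"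
proof -
  show ?thesis
  proof (rule semigroup_limit[where s = split_rank_ratio and A = "Spec R" and E = exps and p = p])
    show "2 \<le> p" using prime_ge_2_nat[OF prime_p] .
    fix C l assume C: "0 \<le> C" "\<And>e Q. Q \<in> Spec R \<Longrightarrow> e \<in> exps \<Longrightarrow> split_rank_ratio e Q \<le> l Q + C / real (p ^ e)"
      and l: "\<And>Q. Q \<in> Spec R \<Longrightarrow> ((\<lambda>e. split_rank_ratio e Q) \<longlongrightarrow> l Q) (inf at_top (principal exps))"
    have "s_at p R D Q = l Q" if "Q \<in> Spec R" for Q using s_at_limit[OF that d0 l[OF that]] .
    then show thesis using C l by (intro that[of C]) auto
  qed (use zero_exps exps_add d0 split_rank_ratio_lower split_rank_ratio_le_1 in auto)
qed

lemma lower_semicontinuous_s_at: "lower_semicontinuous (zariski R) (s_at p R D)"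
  unfolding lower_semicontinuous_def topspace_zariski[OF is_cring]
proof
  fix r
  show "openin (zariski R) {Q \<in> Spec R. r < s_at p R D Q}"
  proof (cases "exps = {0}")
    case True
    then have "{Q \<in> Spec R. r < s_at p R D Q} = (if r < 0 then Spec R else {})"
      using s_at_trivial by auto
    moreover have "openin (zariski R) (Spec R)"
      using openin_topspace[of "zariski R"] topspace_zariski[OF is_cring] by simp
    ultimately show ?thesis by simp
  next
    case False
    then obtain d0 where d0: "d0 \<in> exps" "0 < d0" using zero_exps by blast
    obtain C where C: "0 \<le> C"
      "\<And>e Q. Q \<in> Spec R \<Longrightarrow> e \<in> exps \<Longrightarrow> split_rank_ratio e Q \<le> s_at p R D Q + C / real (p ^ e)"
      "\<And>Q. Q \<in> Spec R \<Longrightarrow> ((\<lambda>e. split_rank_ratio e Q) \<longlongrightarrow> s_at p R D Q) (inf at_top (principal exps))"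
      using split_rank_ratio_limit[OF d0] by blast
    have "\<exists>U. openin (zariski R) U \<and> Q \<in> U \<and> U \<subseteq> {Q \<in> Spec R. r < s_at p R D Q}"
      if Q: "Q \<in> Spec R" "r < s_at p R D Q" for Q
    proof -
      have "((\<lambda>e. C / real (p ^ e)) \<longlongrightarrow> 0) at_top"
        using tendsto_mult[OF tendsto_const[of C] LIMSEQ_realpow_zero[of "1 / real p"]] prime_gt_1_nat[OF prime_p]
        by (simp add: power_divide)
      then have "((\<lambda>e. C / real (p ^ e)) \<longlongrightarrow> 0) (inf at_top (principal exps))"
        by (rule tendsto_mono[rotated]) simp
      from tendsto_diff[OF C(3)[OF Q(1)] this]
      have "\<forall>\<^sub>F e in inf at_top (principal exps). r < split_rank_ratio e Q - C / real (p ^ e)"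
        using Q(2) by (intro order_tendstoD(1)) auto
      moreover have "\<forall>\<^sub>F e in inf at_top (principal exps). e \<in> exps"
        unfolding eventually_inf_principal by simp
      ultimately have "\<forall>\<^sub>F e in inf at_top (principal exps). e \<in> exps \<and> r < split_rank_ratio e Q - C / real (p ^ e)"
        by eventually_elim simp
      moreover have "inf at_top (principal exps) \<noteq> bot"
        using infinite_multiples[OF zero_exps exps_add d0] by (intro inf_at_top_principal_nontrivial)
      ultimately obtain e where e: "e \<in> exps" "r < split_rank_ratio e Q - C / real (p ^ e)"
        using eventually_happens' by blast
      \<comment> \<open>On this open set the ratio at e is at least the one at Q, and the lower
        bound for the signature has the same constant C at all primes, so the signature exceeds r
        throughout.\<close>
      let ?U = "{Q' \<in> Spec R. split_rank e Q \<le> split_rank e Q'}"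
      have "?U \<subseteq> {Q \<in> Spec R. r < s_at p R D Q}"
      proof
        fix Q' assume Q': "Q' \<in> ?U"
        then have "split_rank_ratio e Q \<le> split_rank_ratio e Q'"
          unfolding split_rank_ratio_def by (intro divide_right_mono) auto
        then have "r < s_at p R D Q'" using C(2)[of Q' e] Q' e by auto
        then show "Q' \<in> {Q \<in> Spec R. r < s_at p R D Q}" using Q' by simp
      qed
      then show ?thesis using openin_le_split_rank Q(1) by (intro exI[of _ ?U]) auto
    qed
    then show ?thesis by (subst openin_subopen) blast
  qed
qed

lemma uniform_limit_s_q_at:
  assumes hyp: "\<And>P e. P \<in> Spec R \<Longrightarrow>
    frobenius_power p (localization R P) (splitting_ideal R D (p ^ e) P) \<subseteq> splitting_ideal R D (p ^ e * p) P"
  shows "uniform_limit (Spec R) (s_q_at p R D) (s_at p R D)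
    (inf at_top (principal (splitting_semigroup_domain p R D)))"
proof (cases "exps = {0}")
  \<comment> \<open>The semigroup is {1}, so no q in it tends to infinity: the filter is trivial,
    and uniform convergence holds vacuously.\<close>
  case True
  have "\<forall>\<^sub>F q in inf at_top (principal {Suc 0}). False"
    unfolding eventually_inf_principal eventually_at_top_linorder by (intro exI[of _ 2]) auto
  then have "inf at_top (principal (splitting_semigroup_domain p R D)) = bot"
    unfolding splitting_semigroup_domain_eq True by (simp add: trivial_limit_def)
  then show ?thesis by (simp add: uniform_limit_iff)
next
  case False
  then obtain d0 where d0: "d0 \<in> exps" "0 < d0" using zero_exps by blast
  obtain C where C: "0 \<le> C"
    "\<And>e Q. Q \<in> Spec R \<Longrightarrow> e \<in> exps \<Longrightarrow> split_rank_ratio e Q \<le> s_at p R D Q + C / real (p ^ e)"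
    "\<And>Q. Q \<in> Spec R \<Longrightarrow> ((\<lambda>e. split_rank_ratio e Q) \<longlongrightarrow> s_at p R D Q) (inf at_top (principal exps))"
    using split_rank_ratio_limit[OF d0] by blast
  obtain C' where C': "0 \<le> C'" "\<And>P e. primeideal P R \<Longrightarrow> (\<And>x. x \<in> split_ideal e P \<Longrightarrow> frob 1 x \<in> split_ideal (Suc e) P) \<Longrightarrow>
    real (split_rank (Suc e) P) \<le> real rk * real (split_rank e P) + C' * (real rk / real p) ^ e"
    using split_rank_upper by blast
  have r: "0 < real rk" using rk_pos by simp
  have p2: "2 \<le> p" using prime_ge_2_nat[OF prime_p] .
  \<comment> \<open>This holds for every e and not only for those in \<open>exps\<close>, so
    \<open>upper\<close> can iterate it with step 1.\<close>
  have step: "split_rank_ratio (e + 1) Q \<le> split_rank_ratio e Q + (C' / real rk) / real (p ^ e)" if Q: "Q \<in> Spec R" for e Q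
  proof -
    interpret Q: cartier_at_prime R p D Q by (rule at_prime[OF Q])
    have "real (split_rank (Suc e) Q) \<le> real rk * real (split_rank e Q) + C' * (real rk / real p) ^ e"
      using Q.split_ideal_frobenius_of_hyp[OF hyp[OF Q]] by (intro C'(2) Q.prime) blast
    then have "split_rank_ratio (e + 1) Q \<le> (real rk * real (split_rank e Q) + C' * (real rk / real p) ^ e) / real rk ^ (e + 1)"
      unfolding split_rank_ratio_def by (intro divide_right_mono) auto
    also have "\<dots> = split_rank_ratio e Q + (C' / real rk) / real (p ^ e)"
      using r by (simp add: split_rank_ratio_def add_divide_distrib power_divide)
    finally show ?thesis .
  qed
  have upper: "s_at p R D Q \<le> split_rank_ratio e Q + 2 * (C' / real rk) / real (p ^ e)" if Q: "Q \<in> Spec R" for e Q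
  proof (rule tendsto_upperbound[OF C(3)[OF Q]])
    have "split_rank_ratio e' Q \<le> split_rank_ratio e Q + 2 * (C' / real rk) / real (p ^ e)" if "e \<le> e'" for e'
    proof -
      \<comment> \<open>The sign is changed because \<open>geometric_iterate\<close> is about
        sequences that increase up to an error, while the ratios here decrease up to one.\<close>
      have "- split_rank_ratio e Q \<le> - split_rank_ratio (e + (e' - e) * 1) Q + 2 * (C' / real rk) / real (p ^ e)"
      proof (rule geometric_iterate[where s = "\<lambda>e. - split_rank_ratio e Q", OF p2])
        show "- split_rank_ratio e Q \<le> - split_rank_ratio (e + 1) Q + (C' / real rk) / real (p ^ e)" for e
          using step[OF Q, of e] by linarith
      qed (use C'(1) r in auto)
      then show ?thesis using that by simp
    qed
    then show "\<forall>\<^sub>F e' in inf at_top (principal exps). split_rank_ratio e' Q \<le> split_rank_ratio e Q + 2 * (C' / real rk) / real (p ^ e)"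
      unfolding eventually_inf_principal eventually_at_top_linorder by blast
    show "inf at_top (principal exps) \<noteq> bot"
      using infinite_multiples[OF zero_exps exps_add d0] by (intro inf_at_top_principal_nontrivial)
  qed
  define B where "B = C + 2 * (C' / real rk)"
  have "uniform_limit (Spec R) split_rank_ratio (s_at p R D) (inf at_top (principal exps))"
  proof (rule geometric_uniform_limit[OF p2, where C = B])
    fix e Q assume Q: "Q \<in> Spec R" and e: "e \<in> exps"
    have "0 \<le> C / real (p ^ e)" "0 \<le> 2 * (C' / real rk) / real (p ^ e)" using C(1) C'(1) r by auto
    moreover have "B / real (p ^ e) = C / real (p ^ e) + 2 * (C' / real rk) / real (p ^ e)"
      by (simp add: B_def add_divide_distrib)
    ultimately show "\<bar>split_rank_ratio e Q - s_at p R D Q\<bar> \<le> B / real (p ^ e)"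
      using C(2)[OF Q e] upper[OF Q, of e] by linarith
  qed
  show ?thesis
  proof (rule uniform_limitI)
    fix \<epsilon> :: real assume "0 < \<epsilon>"
    then have "\<forall>\<^sub>F e in inf at_top (principal exps). \<forall>Q\<in>Spec R. dist (split_rank_ratio e Q) (s_at p R D Q) < \<epsilon>"
      using \<open>uniform_limit (Spec R) split_rank_ratio (s_at p R D) (inf at_top (principal exps))\<close> by (rule uniform_limitD[rotated])
    moreover have "s_q_at p R D (p ^ e) Q = split_rank_ratio e Q" if "Q \<in> Spec R" for e Q
      using cartier_at_prime.s_q_at_eq[OF at_prime[OF that]] by (simp add: split_rank_ratio_def)
    ultimately have "\<forall>\<^sub>F e in inf at_top (principal exps). \<forall>Q\<in>Spec R. dist (s_q_at p R D (p ^ e) Q) (s_at p R D Q) < \<epsilon>"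
      by simp
    then show "\<forall>\<^sub>F q in inf at_top (principal (splitting_semigroup_domain p R D)).
        \<forall>Q\<in>Spec R. dist (s_q_at p R D q Q) (s_at p R D Q) < \<epsilon>"
      unfolding splitting_semigroup_domain_eq using p2 by (intro eventually_ppowers) auto
  qed
qed

end

theorem theorem6p4:
  fixes R :: "('a, 'm) ring_scheme" and p :: nat and D :: "nat \<Rightarrow> ('a \<Rightarrow> 'a) set"
  assumes "noetherian_domain R"
    and "Factorial_Ring.prime p" and "[p] \<cdot>\<^bsub>R\<^esub> \<one>\<^bsub>R\<^esub> = \<zero>\<^bsub>R\<^esub>"
    and "F_finite p R"
    and "cartier_subalgebra p R D"
  shows "lower_semicontinuous (zariski R) (s_at p R D) \<and>
    ((\<forall>P\<in>Spec R. \<forall>q\<in>ppowers p.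
        frobenius_power p (localization R P) (splitting_ideal R D q P) \<subseteq> splitting_ideal R D (q * p) P)
     \<longrightarrow> uniform_limit (Spec R) (s_q_at p R D) (s_at p R D)
           (inf at_top (principal (splitting_semigroup_domain p R D))))"
proof -
  interpret noetherian_domain R by fact
  interpret cartier_domain R p D
    by (intro cartier_domain.intro ffinite_domain.intro char_p_ring.intro char_p_ring_axioms.intro
      ffinite_domain_axioms.intro cartier_domain_axioms.intro assms is_cring)
  show ?thesis
  proof (intro conjI impI lower_semicontinuous_s_at uniform_limit_s_q_at)
    fix P e
    assume "\<forall>P\<in>Spec R. \<forall>q\<in>ppowers p.
        frobenius_power p (localization R P) (splitting_ideal R D q P) \<subseteq> splitting_ideal R D (q * p) P"
      and "P \<in> Spec R"
    then show "frobenius_power p (localization R P) (splitting_ideal R D (p ^ e) P) \<subseteq> splitting_ideal R D (p ^ e * p) P"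
      by simp
  qed
qed

end
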